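(* Let $m\in\mathbb{N}_0$ be such that $(m)_q^!\,b_m\neq 0$. Then the elements $$(\mathrm{ad}\,x_1)^{m-j}(P_j)\ \ (j\in \mathbb{J}_1,\ j\le m),\qquad (\mathrm{ad}\,x_1)^{m-n}(L_n)\ \ (n\in\mathbb{J}_2,\ n\le m),$$ form a basis of the vector space $\ker(\pi)\cap U_m$.
   Context: Let $\Bbbk$ be a field of characteristic $p$ ($p$ a prime or $0$), $\Bbbk^\times=\Bbbk\setminus\{0\}$, $\mathbb{N}_0=\{0,1,2,\dots\}$. Let $(V,c)$ be a two-dimensional braided vector space of diagonal type: $V$ has basis $x_1,x_2$ and $c(x_i\otimes x_j)=q_{ij}x_j\otimes x_i$ with $q_{ij}\in\Bbbk^\times$. Put $q=q_{11}$, $r=q_{12}q_{21}$, $s=q_{22}$. Let $\alpha_1,\alpha_2$ be the standard basis of $\mathbb{Z}^2$ and $\chi:\mathbb{Z}^2\times\mathbb{Z}^2\to\Bbbk^\times$ the bicharacter with $\chi(\alpha_i,\alpha_j)=q_{ij}$. The tensor algebra $T(V)$ is $\mathbb{Z}^2$-graded with $\deg x_i=\alpha_i$. Let $\mathcal{B}(V)$ be the Nichols algebra of $V$ and $\pi:T(V)\to\mathcal{B}(V)$ the canonical map. For $i\in\{1,2\}$ let $d_i$ be the skew-derivation of $T(V)$ with $d_i(x_j)=\delta_{ij}$ and $d_i(xy)=d_i(x)y+\chi(\deg x,\alpha_i)\,x\,d_i(y)$ for homogeneous $x$ and all $y$. (A homogeneous $y\in T(V)$ of positive degree lies in $\ker\pi$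 iff $d_1(y),d_2(y)\in\ker\pi$.) For homogeneous $y$, $(\mathrm{ad}\,x_1)(y)=x_1y-\chi(\alpha_1,\deg y)\,y\,x_1$, extended linearly. Notation: $(k)_t=1+t+\cdots+t^{k-1}$, $(k)_t^!=\prod_{i=1}^k(i)_t$, $b_k=\prod_{i=0}^{k-1}(1-q^ir)$. Define $u_0=x_2$, $u_k=x_1u_{k-1}-q^{k-1}q_{12}u_{k-1}x_1$ for $k\ge1$; $\hat u_k=\frac{1}{(k)_q^!b_k}u_k$ if $(k)_q^!b_k\ne0$, and $\hat u_k=0$ otherwise. Let $U_n=\bigoplus_{i=0}^n\Bbbk u_iu_{n-i}$ and $U_n'=\bigoplus_{i=0}^{n-1}\Bbbk u_iu_{n-i}$, subspaces of $T(V)$. For $k$ with $(k)_q^!b_k\neq0$ let $P_k=\sum_{i=0}^k(-q_{21})^iq^{i(i-1)/2}\hat u_i\hat u_{k-i}$. The set $\mathbb{J}=\mathbb{J}^p_{q,r,s}\subseteq\mathbb{N}_0$ is defined recursively: $j\in\mathbb{J}$ iff $q^{j(j-1)/2}(-r)^js=-1$ and for every $n\in\mathbb{J}$ with $n<j$ one has $\left(\frac{j-n}{2}\right)_{q^{n+j-1}r^2}=0$ if $j-n$ is even, and $(j-n)_{-q^{(n+j-1)/2}r}=0$ if $j-n$ is odd (equalities in $\Bbbk$). $\mathbb{J}_1$ is the set of $j\in\mathbb{J}$ such that $q^{j(j-1)/2}(-r)^js=-1$ and $q^{n+j-1}r^2\neq1$ for all $n\in\mathbb{J}$ with $n<j$.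 $\mathbb{J}_2$ is the set of $j\in\mathbb{J}$ for which there exists $n\in\mathbb{J}$ with $n<j$ such that: $q^{n+j-1}r^2=1$ and $2p\mid(j-n)$ if $j-n$ is even; $q^{(n+j-1)/2}r=-1$ and $p\mid(j-n)$ if $j-n$ is odd. (For $p=0$, $\mathbb{J}_2=\emptyset$.) Elements $L_n$: if $p$ is prime, $n\in\mathbb{J}_2$ and $(n)_q^!b_n\neq0$, there is a unique $j_n\in\mathbb{J}$ with $j_n<n$ and $q^{n+j_n-1}r^2=1$; it lies in $\mathbb{J}_1$. Then $L_n$ denotes the unique element of $U_n'\cap\ker(\pi)$ with $-q_{21}^{-1}d_1(L_n)=(\mathrm{ad}\,x_1)^{n-j_n-1}(P_{j_n})$. *)

theory Defs
  imports Complex_Main "HOL-Library.Poly_Mapping" "HOL-Library.Product_Plus"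
begin

section \<open>The tensor algebra\<close>

text \<open>
  \<open>X1\<close> and \<open>X2\<close> index the basis of \<open>V\<close>. Words in them form the free monoid, written additively so
  that the convolution product of \<^typ>\<open>'a \<Rightarrow>\<^sub>0 'b\<close> makes \<open>word \<Rightarrow>\<^sub>0 'k\<close> the free algebra \<open>T(V)\<close>,
  with \<open>0\<close> the empty word. \<open>T(V) \<otimes> T(V)\<close> has the pairs of words as basis and is
  \<open>word \<times> word \<Rightarrow>\<^sub>0 'k\<close>.
\<close>

datatype gen = X1 | X2

datatype word = Word (letters: "gen list")

instantiation word :: monoid_add
begin

definition zero_word :: word where "0 = Word []"

definition plus_word :: "word \<Rightarrow> word \<Rightarrow> word" where
  "v + w = Word (letters v @ letters w)"

instance
  by standard (simp_all add: zero_word_def plus_word_def)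

end

type_synonym 'k tensor_alg = "word \<Rightarrow>\<^sub>0 'k"
type_synonym 'k tensor_alg2 = "word \<times> word \<Rightarrow>\<^sub>0 'k"

definition scale :: "'k::field \<Rightarrow> ('a \<Rightarrow>\<^sub>0 'k) \<Rightarrow> ('a \<Rightarrow>\<^sub>0 'k)" where
  "scale c y = Poly_Mapping.map (\<lambda>a. c * a) y"

lemma lookup_scale [simp]: "Poly_Mapping.lookup (scale c y) w = c * Poly_Mapping.lookup y w"
  by (cases "Poly_Mapping.lookup y w = 0") (simp_all add: scale_def Poly_Mapping.map.rep_eq)

interpretation pm: vector_space "scale :: 'k::field \<Rightarrow> ('a \<Rightarrow>\<^sub>0 'k) \<Rightarrow> ('a \<Rightarrow>\<^sub>0 'k)"
  by standard (auto intro!: poly_mapping_eqI simp: lookup_add algebra_simps)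

text \<open>The linear extension of a map given on basis elements.\<close>

definition lin_ext :: "('a \<Rightarrow> ('b \<Rightarrow>\<^sub>0 'k)) \<Rightarrow> ('a \<Rightarrow>\<^sub>0 'k::field) \<Rightarrow> ('b \<Rightarrow>\<^sub>0 'k)" where
  "lin_ext f y = (\<Sum>w\<in>Poly_Mapping.keys y. scale (Poly_Mapping.lookup y w) (f w))"

definition mon :: "gen list \<Rightarrow> 'k::field tensor_alg" where
  "mon l = Poly_Mapping.single (Word l) 1"

abbreviation x1 :: "'k::field tensor_alg" where "x1 \<equiv> mon [X1]"
abbreviation x2 :: "'k::field tensor_alg" where "x2 \<equiv> mon [X2]"


section \<open>Grading and bicharacter\<close>

text \<open>\<open>Q i j\<close> is the entry \<open>q\<^sub>i\<^sub>j\<close> of the braiding matrix.\<close>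

type_synonym 'k braiding = "gen \<Rightarrow> gen \<Rightarrow> 'k"

fun alpha :: "gen \<Rightarrow> int \<times> int" where
  "alpha X1 = (1, 0)"
| "alpha X2 = (0, 1)"

definition deg :: "gen list \<Rightarrow> int \<times> int" where
  "deg l = (int (count_list l X1), int (count_list l X2))"

fun chi :: "'k::field braiding \<Rightarrow> int \<times> int \<Rightarrow> int \<times> int \<Rightarrow> 'k" where
  "chi Q (a1, a2) (b1, b2) =
     Q X1 X1 powi (a1 * b1) * Q X1 X2 powi (a1 * b2) *
     Q X2 X1 powi (a2 * b1) * Q X2 X2 powi (a2 * b2)"


section \<open>The Nichols algebra\<close>

definition tens :: "'k::field tensor_alg \<Rightarrow> 'k tensor_alg \<Rightarrow> 'k tensor_alg2" where
  "tens y z = (\<Sum>v\<in>Poly_Mapping.keys y. \<Sum>w\<in>Poly_Mapping.keys z.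
     Poly_Mapping.single (v, w) (Poly_Mapping.lookup y v * Poly_Mapping.lookup z w))"

text \<open>
  The product \<open>(a \<otimes> b)(c \<otimes> d) = \<chi>(deg b, deg c) ac \<otimes> bd\<close> of \<open>T(V) \<otimes> T(V)\<close> as an algebra in the
  braided category, that is, with \<open>b\<close> moved past \<open>c\<close> by the braiding of \<open>T(V)\<close> extending that of
  \<open>V\<close>.
\<close>

definition braided_times ::
    "'k::field braiding \<Rightarrow> 'k tensor_alg2 \<Rightarrow> 'k tensor_alg2 \<Rightarrow> 'k tensor_alg2" where
  "braided_times Q y z = (\<Sum>(a, b)\<in>Poly_Mapping.keys y. \<Sum>(c, d)\<in>Poly_Mapping.keys z.
     Poly_Mapping.single (a + c, b + d)
       (Poly_Mapping.lookup y (a, b) * Poly_Mapping.lookup z (c, d) * chi Q (deg (letters b)) (deg (letters c))))"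

text \<open>The algebra map \<open>\<Delta> : T(V) \<rightarrow> T(V) \<otimes> T(V)\<close> with \<open>\<Delta>(x\<^sub>i) = x\<^sub>i \<otimes> 1 + 1 \<otimes> x\<^sub>i\<close>.\<close>

fun comult_word :: "'k::field braiding \<Rightarrow> gen list \<Rightarrow> 'k tensor_alg2" where
  "comult_word Q [] = tens 1 1"
| "comult_word Q (i # l) =
     braided_times Q (tens (mon [i]) 1 + tens 1 (mon [i])) (comult_word Q l)"

definition comult :: "'k::field braiding \<Rightarrow> 'k tensor_alg \<Rightarrow> 'k tensor_alg2" where
  "comult Q = lin_ext (\<lambda>w. comult_word Q (letters w))"

definition counit :: "'k::field tensor_alg \<Rightarrow> 'k" where
  "counit y = Poly_Mapping.lookup y 0"

definition coideal :: "'k::field braiding \<Rightarrow> 'k tensor_alg set \<Rightarrow> bool" where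
  "coideal Q C \<longleftrightarrow> pm.subspace C \<and> (\<forall>y\<in>C. counit y = 0) \<and>
     (\<forall>y\<in>C. comult Q y \<in> pm.span {tens a b |a b. a \<in> C \<or> b \<in> C})"

definition degree_ge2 :: "'k::field tensor_alg set" where
  "degree_ge2 = {y. \<forall>w\<in>Poly_Mapping.keys y. 2 \<le> length (letters w)}"

text \<open>
  The defining ideal of the Nichols algebra \<open>\<B>(V)\<close>: the sum of all coideals of \<open>T(V)\<close> contained in
  \<open>\<Oplus>\<^sub>n\<^sub>\<ge>\<^sub>2 V\<^sup>\<otimes>\<^sup>n\<close>, which is the largest such coideal (lemmas below).
\<close>

definition nichols_ideal :: "'k::field braiding \<Rightarrow> 'k tensor_alg set" where
  "nichols_ideal Q = pm.span (\<Union>{C. coideal Q C \<and> C \<subseteq> degree_ge2})"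

text \<open>\<open>\<pi>\<close> sends \<open>y\<close> to its coset in \<open>\<B>(V) = T(V) / nichols_ideal\<close>.\<close>

definition nichols_proj :: "'k::field braiding \<Rightarrow> 'k tensor_alg \<Rightarrow> 'k tensor_alg set" where
  "nichols_proj Q y = {z. z - y \<in> nichols_ideal Q}"

definition ker_pi :: "'k::field braiding \<Rightarrow> 'k tensor_alg set" where
  "ker_pi Q = {y. nichols_proj Q y = nichols_proj Q 0}"

lemma ker_pi_eq: "ker_pi Q = nichols_ideal Q"
proof -
  have "y \<in> nichols_ideal Q \<longleftrightarrow> nichols_proj Q y = nichols_proj Q 0" for y
  proof
    assume "nichols_proj Q y = nichols_proj Q 0"
    moreover have "y \<in> nichols_proj Q y"
      by (simp add: nichols_proj_def nichols_ideal_def pm.span_zero)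
    ultimately show "y \<in> nichols_ideal Q"
      by (simp add: nichols_proj_def)
  next
    assume y: "y \<in> nichols_ideal Q"
    have "z - y \<in> nichols_ideal Q \<longleftrightarrow> z \<in> nichols_ideal Q" for z
      using y pm.span_diff[of z _ y] pm.span_add[of "z - y" _ y]
      unfolding nichols_ideal_def by auto
    then show "nichols_proj Q y = nichols_proj Q 0"
      by (simp add: nichols_proj_def)
  qed
  then show ?thesis
    by (auto simp: ker_pi_def)
qed

lemma lin_ext_superset:
  assumes "finite S" "Poly_Mapping.keys y \<subseteq> S"
  shows "lin_ext f y = (\<Sum>w\<in>S. scale (Poly_Mapping.lookup y w) (f w))"
  unfolding lin_ext_def using assms
  by (intro sum.mono_neutral_left) (auto simp: in_keys_iff)

lemma lin_ext_add: "lin_ext f (y + z) = lin_ext f y + lin_ext f z"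
proof -
  let ?S = "Poly_Mapping.keys y \<union> Poly_Mapping.keys z"
  have "Poly_Mapping.keys (y + z) \<subseteq> ?S"
    by (rule Poly_Mapping.keys_add)
  then show ?thesis
    by (simp add: lin_ext_superset[of ?S] lookup_add pm.scale_left_distrib sum.distrib)
qed

lemma lin_ext_scale: "lin_ext f (scale c y) = scale c (lin_ext f y)"
proof -
  have "Poly_Mapping.keys (scale c y) \<subseteq> Poly_Mapping.keys y"
    by (auto simp: in_keys_iff)
  then show ?thesis
    by (simp add: lin_ext_superset[of "Poly_Mapping.keys y"] pm.scale_sum_right)
qed

lemma nichols_ideal_subset: "nichols_ideal Q \<subseteq> (degree_ge2 :: 'k::field tensor_alg set)"
proof -
  have "pm.subspace (degree_ge2 :: 'k tensor_alg set)"
    unfolding degree_ge2_def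
  proof (rule pm.subspaceI, goal_cases)
    case (2 x y)
    then show ?case
      using Poly_Mapping.keys_add[of x y] by blast
  qed (auto simp: in_keys_iff)
  then show ?thesis
    unfolding nichols_ideal_def by (intro pm.span_minimal) auto
qed

lemma coideal_nichols_ideal: "coideal Q (nichols_ideal Q)"
proof -
  let ?I = "nichols_ideal Q"
  let ?D = "pm.span {tens a b |a b. a \<in> ?I \<or> b \<in> ?I}"
  have "pm.subspace {y. comult Q y \<in> ?D}"
  proof (rule pm.subspaceI)
    show "0 \<in> {y. comult Q y \<in> ?D}"
      by (simp add: comult_def lin_ext_def pm.span_zero)
  qed (auto simp: comult_def lin_ext_add lin_ext_scale pm.span_add pm.span_scale)
  moreover have "\<Union>{C. coideal Q C \<and> C \<subseteq> degree_ge2} \<subseteq> {y. comult Q y \<in> ?D}"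
  proof safe
    fix C y assume C: "coideal Q C" "C \<subseteq> degree_ge2" and "y \<in> C"
    have "C \<subseteq> ?I"
      unfolding nichols_ideal_def using C by (blast intro: pm.span_base)
    then have "pm.span {tens a b |a b. a \<in> C \<or> b \<in> C} \<subseteq> ?D"
      by (intro pm.span_mono) blast
    then show "comult Q y \<in> ?D"
      using C \<open>y \<in> C\<close> unfolding coideal_def by blast
  qed
  ultimately have "?I \<subseteq> {y. comult Q y \<in> ?D}"
    unfolding nichols_ideal_def[of Q] by (intro pm.span_minimal) (auto simp: nichols_ideal_def)
  moreover have "counit y = 0" if "y \<in> ?I" for y
  proof -
    have "(0::word) \<notin> Poly_Mapping.keys y"
      using that nichols_ideal_subset[of Q] by (fastforce simp: degree_ge2_def zero_word_def)
    then show ?thesis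
      by (simp add: counit_def in_keys_iff)
  qed
  moreover have "pm.subspace ?I"
    by (simp add: nichols_ideal_def)
  ultimately show ?thesis
    by (auto simp: coideal_def)
qed

lemma nichols_ideal_greatest:
  "coideal Q C \<Longrightarrow> C \<subseteq> degree_ge2 \<Longrightarrow> C \<subseteq> nichols_ideal Q"
  unfolding nichols_ideal_def by (blast intro: pm.span_base)


section \<open>Skew-derivations and the adjoint action\<close>

fun deriv_word :: "'k::field braiding \<Rightarrow> gen \<Rightarrow> gen list \<Rightarrow> 'k tensor_alg" where
  "deriv_word Q i [] = 0"
| "deriv_word Q i (j # l) =
     (if j = i then mon l else 0) + scale (chi Q (alpha j) (alpha i)) (mon [j] * deriv_word Q i l)"

text \<open>\<open>deriv Q i\<close> is \<open>d\<^sub>i\<close>; the Leibniz rule is \<open>deriv_Leibniz\<close> below.\<close>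

definition deriv :: "'k::field braiding \<Rightarrow> gen \<Rightarrow> 'k tensor_alg \<Rightarrow> 'k tensor_alg" where
  "deriv Q i = lin_ext (\<lambda>w. deriv_word Q i (letters w))"

lemma scale_eq_times: "scale c y = Poly_Mapping.single 0 c * (y :: 'a::monoid_add \<Rightarrow>\<^sub>0 'k::field)"
  by (simp add: scale_def mult_map_scale_conv_mult)

lemma scale_mult_left: "scale c y * z = scale c (y * (z :: 'a::monoid_add \<Rightarrow>\<^sub>0 'k::field))"
  by (simp add: scale_eq_times mult.assoc)

lemma sum_scale_mon:
  "y = (\<Sum>w\<in>Poly_Mapping.keys y. scale (Poly_Mapping.lookup y w) (mon (letters w)))"
proof (rule poly_mapping_eqI)
  fix v
  have "Poly_Mapping.lookup y v = (\<Sum>w\<in>Poly_Mapping.keys y. if w = v then Poly_Mapping.lookup y w else 0)"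
    by (simp add: in_keys_iff)
  also have "\<dots> = Poly_Mapping.lookup (\<Sum>w\<in>Poly_Mapping.keys y. scale (Poly_Mapping.lookup y w) (mon (letters w))) v"
    unfolding lookup_sum by (intro sum.cong) (auto simp: mon_def lookup_single when_def)
  finally show "Poly_Mapping.lookup y v = \<dots>" .
qed

lemma scale_mult_right: "y * scale c z = scale c (y * z)" for y :: "'k::field tensor_alg"
proof -
  have mon: "mon l * Poly_Mapping.single 0 c = scale c (mon l)" for l
    by (simp add: scale_eq_times mon_def mult_single)
  have "y * Poly_Mapping.single 0 c =
      (\<Sum>w\<in>Poly_Mapping.keys y. scale c (scale (Poly_Mapping.lookup y w) (mon (letters w))))"
    by (subst sum_scale_mon[of y])
      (simp add: sum_distrib_right scale_mult_left mon mult.commute)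
  also have "\<dots> = scale c y"
    by (simp flip: pm.scale_sum_right sum_scale_mon del: pm.scale_scale)
  finally show ?thesis
    by (simp add: scale_eq_times flip: mult.assoc)
qed

lemma lin_ext_sum: "lin_ext f (\<Sum>x\<in>A. g x) = (\<Sum>x\<in>A. lin_ext f (g x))"
proof (induction A rule: infinite_finite_induct)
  case (insert x A)
  then show ?case by (simp add: lin_ext_add)
qed (simp_all add: lin_ext_def)

lemma deriv_mon: "deriv Q i (mon l) = deriv_word Q i l"
  by (simp add: deriv_def lin_ext_def mon_def)

lemma deriv_gen: "deriv Q i (mon [j]) = (if i = j then 1 else 0)"
  by (auto simp: deriv_mon) (simp add: mon_def flip: zero_word_def)

lemma mon_times: "mon k * mon l = mon (k @ l)"
  by (simp add: mon_def mult_single plus_word_def)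

lemma chi_add_left:
  assumes "\<And>i j. Q i j \<noteq> 0"
  shows "chi Q (a + b) c = chi Q a c * chi Q b c"
  using assms by (cases a; cases b; cases c) (simp add: distrib_right power_int_add)

lemma deriv_word_append:
  assumes "\<And>i j. Q i j \<noteq> 0"
  shows "deriv_word Q i (k @ l) =
    deriv_word Q i k * mon l + scale (chi Q (deg k) (alpha i)) (mon k * deriv_word Q i l)"
proof (induction k)
  case Nil
  have "mon [] = (1 :: 'a tensor_alg)"
    by (simp add: mon_def flip: zero_word_def)
  then show ?case
    by (cases i) (simp_all add: deg_def)
next
  case (Cons j k)
  have "deg (j # k) = alpha j + deg k"
    by (cases j) (simp_all add: deg_def)
  moreover have "mon [j] * (mon k * y) = mon (j # k) * y" for y :: "'a tensor_alg"
    by (simp add: mon_times flip: mult.assoc)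
  ultimately show ?case
    using Cons
    by (simp add: chi_add_left[OF assms] scale_mult_left scale_mult_right distrib_left distrib_right
        mon_times pm.scale_right_distrib mult.assoc)
qed

lemma deriv_Leibniz:
  assumes Q: "\<And>i j. Q i j \<noteq> 0" and x: "\<forall>w\<in>Poly_Mapping.keys x. deg (letters w) = a"
  shows "deriv Q i (x * y) = deriv Q i x * y + scale (chi Q a (alpha i)) (x * deriv Q i y)"
proof -
  let ?s = "\<lambda>y w. scale (Poly_Mapping.lookup y w)"
  let ?k = "Poly_Mapping.keys"
  have d: "deriv Q i y = (\<Sum>w\<in>?k y. ?s y w (deriv_word Q i (letters w)))" for y
    by (simp add: deriv_def lin_ext_def)
  have dsum: "deriv Q i (\<Sum>v\<in>A. g v) = (\<Sum>v\<in>A. deriv Q i (g v))" for g :: "word \<Rightarrow> 'a tensor_alg" and A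
    by (simp add: deriv_def lin_ext_sum)
  have dscale: "deriv Q i (scale c y) = scale c (deriv Q i y)" for c y
    by (simp add: deriv_def lin_ext_scale)
  have "x * y = (\<Sum>v\<in>?k x. \<Sum>w\<in>?k y. ?s x v (?s y w (mon (letters v @ letters w))))"
    by (subst sum_scale_mon[of x], subst sum_scale_mon[of y])
      (simp add: sum_product scale_mult_left scale_mult_right mon_times mult.commute)
  then have "deriv Q i (x * y) =
      (\<Sum>v\<in>?k x. \<Sum>w\<in>?k y. ?s x v (?s y w (deriv_word Q i (letters v @ letters w))))"
    by (simp add: dsum dscale deriv_mon)
  also have "\<dots> = (\<Sum>v\<in>?k x. \<Sum>w\<in>?k y.
        ?s x v (deriv_word Q i (letters v)) * ?s y w (mon (letters w)))
      + (\<Sum>v\<in>?k x. \<Sum>w\<in>?k y. scale (chi Q a (alpha i))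
        (?s x v (mon (letters v)) * ?s y w (deriv_word Q i (letters w))))"
    unfolding sum.distrib[symmetric]
    by (intro sum.cong refl)
      (simp add: deriv_word_append[OF Q] x scale_mult_left scale_mult_right
        pm.scale_right_distrib mult.commute mult.left_commute)
  also have "\<dots> = deriv Q i x * (\<Sum>w\<in>?k y. ?s y w (mon (letters w)))
      + scale (chi Q a (alpha i)) ((\<Sum>v\<in>?k x. ?s x v (mon (letters v))) * deriv Q i y)"
    by (simp add: d sum_product pm.scale_sum_right)
  finally show ?thesis
    by (simp flip: sum_scale_mon)
qed

definition ad_x1 :: "'k::field braiding \<Rightarrow> 'k tensor_alg \<Rightarrow> 'k tensor_alg" where
  "ad_x1 Q = lin_ext (\<lambda>w. x1 * mon (letters w)
     - scale (chi Q (alpha X1) (deg (letters w))) (mon (letters w) * x1))"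


section \<open>The elements and spaces in degree \<open>n\<alpha>\<^sub>1 + 2\<alpha>\<^sub>2\<close>\<close>

definition qnum :: "nat \<Rightarrow> 'k::field \<Rightarrow> 'k" where
  "qnum k t = (\<Sum>i<k. t ^ i)"

definition qfact :: "nat \<Rightarrow> 'k::field \<Rightarrow> 'k" where
  "qfact k t = (\<Prod>i=1..k. qnum i t)"

definition bcoef :: "'k::field \<Rightarrow> 'k \<Rightarrow> nat \<Rightarrow> 'k" where
  "bcoef q r k = (\<Prod>i<k. 1 - q ^ i * r)"

abbreviation qq :: "'k::field braiding \<Rightarrow> 'k" where "qq Q \<equiv> Q X1 X1"
abbreviation rr :: "'k::field braiding \<Rightarrow> 'k" where "rr Q \<equiv> Q X1 X2 * Q X2 X1"
abbreviation ss :: "'k::field braiding \<Rightarrow> 'k" where "ss Q \<equiv> Q X2 X2"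

fun u :: "'k::field braiding \<Rightarrow> nat \<Rightarrow> 'k tensor_alg" where
  "u Q 0 = x2"
| "u Q (Suc k) = x1 * u Q k - scale (qq Q ^ k * Q X1 X2) (u Q k * x1)"

definition uhat :: "'k::field braiding \<Rightarrow> nat \<Rightarrow> 'k tensor_alg" where
  "uhat Q k =
     (let c = qfact k (qq Q) * bcoef (qq Q) (rr Q) k
      in if c \<noteq> 0 then scale (1 / c) (u Q k) else 0)"

definition U :: "'k::field braiding \<Rightarrow> nat \<Rightarrow> 'k tensor_alg set" where
  "U Q n = pm.span ((\<lambda>i. u Q i * u Q (n - i)) ` {0..n})"

definition U' :: "'k::field braiding \<Rightarrow> nat \<Rightarrow> 'k tensor_alg set" where
  "U' Q n = pm.span ((\<lambda>i. u Q i * u Q (n - i)) ` {0..<n})"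

definition P :: "'k::field braiding \<Rightarrow> nat \<Rightarrow> 'k tensor_alg" where
  "P Q k = (\<Sum>i=0..k. scale ((- Q X2 X1) ^ i * qq Q ^ (i * (i - 1) div 2))
     (uhat Q i * uhat Q (k - i)))"


section \<open>The index sets and the elements \<open>L\<^sub>n\<close>\<close>

function in_J :: "'k::field \<Rightarrow> 'k \<Rightarrow> 'k \<Rightarrow> nat \<Rightarrow> bool" where
  "in_J q r s j \<longleftrightarrow>
     q ^ (j * (j - 1) div 2) * (- r) ^ j * s = - 1 \<and>
     (\<forall>n\<in>{..<j}. in_J q r s n \<longrightarrow>
        (if even (j - n) then qnum ((j - n) div 2) (q ^ (n + j - 1) * r ^ 2) = 0
         else qnum (j - n) (- (q ^ ((n + j - 1) div 2)) * r) = 0))"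
  by pat_completeness auto
termination
  by (relation "measure (\<lambda>(q, r, s, j). j)") auto

declare in_J.simps [simp del]

definition J :: "'k::field \<Rightarrow> 'k \<Rightarrow> 'k \<Rightarrow> nat set" where
  "J q r s = {j. in_J q r s j}"

definition J1 :: "'k::field \<Rightarrow> 'k \<Rightarrow> 'k \<Rightarrow> nat set" where
  "J1 q r s = {j \<in> J q r s. q ^ (j * (j - 1) div 2) * (- r) ^ j * s = - 1 \<and>
     (\<forall>n \<in> J q r s. n < j \<longrightarrow> q ^ (n + j - 1) * r ^ 2 \<noteq> 1)}"

text \<open>
  In characteristic \<open>0\<close> this is empty, since there the divisibility conditions would say \<open>n = j\<close>.
\<close>

definition J2 :: "'k::field \<Rightarrow> 'k \<Rightarrow> 'k \<Rightarrow> nat set" where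
  "J2 q r s = {j \<in> J q r s. \<exists>n \<in> J q r s. n < j \<and>
     (if even (j - n) then q ^ (n + j - 1) * r ^ 2 = 1 \<and> 2 * CHAR('k) dvd j - n
      else q ^ ((n + j - 1) div 2) * r = - 1 \<and> CHAR('k) dvd j - n)}"

definition j_of :: "'k::field braiding \<Rightarrow> nat \<Rightarrow> nat" where
  "j_of Q n = (THE j. j \<in> J (qq Q) (rr Q) (ss Q) \<and> j < n \<and> qq Q ^ (n + j - 1) * rr Q ^ 2 = 1)"

definition L :: "'k::field braiding \<Rightarrow> nat \<Rightarrow> 'k tensor_alg" where
  "L Q n = (THE y. y \<in> U' Q n \<inter> ker_pi Q \<and>
     scale (- inverse (Q X2 X1)) (deriv Q X1 y) =
       (ad_x1 Q ^^ (n - j_of Q n - 1)) (P Q (j_of Q n)))"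


section \<open>Bases given as families\<close>

definition basis_family :: "('i \<Rightarrow> ('a \<Rightarrow>\<^sub>0 'k::field)) \<Rightarrow> 'i set \<Rightarrow> ('a \<Rightarrow>\<^sub>0 'k) set \<Rightarrow> bool" where
  "basis_family f A W \<longleftrightarrow> inj_on f A \<and> pm.independent (f ` A) \<and> pm.span (f ` A) = W"

end

theory Submission
  imports Defs "HOL-Computational_Algebra.Polynomial"
begin

text \<open>
  Write \<open>K\<^sub>m\<close> for the space of relations \<open>ker \<pi> \<inter> U\<^sub>m\<close> (\<open>rels m\<close> below), for \<open>m\<close> with
  \<open>(m)\<^sub>q\<^sup>! b\<^sub>m \<noteq> 0\<close>. The proof compares \<open>K\<^sub>m\<close> with \<open>K\<^sub>m\<^sub>+\<^sub>1\<close> by two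
  operators, \<open>ad x\<^sub>1\<close> upwards and \<open>d\<^sub>1\<close> downwards.

  Membership in \<open>ker \<pi>\<close> can be tested with the skew-derivations (\<open>ker_pi_iff\<close>), because \<open>ker \<pi>\<close> is
  the set of all elements annihilated by the counit after any sequence of skew-derivations. In the
  coordinates \<open>Phi m\<close>, a suitable rescaling of the products \<open>uhat\<^sub>i uhat\<^sub>m\<^sub>-\<^sub>i\<close>, the operator \<open>d\<^sub>1\<close>
  becomes a \<open>q\<close>-difference operator, and \<open>d\<^sub>2\<close> contributes the single boundary condition
  \<open>c\<^sub>0 + \<mu>\<^sub>m c\<^sub>m = 0\<close>. So the kernel of \<open>d\<^sub>1\<close> on \<open>U\<^sub>m\<close> is the line through \<open>P\<^sub>m\<close>, and \<open>P\<^sub>m\<close> is a relation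
  iff \<open>\<mu>\<^sub>m = -1\<close>, which is the first condition for \<open>m \<in> \<J>\<close>. On the other hand \<open>ad x\<^sub>1\<close> is injective
  on \<open>U\<^sub>m\<close> and maps relations to relations. Hence \<open>dim K\<^sub>m\<^sub>+\<^sub>1\<close> is \<open>dim K\<^sub>m\<close> or \<open>dim K\<^sub>m + 1\<close>, and it is
  the latter iff \<open>\<mu>\<^sub>m\<^sub>+\<^sub>1 = -1\<close> and \<open>d\<^sub>1\<close> maps \<open>K\<^sub>m\<^sub>+\<^sub>1\<close> onto \<open>K\<^sub>m\<close>.

  The operators satisfy \<open>d\<^sub>1 \<circ> ad x\<^sub>1 = q ad x\<^sub>1 \<circ> d\<^sub>1 + (1 - q\<^bsup>2m\<^esup> r\<^sup>2)\<close> on \<open>U\<^sub>m\<close>, as in the representation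
  theory of quantum \<open>sl\<^sub>2\<close>. If \<open>n < m\<close> and \<open>\<mu>\<^sub>n = \<mu>\<^sub>m = -1\<close>, then \<open>(ad x\<^sub>1)\<^bsup>m-n-1\<^esup>(P\<^sub>n)\<close> lies in
  \<open>d\<^sub>1(K\<^sub>m)\<close> iff one weighted sum of its coordinates vanishes, and the explicit value of this sum shows
  that this is the recursive condition on the pair \<open>n, m\<close> in the definition of \<open>\<J>\<close>
  (\<open>ad_pow_P_in_d1_image_iff\<close>). Thus surjectivity fails if \<open>\<mu>\<^sub>m = -1\<close> and \<open>m \<notin> \<J>\<close>. For \<open>m \<in> \<J>\<close> an induction along
  the kernels of the powers of \<open>d\<^sub>1\<close> shows surjectivity (\<open>d1_surj\<close>). So the dimension grows exactly at
  the elements of \<open>\<J>\<close>.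

  It remains to name a new relation for each \<open>m \<in> \<J>\<close>, outside the image of \<open>ad x\<^sub>1\<close>. If
  \<open>q\<^bsup>n+m-1\<^esup> r\<^sup>2 \<noteq> 1\<close> for all smaller \<open>n \<in> \<J>\<close>, that is \<open>m \<in> \<J>\<^sub>1\<close>, then \<open>P\<^sub>m\<close> is new
  (\<open>P_not_in_ad_image\<close>). Otherwise \<open>m \<in> \<J>\<^sub>2\<close>, and \<open>P\<^sub>m\<close> is a multiple of \<open>(ad x\<^sub>1)\<^bsup>m-n\<^esup>(P\<^sub>n)\<close>; surjectivity of
  \<open>d\<^sub>1\<close> then provides \<open>L\<^sub>m\<close>, which is new (\<open>L_not_in_ad_image\<close>). Both facts come from applying powers
  of \<open>d\<^sub>1\<close> to a supposed preimage under \<open>ad x\<^sub>1\<close>. The basis follows by induction on \<open>m\<close>.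
\<close>

section \<open>Linear maps on the tensor algebra\<close>

abbreviation lin :: "(('a \<Rightarrow>\<^sub>0 'k::field) \<Rightarrow> ('b \<Rightarrow>\<^sub>0 'k)) \<Rightarrow> bool" where
  "lin \<equiv> Vector_Spaces.linear scale scale"

interpretation pmp: vector_space_pair
  "scale :: 'k::field \<Rightarrow> ('a \<Rightarrow>\<^sub>0 'k) \<Rightarrow> ('a \<Rightarrow>\<^sub>0 'k)" "scale :: 'k \<Rightarrow> ('b \<Rightarrow>\<^sub>0 'k) \<Rightarrow> ('b \<Rightarrow>\<^sub>0 'k)"
  ..

lemma linI:
  assumes "\<And>x y. f (x + y) = f x + f y" "\<And>c x. f (scale c x) = scale c (f x)"
  shows "lin f"
  using assms unfolding Vector_Spaces.linear_iff by (auto intro: pm.vector_space_axioms)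

lemma lin_lin_ext [simp]: "lin (lin_ext f)"
  by (rule linI) (simp_all add: lin_ext_add lin_ext_scale)

lemma lin_comp: "lin f \<Longrightarrow> lin g \<Longrightarrow> lin (\<lambda>y. f (g y))"
  by (rule linI) (simp_all add: pmp.linear_add pmp.linear_scale)

lemma lin_deriv [simp]: "lin (deriv Q i)"
  unfolding deriv_def by simp

lemma lin_ad_x1 [simp]: "lin (ad_x1 Q)"
  unfolding ad_x1_def by simp

lemma lin_funpow:
  fixes f :: "('a \<Rightarrow>\<^sub>0 'k::field) \<Rightarrow> ('a \<Rightarrow>\<^sub>0 'k)"
  shows "lin f \<Longrightarrow> lin (f ^^ k)"
proof (induction k)
  case 0 show ?case by (rule linI) simp_all
next
  case (Suc k) then show ?case
    using lin_comp[of f "f ^^ k"] by (simp add: o_def)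
qed

lemma lin_fold_deriv: "lin (fold (deriv Q) l)"
proof (induction l)
  case Nil show ?case by (rule linI) simp_all
next
  case (Cons i l) then show ?case
    using lin_comp[of "fold (deriv Q) l" "deriv Q i"] by (simp add: o_def)
qed

lemma lin_mult_left [simp]: "lin (\<lambda>y. (a :: 'k::field tensor_alg) * y)"
  by (rule linI) (simp_all add: distrib_left scale_mult_right)

lemma lin_mult_right [simp]: "lin (\<lambda>y. y * (a :: 'k::field tensor_alg))"
  by (rule linI) (simp_all add: distrib_right scale_mult_left)

lemma mon_Nil: "mon [] = 1"
  by (simp add: mon_def flip: zero_word_def)

lemma lin_ext_single [simp]: "lin_ext f (Poly_Mapping.single w 1) = f w"
  by (simp add: lin_ext_def)

lemma lin_ext_mon [simp]: "lin_ext f (mon l) = f (Word l)"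
  by (simp add: mon_def)

lemma expand_single: "y = (\<Sum>w\<in>Poly_Mapping.keys y. scale (Poly_Mapping.lookup y w) (Poly_Mapping.single w 1))"
proof (rule poly_mapping_eqI)
  fix v
  have "Poly_Mapping.lookup y v = (\<Sum>w\<in>Poly_Mapping.keys y. if w = v then Poly_Mapping.lookup y w else 0)"
    by (simp add: in_keys_iff)
  also have "\<dots> = Poly_Mapping.lookup (\<Sum>w\<in>Poly_Mapping.keys y. scale (Poly_Mapping.lookup y w) (Poly_Mapping.single w 1)) v"
    unfolding lookup_sum by (intro sum.cong) (auto simp: lookup_single when_def)
  finally show "Poly_Mapping.lookup y v = \<dots>" .
qed

lemma lin_eqI:
  assumes "lin f" "lin g" "\<And>w. f (Poly_Mapping.single w 1) = g (Poly_Mapping.single w 1)"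
  shows "f y = g y"
  by (subst (1 2) expand_single[of y])
    (simp add: pmp.linear_sum[OF assms(1)] pmp.linear_sum[OF assms(2)]
      pmp.linear_scale[OF assms(1)] pmp.linear_scale[OF assms(2)] assms(3))

lemma lin_eq_monI:
  assumes "lin f" "lin g" "\<And>l. f (mon l) = g (mon l)"
  shows "f y = g y"
  using assms(1,2)
proof (rule lin_eqI)
  fix w show "f (Poly_Mapping.single w 1) = g (Poly_Mapping.single w 1)"
    using assms(3)[of "letters w"] by (simp add: mon_def)
qed

lemma lin_eq_tensI:
  assumes "lin f" "lin g"
    "\<And>k l. f (Poly_Mapping.single (Word k, Word l) 1) = g (Poly_Mapping.single (Word k, Word l) 1)"
  shows "f y = g y"
  using assms(1,2)
proof (rule lin_eqI)
  fix w show "f (Poly_Mapping.single w 1) = g (Poly_Mapping.single w 1)"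
    by (cases w; cases "fst w"; cases "snd w") (use assms(3) in auto)
qed

lemma subspace_vimage:
  "lin f \<Longrightarrow> pm.subspace W \<Longrightarrow> pm.subspace {y. f y \<in> W}"
  by (rule pm.subspaceI)
    (auto simp: pmp.linear_0 pmp.linear_add pmp.linear_scale pm.subspace_0 pm.subspace_add pm.subspace_scale)

section \<open>The tensor square\<close>

lemma tens_superset:
  assumes "finite S" "finite R" "Poly_Mapping.keys y \<subseteq> S" "Poly_Mapping.keys z \<subseteq> R"
  shows "tens y z = (\<Sum>v\<in>S. \<Sum>w\<in>R. scale (Poly_Mapping.lookup y v * Poly_Mapping.lookup z w) (Poly_Mapping.single (v, w) 1))"
proof -
  have e: "Poly_Mapping.single a c = scale c (Poly_Mapping.single a 1)" for a :: "word \<times> word" and c :: 'a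
    by (rule poly_mapping_eqI) (simp add: lookup_single when_def)
  have "tens y z = (\<Sum>v\<in>Poly_Mapping.keys y. \<Sum>w\<in>R. scale (Poly_Mapping.lookup y v * Poly_Mapping.lookup z w) (Poly_Mapping.single (v, w) 1))"
    unfolding tens_def by (subst e, intro sum.cong refl sum.mono_neutral_left)
      (use assms in \<open>auto simp: in_keys_iff\<close>)
  also have "\<dots> = (\<Sum>v\<in>S. \<Sum>w\<in>R. scale (Poly_Mapping.lookup y v * Poly_Mapping.lookup z w) (Poly_Mapping.single (v, w) 1))"
    by (intro sum.mono_neutral_left) (use assms in \<open>auto simp: in_keys_iff\<close>)
  finally show ?thesis .
qed

lemma lin_tens_left: "lin (\<lambda>y :: 'k::field tensor_alg. tens y z)"
proof (rule linI)
  fix x y :: "'k tensor_alg"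
  show "tens (x + y) z = tens x z + tens y z"
    using Poly_Mapping.keys_add[of x y]
    by (simp add: tens_superset[of "Poly_Mapping.keys x \<union> Poly_Mapping.keys y" "Poly_Mapping.keys z"]
        lookup_add distrib_right pm.scale_left_distrib sum.distrib)
next
  fix c and y :: "'k tensor_alg"
  have "Poly_Mapping.keys (scale c y) \<subseteq> Poly_Mapping.keys y"
    by (auto simp: in_keys_iff)
  then show "tens (scale c y) z = scale c (tens y z)"
    by (simp add: tens_superset[of "Poly_Mapping.keys y" "Poly_Mapping.keys z"] pm.scale_sum_right mult.assoc)
qed

lemma lin_tens_right: "lin (\<lambda>z :: 'k::field tensor_alg. tens y z)"
proof (rule linI)
  fix x z :: "'k tensor_alg"
  show "tens y (x + z) = tens y x + tens y z"
    using Poly_Mapping.keys_add[of x z]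
    by (simp add: tens_superset[of "Poly_Mapping.keys y" "Poly_Mapping.keys x \<union> Poly_Mapping.keys z"]
        lookup_add distrib_left pm.scale_left_distrib sum.distrib)
next
  fix c and z :: "'k tensor_alg"
  have "Poly_Mapping.keys (scale c z) \<subseteq> Poly_Mapping.keys z"
    by (auto simp: in_keys_iff)
  then show "tens y (scale c z) = scale c (tens y z)"
    by (simp add: tens_superset[of "Poly_Mapping.keys y" "Poly_Mapping.keys z"] pm.scale_sum_right mult.left_commute)
qed

lemmas tens_add_left = pmp.linear_add[OF lin_tens_left]
lemmas tens_add_right = pmp.linear_add[OF lin_tens_right]
lemmas tens_scale_left = pmp.linear_scale[OF lin_tens_left]
lemmas tens_scale_right = pmp.linear_scale[OF lin_tens_right]

lemma tens_mon: "tens (mon k) (mon l) = Poly_Mapping.single (Word k, Word l) 1"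
  by (simp add: tens_def mon_def)

definition on_left :: "('k::field tensor_alg \<Rightarrow> 'k tensor_alg) \<Rightarrow> 'k tensor_alg2 \<Rightarrow> 'k tensor_alg2" where
  "on_left f = lin_ext (\<lambda>(a, b). tens (f (mon (letters a))) (mon (letters b)))"

text \<open>
  The map \<open>p \<otimes> id\<close> to \<open>k \<otimes> T(V) = T(V)\<close>, for a linear form \<open>p\<close>.
\<close>

definition contract :: "('k::field tensor_alg \<Rightarrow> 'k) \<Rightarrow> 'k tensor_alg2 \<Rightarrow> 'k tensor_alg" where
  "contract p = lin_ext (\<lambda>(a, b). scale (p (mon (letters a))) (mon (letters b)))"

lemma lin_on_left [simp]: "lin (on_left f)"
  unfolding on_left_def by simp

lemma lin_contract [simp]: "lin (contract p)"
  unfolding contract_def by simp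

lemma on_left_tens:
  assumes "lin f"
  shows "on_left f (tens y z) = tens (f y) z"
proof -
  have "on_left f (tens y (mon l)) = tens (f y) (mon l)" for l
    by (rule lin_eq_monI[where y = y], rule lin_comp[OF lin_on_left lin_tens_left],
        rule lin_comp[OF lin_tens_left assms])
      (simp add: on_left_def tens_mon)
  then show ?thesis
    by (rule_tac lin_eq_monI[where y = z], rule_tac lin_comp[OF lin_on_left lin_tens_right])
      (auto intro: lin_tens_right)
qed

lemma contract_tens:
  assumes "\<And>x y. p (x + y) = p x + p y" "\<And>c x. p (scale c x) = c * p x"
  shows "contract p (tens y z) = scale (p y) z"
proof -
  have "contract p (tens y (mon l)) = scale (p y) (mon l)" for l
    by (rule lin_eq_monI[where y = y], rule lin_comp[OF lin_contract lin_tens_left], rule linI)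
      (auto simp: contract_def tens_mon assms pm.scale_left_distrib)
  then show ?thesis
    by (rule_tac lin_eq_monI[where y = z], rule_tac lin_comp[OF lin_contract lin_tens_right], rule_tac linI)
      (auto simp: pm.scale_right_distrib mult.commute)
qed

section \<open>The Nichols ideal as the common kernel of iterated skew-derivations\<close>

text \<open>
  Left multiplication by \<open>x\<^sub>i \<otimes> 1 + 1 \<otimes> x\<^sub>i\<close> in the braided tensor square; see \<open>braided_times_gen\<close>.
\<close>

definition mult_gen :: "'k::field braiding \<Rightarrow> gen \<Rightarrow> 'k tensor_alg2 \<Rightarrow> 'k tensor_alg2" where
  "mult_gen Q i = lin_ext (\<lambda>(a, b). tens (mon (i # letters a)) (mon (letters b)) +
     scale (chi Q (alpha i) (deg (letters a))) (tens (mon (letters a)) (mon (i # letters b))))"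

lemma lin_mult_gen [simp]: "lin (mult_gen Q i)"
  unfolding mult_gen_def by simp

lemma mult_gen_tens_mon:
  "mult_gen Q i (tens (mon k) (mon l)) = tens (mon (i # k)) (mon l) +
     scale (chi Q (alpha i) (deg k)) (tens (mon k) (mon (i # l)))"
  by (simp add: mult_gen_def tens_mon)

lemma chi_zero [simp]: "chi Q (0, 0) b = 1" "chi Q b (0, 0) = 1"
  by (cases b; simp)+

lemma deg_Nil [simp]: "deg [] = (0, 0)"
  by (simp add: deg_def)

lemma deg_Cons: "deg (j # l) = alpha j + deg l"
  by (cases j) (simp_all add: deg_def)

lemma deg_single [simp]: "deg [j] = alpha j"
  by (cases j) (simp_all add: deg_def)

lemma braided_times_gen:
  "braided_times Q (tens (mon [i]) 1 + tens 1 (mon [i])) z = mult_gen Q i z"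
proof -
  let ?y = "tens (mon [i]) 1 + tens 1 (mon [i]) :: 'a tensor_alg2"
  have y: "?y = Poly_Mapping.single (Word [i], Word []) 1 + Poly_Mapping.single (Word [], Word [i]) 1"
    by (simp add: tens_mon flip: mon_Nil)
  have l: "Poly_Mapping.lookup ?y w = (if w = (Word [i], Word []) \<or> w = (Word [], Word [i]) then 1 else 0)" for w
    by (auto simp: y lookup_add lookup_single when_def)
  have k: "Poly_Mapping.keys ?y = {(Word [i], Word []), (Word [], Word [i])}"
    unfolding set_eq_iff in_keys_iff l by simp
  have e: "Poly_Mapping.single a c = scale c (Poly_Mapping.single a 1)" for a :: "word \<times> word" and c :: 'a
    by (rule poly_mapping_eqI) (simp add: lookup_single when_def)
  have "braided_times Q ?y z = (\<Sum>(c, d)\<in>Poly_Mapping.keys z.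
       Poly_Mapping.single (Word [i] + c, Word [] + d) (Poly_Mapping.lookup z (c, d)))
     + (\<Sum>(c, d)\<in>Poly_Mapping.keys z.
       Poly_Mapping.single (Word [] + c, Word [i] + d)
        (Poly_Mapping.lookup z (c, d) * chi Q (alpha i) (deg (letters c))))"
    unfolding braided_times_def k by (simp add: l del: deg_Cons)
  also have "\<dots> = mult_gen Q i z"
    unfolding mult_gen_def lin_ext_def sum.distrib[symmetric]
    by (intro sum.cong refl, clarsimp)
      (subst e, subst (2) e, simp add: plus_word_def tens_mon pm.scale_right_distrib)
  finally show ?thesis .
qed

lemma comult_mon: "comult Q (mon l) = comult_word Q l"
  by (simp add: comult_def)

lemma lin_comult [simp]: "lin (comult Q)"
  by (simp add: comult_def)

lemma comult_mult_gen: "comult Q (mon [i] * y) = mult_gen Q i (comult Q y)"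
  by (rule lin_eq_monI[where y = y])
    (auto intro: lin_comp simp: mon_times comult_mon braided_times_gen)

lemma counit_add: "counit (x + y) = counit x + counit y"
  by (simp add: counit_def lookup_add)

lemma counit_scale: "counit (scale c y) = c * counit y"
  by (simp add: counit_def)

lemma counit_mon: "counit (mon l) = (if l = [] then 1 else 0)"
  by (auto simp: counit_def mon_def zero_word_def lookup_single)

text \<open>
  Since \<open>x\<^sub>i \<otimes> 1\<close> is killed by the counit on the left factor, left multiplication by
  \<open>x\<^sub>i \<otimes> 1 + 1 \<otimes> x\<^sub>i\<close> turns into left multiplication by \<open>x\<^sub>i\<close>, and the counit axiom follows letter by
  letter.
\<close>

lemma contract_counit_comult: "contract counit (comult Q y) = y"
proof (rule lin_eq_monI[where y = y])
  show "lin (\<lambda>y. contract counit (comult Q y))" by (rule lin_comp) auto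
  show "lin (\<lambda>y. y)" by (rule linI) auto
  have *: "contract counit (mult_gen Q i z) = mon [i] * contract counit z" for i z
  proof (rule lin_eq_tensI[where y = z])
    show "lin (\<lambda>z. contract counit (mult_gen Q i z))" by (rule lin_comp) auto
    show "lin (\<lambda>z. mon [i] * contract counit z)" by (rule lin_comp) auto
    show "contract counit (mult_gen Q i (Poly_Mapping.single (Word k, Word l) 1)) =
       mon [i] * contract counit (Poly_Mapping.single (Word k, Word l) 1)" for k l
      by (auto simp: mult_gen_tens_mon contract_tens counit_add counit_scale counit_mon
          pmp.linear_add pmp.linear_scale mon_times scale_mult_right simp flip: tens_mon)
  qed
  show "contract counit (comult Q (mon l)) = mon l" for l
  proof (induction l)
    case Nil
    then show ?case
      by (simp add: comult_mon contract_tens counit_add counit_scale counit_mon flip: mon_Nil)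
  next
    case (Cons i l)
    then show ?case
      using comult_mult_gen[of Q i "mon l"] by (simp add: * mon_times)
  qed
qed

lemma deriv_mon_Cons:
  "deriv Q i (mon (j # l)) = (if j = i then mon l else 0) + scale (chi Q (alpha j) (alpha i)) (mon [j] * deriv Q i (mon l))"
  by (simp add: deriv_mon)

lemma chi_add_right:
  assumes "\<And>i j. Q i j \<noteq> 0"
  shows "chi Q c (a + b) = chi Q c a * chi Q c b"
  using assms by (cases a; cases b; cases c) (simp add: distrib_left power_int_add)

definition homog :: "int \<times> int \<Rightarrow> 'k::field tensor_alg \<Rightarrow> bool" where
  "homog a y \<longleftrightarrow> (\<forall>w\<in>Poly_Mapping.keys y. deg (letters w) = a)"

lemma homog_0 [simp]: "homog a 0"
  by (simp add: homog_def)

lemma homog_add: "homog a x \<Longrightarrow> homog a y \<Longrightarrow> homog a (x + y)"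
  using Poly_Mapping.keys_add[of x y] unfolding homog_def by blast

lemma homog_scale: "homog a y \<Longrightarrow> homog a (scale c y)"
  by (auto simp: homog_def in_keys_iff)

lemma homog_diff: "homog a x \<Longrightarrow> homog a y \<Longrightarrow> homog a (x - y)"
  using homog_add[of a x "scale (-1) y"] homog_scale[of a y "-1"] by simp

lemma homog_mon: "homog (deg l) (mon l)"
  by (simp add: homog_def mon_def)

lemma homog_mult:
  assumes "homog a x" "homog b y"
  shows "homog (a + b) (x * y)"
proof -
  have deg_append: "deg (k @ l) = deg k + deg l" for k l
    by (simp add: deg_def)
  have "\<exists>v\<in>Poly_Mapping.keys x. \<exists>u\<in>Poly_Mapping.keys y. w = v + u" if "w \<in> Poly_Mapping.keys (x * y)" for w
    using that Poly_Mapping.keys_mult[of x y] by blast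
  then show ?thesis
    using assms unfolding homog_def by (fastforce simp: plus_word_def deg_append)
qed

locale diagonal_braiding =
  fixes Q :: "'k::field braiding"
  assumes Q: "\<And>i j. Q i j \<noteq> 0"
begin

lemma homog_deriv_mon:
  "homog (deg l - alpha i) (deriv Q i (mon l))"
proof (induction l)
  case Nil then show ?case by (simp add: deriv_mon)
next
  case (Cons j l)
  have 1: "homog (deg (j # l) - alpha i) (if j = i then mon l else 0 :: 'k tensor_alg)"
    using homog_mon[of l] by (auto simp: deg_Cons)
  have "homog (alpha j + (deg l - alpha i)) (mon [j] * deriv Q i (mon l))"
    using Cons homog_mon[of "[j]"] by (intro homog_mult) auto
  then have 2: "homog (deg (j # l) - alpha i) (mon [j] * deriv Q i (mon l))"
    by (simp add: deg_Cons add_diff_eq)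
  show ?case
    unfolding deriv_mon_Cons using 1 2 by (intro homog_add homog_scale)
qed

lemma mult_gen_homog:
  assumes "homog a y"
  shows "mult_gen Q j (tens y (mon l)) = tens (mon [j] * y) (mon l) + scale (chi Q (alpha j) a) (tens y (mon (j # l)))"
proof -
  let ?t = "\<lambda>w. scale (Poly_Mapping.lookup y w)"
  note exp = sum_scale_mon[of y]
  have "mult_gen Q j (tens y (mon l)) = (\<Sum>w\<in>Poly_Mapping.keys y. ?t w (mult_gen Q j (tens (mon (letters w)) (mon l))))"
    by (subst exp) (simp add: pmp.linear_sum[OF lin_tens_left] pmp.linear_sum[OF lin_mult_gen]
        tens_scale_left pmp.linear_scale[OF lin_mult_gen])
  also have "\<dots> = (\<Sum>w\<in>Poly_Mapping.keys y. ?t w (tens (mon (j # letters w)) (mon l))) +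
    (\<Sum>w\<in>Poly_Mapping.keys y. scale (chi Q (alpha j) a) (?t w (tens (mon (letters w)) (mon (j # l)))))"
    unfolding sum.distrib[symmetric] using assms
    by (intro sum.cong refl) (simp add: mult_gen_tens_mon homog_def pm.scale_right_distrib mult.commute)
  also have "(\<Sum>w\<in>Poly_Mapping.keys y. ?t w (tens (mon (j # letters w)) (mon l))) = tens (mon [j] * y) (mon l)"
    by (subst (3) exp) (simp add: sum_distrib_left pmp.linear_sum[OF lin_tens_left] scale_mult_right
        tens_scale_left mon_times)
  also have "(\<Sum>w\<in>Poly_Mapping.keys y. scale (chi Q (alpha j) a) (?t w (tens (mon (letters w)) (mon (j # l)))))
    = scale (chi Q (alpha j) a) (tens y (mon (j # l)))"
    by (subst (3) exp) (simp add: pmp.linear_sum[OF lin_tens_left] tens_scale_left pm.scale_sum_right)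
  finally show ?thesis .
qed

text \<open>
  The Leibniz rule for \<open>d\<^sub>i \<otimes> id\<close> against \<open>x\<^sub>j \<otimes> 1 + 1 \<otimes> x\<^sub>j\<close>. On the summand \<open>1 \<otimes> x\<^sub>j\<close> the braiding
  factor sees a left factor whose degree was lowered by \<open>\<alpha>\<^sub>i\<close>, and this produces the same scalar
  \<open>\<chi>(\<alpha>\<^sub>j, \<alpha>\<^sub>i)\<close> as on the summand \<open>x\<^sub>j \<otimes> 1\<close>.
\<close>

lemma on_left_deriv_mult_gen:
  "on_left (deriv Q i) (mult_gen Q j z) =
     (if i = j then z else 0) + scale (chi Q (alpha j) (alpha i)) (mult_gen Q j (on_left (deriv Q i) z))"
proof (rule lin_eq_tensI[where y = z])
  show "lin (\<lambda>z. on_left (deriv Q i) (mult_gen Q j z))" by (rule lin_comp) auto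
  have "lin (\<lambda>z. mult_gen Q j (on_left (deriv Q i) z))" by (rule lin_comp) auto
  then show "lin (\<lambda>z. (if i = j then z else 0) + scale (chi Q (alpha j) (alpha i)) (mult_gen Q j (on_left (deriv Q i) z)))"
    by (intro linI) (auto simp: pmp.linear_add pmp.linear_scale pm.scale_right_distrib)
  fix k l
  let ?d = "deriv Q i (mon k)"
  have d0: "?d = 0" if "k = []" using that by (simp add: deriv_mon)
  have c: "chi Q (alpha j) (alpha i) * chi Q (alpha j) (deg k - alpha i) = chi Q (alpha j) (deg k)"
    using chi_add_right[of Q "alpha j" "alpha i" "deg k - alpha i"] Q by simp
  have R: "scale (chi Q (alpha j) (alpha i)) (mult_gen Q j (tens ?d (mon l))) =
      scale (chi Q (alpha j) (alpha i)) (tens (mon [j] * ?d) (mon l)) + scale (chi Q (alpha j) (deg k)) (tens ?d (mon (j # l)))"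
    by (simp add: mult_gen_homog[OF homog_deriv_mon] pm.scale_right_distrib c)
  have "on_left (deriv Q i) (mult_gen Q j (tens (mon k) (mon l))) =
     tens (deriv Q i (mon (j # k))) (mon l) + scale (chi Q (alpha j) (deg k)) (tens ?d (mon (j # l)))"
    by (simp add: mult_gen_tens_mon pmp.linear_add pmp.linear_scale on_left_tens)
  also have "\<dots> = (if i = j then tens (mon k) (mon l) else 0) +
      scale (chi Q (alpha j) (alpha i)) (mult_gen Q j (on_left (deriv Q i) (tens (mon k) (mon l))))"
    by (auto simp: on_left_tens R deriv_mon_Cons tens_add_left tens_scale_left pmp.linear_0[OF lin_tens_left])
  finally show "on_left (deriv Q i) (mult_gen Q j (Poly_Mapping.single (Word k, Word l) 1)) =
       (if i = j then Poly_Mapping.single (Word k, Word l) 1 else 0) +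
       scale (chi Q (alpha j) (alpha i)) (mult_gen Q j (on_left (deriv Q i) (Poly_Mapping.single (Word k, Word l) 1)))"
    by (simp add: tens_mon)
qed

text \<open>
  The skew-derivation \<open>d\<^sub>i\<close> is \<open>(x\<^sub>i\<^sup>* \<otimes> id) \<circ> \<Delta>\<close>, so this is coassociativity of \<open>\<Delta>\<close> evaluated at
  \<open>x\<^sub>i\<^sup>*\<close> on the first factor. It is proved directly from the recursion for \<open>\<Delta>\<close>.
\<close>

lemma comult_deriv: "comult Q (deriv Q i y) = on_left (deriv Q i) (comult Q y)"
proof (rule lin_eq_monI[where y = y])
  show "lin (\<lambda>y. comult Q (deriv Q i y))" by (rule lin_comp) auto
  show "lin (\<lambda>y. on_left (deriv Q i) (comult Q y))" by (rule lin_comp) auto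
  fix l show "comult Q (deriv Q i (mon l)) = on_left (deriv Q i) (comult Q (mon l))"
  proof (induction l)
    case Nil
    have "deriv Q i 1 = 0" using deriv_mon[of Q i "[]"] by (simp add: mon_Nil)
    then show ?case
      by (simp add: mon_Nil comult_mon[of Q "[]", simplified mon_Nil] on_left_tens pmp.linear_0[OF lin_tens_left] pmp.linear_0[OF lin_comult])
  next
    case (Cons j l)
    have "comult Q (mon (j # l)) = mult_gen Q j (comult Q (mon l))"
      using comult_mult_gen[of Q j "mon l"] by (simp add: mon_times)
    then show ?case
      using Cons
      by (auto simp: on_left_deriv_mult_gen deriv_mon_Cons pmp.linear_add pmp.linear_scale pmp.linear_0[OF lin_comult] comult_mult_gen)
  qed
qed

lemma comult_fold_deriv: "comult Q (fold (deriv Q) l y) = on_left (fold (deriv Q) l) (comult Q y)"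
proof (induction l arbitrary: y)
  case Nil
  have "on_left (\<lambda>x. x) z = z" for z :: "'k tensor_alg2"
    by (rule lin_eq_tensI[where y = z]) (auto intro: linI simp: on_left_def tens_mon)
  then show ?case by (simp add: id_def)
next
  case (Cons i l)
  have "on_left (fold (deriv Q) l) (on_left (deriv Q i) z) = on_left (fold (deriv Q) (i # l)) z" for z
  proof (rule lin_eq_tensI[where y = z])
    show "lin (\<lambda>z. on_left (fold (deriv Q) l) (on_left (deriv Q i) z))" by (rule lin_comp) auto
    show "on_left (fold (deriv Q) l) (on_left (deriv Q i) (Poly_Mapping.single (Word k, Word h) 1)) =
        on_left (fold (deriv Q) (i # l)) (Poly_Mapping.single (Word k, Word h) 1)" for k h
      unfolding tens_mon[symmetric] on_left_tens[OF lin_fold_deriv] on_left_tens[OF lin_deriv] by simp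
  qed simp
  then show ?case using Cons by (simp add: comult_deriv o_def)
qed

abbreviation dcounit :: "gen list \<Rightarrow> 'k tensor_alg \<Rightarrow> 'k" where
  "dcounit l y \<equiv> counit (fold (deriv Q) l y)"

lemma dcounit_add: "dcounit l (x + y) = dcounit l x + dcounit l y"
  by (simp add: pmp.linear_add[OF lin_fold_deriv] counit_add)

lemma dcounit_scale: "dcounit l (scale c y) = c * dcounit l y"
  by (simp add: pmp.linear_scale[OF lin_fold_deriv] counit_scale)

lemma dcounit_0: "dcounit l 0 = 0"
  by (simp add: pmp.linear_0[OF lin_fold_deriv] counit_def)

text \<open>
  Combining \<open>comult_fold_deriv\<close> with the counit axiom: every iterated skew-derivation is a contraction
  of \<open>\<Delta>\<close>. This is what relates coideals and skew-derivations.
\<close>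

lemma contract_dcounit_comult: "contract (dcounit l) (comult Q y) = fold (deriv Q) l y"
proof -
  have "contract counit (on_left (fold (deriv Q) l) z) = contract (dcounit l) z" for z
    by (rule lin_eq_tensI[where y = z], rule lin_comp)
      (auto simp: on_left_tens lin_fold_deriv contract_tens counit_add counit_scale dcounit_add dcounit_scale simp flip: tens_mon)
  then show ?thesis
    using contract_counit_comult[of Q "fold (deriv Q) l y"] by (simp add: comult_fold_deriv)
qed

text \<open>
  This is \<open>ker \<pi>\<close>, by \<open>ker_pi_eq_deriv_radical\<close>, in a form that can be computed with.
\<close>

definition deriv_radical :: "'k tensor_alg set" where
  "deriv_radical = {y. \<forall>l. dcounit l y = 0}"

lemma subspace_deriv_radical: "pm.subspace deriv_radical"
  by (rule pm.subspaceI) (auto simp: deriv_radical_def dcounit_0 dcounit_add dcounit_scale)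

lemma deriv_radical_deriv: "y \<in> deriv_radical \<Longrightarrow> deriv Q i y \<in> deriv_radical"
  unfolding deriv_radical_def by (auto dest: spec[of _ "i # _"])

lemma deriv_radical_fold: "y \<in> deriv_radical \<Longrightarrow> fold (deriv Q) l y \<in> deriv_radical"
  by (induction l arbitrary: y) (auto simp: deriv_radical_deriv)

lemma deriv_radicalI:
  assumes "counit y = 0" "\<And>i. deriv Q i y \<in> deriv_radical"
  shows "y \<in> deriv_radical"
  unfolding deriv_radical_def
proof safe
  fix l show "dcounit l y = 0"
    using assms by (cases l) (auto simp: deriv_radical_def)
qed

lemma contract_tens_list:
  assumes "\<And>x y. p (x + y) = p x + p y" "\<And>c x. p (scale c x) = c * p x"
  shows "contract p (\<Sum>(a, b)\<leftarrow>ts. tens a b) = (\<Sum>(a, b)\<leftarrow>ts. scale (p a) b)"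
  by (induction ts) (auto simp: pmp.linear_0 pmp.linear_add contract_tens assms)

text \<open>
  If contracting the left factor with every form \<open>dcounit l\<close> leads into the radical \<open>R\<close>, then the
  tensor lies in \<open>R \<otimes> T + T \<otimes> R\<close>. Induction on the number of summands: if the first left factor \<open>a\<close>
  lies in \<open>R\<close>, its summand can be dropped. Otherwise some form \<open>dcounit w\<close> is nonzero at \<open>a\<close>, so the
  hypothesis expresses the right factor \<open>b\<close> modulo \<open>R\<close> by the other right factors, which eliminates
  the first summand.
\<close>

lemma tensor_kernel:
  assumes "\<And>l. (\<Sum>(a, b)\<leftarrow>ts. scale (dcounit l a) b) \<in> deriv_radical"
  shows "(\<Sum>(a, b)\<leftarrow>ts. tens a b) \<in> pm.span {tens a b |a b. a \<in> deriv_radical \<or> b \<in> deriv_radical}"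
    (is "_ \<in> ?D")
  using assms
proof (induction "length ts" arbitrary: ts)
  case 0
  then show ?case by (simp add: pm.span_zero)
next
  case (Suc n)
  then obtain a b us where ts: "ts = (a, b) # us" and n: "length us = n"
    by (metis length_Suc_conv surj_pair)
  note R = subspace_deriv_radical
  show ?case
  proof (cases "a \<in> deriv_radical")
    case True
    have "(\<Sum>(a, b)\<leftarrow>us. scale (dcounit l a) b) \<in> deriv_radical" for l
      using Suc.prems[of l] True by (simp add: ts deriv_radical_def)
    then have "(\<Sum>(a, b)\<leftarrow>us. tens a b) \<in> ?D"
      using Suc.hyps n by blast
    then show ?thesis
      using True unfolding ts by (auto intro!: pm.span_add intro: pm.span_base)
  next
    case False
    then obtain w where w: "dcounit w a \<noteq> 0"
      by (auto simp: deriv_radical_def)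
    \<comment> \<open>Subtracting \<open>\<tau> x\<close> times \<open>a\<close> from a left factor \<open>x\<close> makes it vanish under \<open>dcounit w\<close>.\<close>
    define \<tau> where "\<tau> x = dcounit w x / dcounit w a" for x
    define vs where "vs = map (\<lambda>(x, y). (x - scale (\<tau> x) a, y)) us"
    let ?b = "\<Sum>(x, y)\<leftarrow>us. scale (\<tau> x) y"
    have bb: "b + ?b \<in> deriv_radical"
    proof -
      have "scale (inverse (dcounit w a)) (\<Sum>(a, b)\<leftarrow>ts. scale (dcounit w a) b) \<in> deriv_radical"
        using Suc.prems[of w] by (rule pm.subspace_scale[OF R])
      moreover have "scale c (\<Sum>(a, b)\<leftarrow>us. scale (dcounit w a) b) = (\<Sum>(a, b)\<leftarrow>us. scale (c * dcounit w a) b)" for c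
        by (induction us) (auto simp: pm.scale_right_distrib)
      ultimately show ?thesis
        using w by (simp add: ts \<tau>_def pm.scale_right_distrib field_simps)
    qed
    have s: "(\<Sum>(a, b)\<leftarrow>vs. scale (dcounit l a) b) = (\<Sum>(a, b)\<leftarrow>us. scale (dcounit l a) b) - scale (dcounit l a) ?b" for l
    proof -
      have "dcounit l (x - scale c a) = dcounit l x - c * dcounit l a" for x c
        using dcounit_add[of l x "scale (-c) a"] dcounit_scale[of l "-c" a] by simp
      then show ?thesis
        unfolding vs_def
        by (induction us) (auto simp: pm.scale_right_distrib pm.scale_left_diff_distrib mult.commute)
    qed
    have "(\<Sum>(a, b)\<leftarrow>vs. scale (dcounit l a) b) \<in> deriv_radical" for l
    proof -
      have "(\<Sum>(a, b)\<leftarrow>vs. scale (dcounit l a) b) =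
         (\<Sum>(a, b)\<leftarrow>ts. scale (dcounit l a) b) - scale (dcounit l a) (b + ?b)"
        by (simp add: s ts pm.scale_right_distrib)
      then show ?thesis
        using Suc.prems bb R by (simp add: pm.subspace_diff pm.subspace_scale)
    qed
    then have 1: "(\<Sum>(a, b)\<leftarrow>vs. tens a b) \<in> ?D"
      by (intro Suc.hyps(1)) (simp_all add: vs_def n)
    have 2: "(\<Sum>(a, b)\<leftarrow>vs. tens a b) = (\<Sum>(a, b)\<leftarrow>us. tens a b) - tens a ?b"
      unfolding vs_def
      by (induction us) (auto simp: pmp.linear_diff[OF lin_tens_left] tens_scale_left tens_scale_right
          pmp.linear_0[OF lin_tens_right] tens_add_right)
    have 3: "tens a (b + ?b) \<in> ?D"
      using bb by (blast intro: pm.span_base)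
    have "(\<Sum>(a, b)\<leftarrow>us. tens a b) - tens a ?b + tens a (b + ?b) \<in> ?D"
      by (rule pm.span_add[OF 1[unfolded 2] 3])
    then show ?thesis
      by (simp add: ts tens_add_right add.commute)
  qed
qed

lemma ex_tens_list: "\<exists>ts. z = (\<Sum>(a, b)\<leftarrow>ts. tens a (b :: 'k tensor_alg))"
proof -
  have "\<exists>ts. (\<Sum>w\<in>S. scale (f w) (Poly_Mapping.single w 1)) = (\<Sum>(a, b)\<leftarrow>ts. tens a (b :: 'k tensor_alg))"
    if "finite S" for S f
    using that
  proof induction
    case empty
    then show ?case by (intro exI[of _ "[]"]) simp
  next
    case (insert w S)
    then obtain ts where ts: "(\<Sum>w\<in>S. scale (f w) (Poly_Mapping.single w 1)) = (\<Sum>(a, b)\<leftarrow>ts. tens a (b :: 'k tensor_alg))"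
      by blast
    have "tens (scale (f w) (mon (letters (fst w)))) (mon (letters (snd w))) = scale (f w) (Poly_Mapping.single w 1)"
      by (simp add: tens_scale_left tens_mon)
    then show ?case
      using insert ts
      by (intro exI[of _ "(scale (f w) (mon (letters (fst w))), mon (letters (snd w))) # ts"]) simp
  qed
  from this[of "Poly_Mapping.keys z" "Poly_Mapping.lookup z"] show ?thesis
    using expand_single[of z] by simp
qed

lemma deriv_gen_counit: "counit (deriv Q i y) = Poly_Mapping.lookup y (Word [i])"
proof -
  have *: "counit (mon [j] * y) = 0" for j y
  proof -
    have "\<forall>w\<in>Poly_Mapping.keys (mon [j] * y). w \<noteq> 0"
      using Poly_Mapping.keys_mult[of "mon [j]" y] by (force simp: mon_def plus_word_def zero_word_def)
    then show ?thesis by (auto simp: counit_def in_keys_iff)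
  qed
  have "scale (counit (deriv Q i y)) 1 = scale (Poly_Mapping.lookup y (Word [i])) (1 :: 'k tensor_alg)"
  proof (rule lin_eq_monI[where y = y])
    show "lin (\<lambda>y. scale (counit (deriv Q i y)) (1 :: 'k tensor_alg))"
      by (rule linI) (auto simp: pmp.linear_add pmp.linear_scale counit_add counit_scale pm.scale_left_distrib)
    show "lin (\<lambda>y. scale (Poly_Mapping.lookup y (Word [i])) (1 :: 'k tensor_alg))"
      by (rule linI) (auto simp: lookup_add pm.scale_left_distrib)
    show "scale (counit (deriv Q i (mon l))) 1 = scale (Poly_Mapping.lookup (mon l) (Word [i])) (1 :: 'k tensor_alg)" for l
    proof (cases l)
      case Nil then show ?thesis by (simp add: deriv_mon) (simp add: mon_def lookup_single counit_def)
    next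
      case (Cons j k)
      have "counit (deriv Q i (mon l)) = Poly_Mapping.lookup (mon l) (Word [i])"
        unfolding Cons deriv_mon_Cons counit_add counit_scale *
        by (auto simp: counit_mon mon_def lookup_single counit_def when_def zero_word_def)
      then show ?thesis by simp
    qed
  qed
  then show ?thesis
    by (metis counit_scale counit_mon mon_Nil mult.right_neutral)
qed

lemma coideal_deriv_radical: "coideal Q deriv_radical"
  unfolding coideal_def
proof (intro conjI ballI)
  show "pm.subspace deriv_radical" by (rule subspace_deriv_radical)
next
  fix y assume y: "y \<in> deriv_radical"
  then show "counit y = 0" unfolding deriv_radical_def by (auto dest: spec[of _ "[]"])
  obtain ts where ts: "comult Q y = (\<Sum>(a, b)\<leftarrow>ts. tens a b)"
    using ex_tens_list by blast
  have "(\<Sum>(a, b)\<leftarrow>ts. scale (dcounit l a) b) \<in> deriv_radical" for l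
  proof -
    have "(\<Sum>(a, b)\<leftarrow>ts. scale (dcounit l a) b) = contract (dcounit l) (comult Q y)"
      unfolding ts by (rule contract_tens_list[symmetric]) (auto simp: dcounit_add dcounit_scale)
    also have "\<dots> = fold (deriv Q) l y" by (rule contract_dcounit_comult)
    finally show ?thesis using deriv_radical_fold[OF y] by simp
  qed
  then show "comult Q y \<in> pm.span {tens a b |a b. a \<in> deriv_radical \<or> b \<in> deriv_radical}"
    unfolding ts by (rule tensor_kernel)
qed

text \<open>
  The form \<open>x\<^sub>i\<^sup>*\<close> vanishes on the Nichols ideal, which lives in degrees at least two, so contracting
  \<open>\<Delta>(y) \<in> I \<otimes> T + T \<otimes> I\<close> on the left by \<open>x\<^sub>i\<^sup>*\<close> leads back into \<open>I\<close>.
\<close>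

lemma nichols_deriv:
  assumes "y \<in> nichols_ideal Q"
  shows "deriv Q i y \<in> nichols_ideal Q"
proof -
  let ?I = "nichols_ideal Q"
  have I: "pm.subspace ?I" by (simp add: nichols_ideal_def)
  have 0: "dcounit [i] a = 0" if "a \<in> ?I" for a
  proof -
    have "Word [i] \<notin> Poly_Mapping.keys a"
      using that nichols_ideal_subset[of Q] by (fastforce simp: degree_ge2_def)
    then show ?thesis by (simp add: deriv_gen_counit in_keys_iff)
  qed
  have "comult Q y \<in> pm.span {tens a b |a b. a \<in> ?I \<or> b \<in> ?I}"
    using coideal_nichols_ideal[of Q] assms by (auto simp: coideal_def)
  also have "\<dots> \<subseteq> {z. contract (dcounit [i]) z \<in> ?I}"
  proof (rule pm.span_minimal)
    show "{tens a b |a b. a \<in> ?I \<or> b \<in> ?I} \<subseteq> {z. contract (dcounit [i]) z \<in> ?I}"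
    proof clarsimp
      fix a b assume *: "a \<in> ?I \<or> b \<in> ?I"
      have "contract (dcounit [i]) (tens a b) = scale (dcounit [i] a) b"
        by (rule contract_tens) (simp_all only: dcounit_add dcounit_scale)
      then show "contract (\<lambda>y. counit (deriv Q i y)) (tens a b) \<in> ?I"
        using * 0[of a] I by (auto simp: pm.subspace_scale pm.subspace_0)
    qed
  qed (rule subspace_vimage[OF lin_contract I])
  finally show ?thesis
    using contract_dcounit_comult[of "[i]" y] by simp
qed

text \<open>
  The Nichols ideal is stable under skew-derivations and killed by the counit, so it lies in the
  radical. Conversely the radical is a coideal in degrees at least two, and the Nichols ideal is the
  largest one.
\<close>

lemma ker_pi_eq_deriv_radical: "ker_pi Q = deriv_radical"
proof -
  have "nichols_ideal Q \<subseteq> deriv_radical"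
  proof
    fix y assume y: "y \<in> nichols_ideal Q"
    have "fold (deriv Q) l y \<in> nichols_ideal Q" for l
      using y by (induction l arbitrary: y) (auto simp: nichols_deriv)
    then show "y \<in> deriv_radical"
      using coideal_nichols_ideal[of Q] by (auto simp: deriv_radical_def coideal_def)
  qed
  moreover have "deriv_radical \<subseteq> degree_ge2"
  proof
    fix y assume y: "y \<in> deriv_radical"
    have "2 \<le> length (letters w)" if w: "w \<in> Poly_Mapping.keys y" for w
    proof (rule ccontr)
      assume "\<not> 2 \<le> length (letters w)"
      then consider "letters w = []" | i where "letters w = [i]"
        by (cases "letters w"; cases "tl (letters w)") auto
      then have "Poly_Mapping.lookup y w = 0"
      proof cases
        case 1
        then have "w = 0" by (cases w) (simp add: zero_word_def)
        then show ?thesis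
          using y spec[of "\<lambda>l. dcounit l y = 0" "[]"] by (simp add: deriv_radical_def counit_def)
      next
        case (2 i)
        then have "w = Word [i]" by (cases w) simp
        then show ?thesis
          using y spec[of "\<lambda>l. dcounit l y = 0" "[i]"] by (simp add: deriv_radical_def deriv_gen_counit)
      qed
      with w show False by (simp add: in_keys_iff)
    qed
    then show "y \<in> degree_ge2" by (simp add: degree_ge2_def)
  qed
  ultimately show ?thesis
    using nichols_ideal_greatest[OF coideal_deriv_radical] by (auto simp: ker_pi_eq)
qed

text \<open>
  The criterion through which \<open>ker \<pi>\<close> is used from here on: only skew-derivations are needed.
\<close>

lemma ker_pi_iff:
  assumes "counit y = 0"
  shows "y \<in> ker_pi Q \<longleftrightarrow> (\<forall>i. deriv Q i y \<in> ker_pi Q)"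
  using deriv_radicalI[of y] deriv_radical_deriv[of y] assms
  unfolding ker_pi_eq_deriv_radical by blast

lemma subspace_ker_pi: "pm.subspace (ker_pi Q)"
  unfolding ker_pi_eq_deriv_radical by (rule subspace_deriv_radical)

end

section \<open>Linear algebra\<close>

text \<open>
  Spaces here carry no finiteness assumption, so dimensions are compared through the cardinalities of
  independent sets.
\<close>

lemma span_eq_if_max_independent:
  fixes S W :: "('a \<Rightarrow>\<^sub>0 'k::field) set"
  assumes "pm.subspace W" "S \<subseteq> W" "finite S" "pm.independent S"
    and max: "\<And>R. pm.independent R \<Longrightarrow> R \<subseteq> W \<Longrightarrow> card R \<le> card S"
  shows "pm.span S = W"
proof
  show "pm.span S \<subseteq> W" using assms by (intro pm.span_minimal)
  show "W \<subseteq> pm.span S"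
  proof (rule ccontr)
    assume "\<not> W \<subseteq> pm.span S"
    then obtain y where y: "y \<in> W" "y \<notin> pm.span S" by blast
    then have "y \<notin> S" using pm.span_base by blast
    moreover have "pm.independent (insert y S)"
      using y assms by (intro pm.independent_insertI)
    then have "card (insert y S) \<le> card S"
      using y assms by (intro max) auto
    ultimately show False using assms by simp
  qed
qed

lemma basis_family_image:
  fixes W W' :: "('a \<Rightarrow>\<^sub>0 'k::field) set"
  assumes f: "basis_family f A W" and A: "finite A" and W': "pm.subspace W'"
    and h: "lin h" "inj_on h W" "h ` W \<subseteq> W'" and g: "\<And>x. x \<in> A \<Longrightarrow> g x = h (f x)"
  shows "inj_on g A" "pm.independent (g ` A)" "pm.span (g ` A) = h ` W" "g ` A \<subseteq> W'"
proof -
  have W: "pm.span (f ` A) = W" using f by (simp add: basis_family_def)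
  have fA: "f ` A \<subseteq> W" using W pm.span_superset by blast
  have e: "g ` A = h ` f ` A" using g by (auto simp: image_image)
  show "inj_on g A"
  proof (rule inj_onI)
    fix x y assume "x \<in> A" "y \<in> A" "g x = g y"
    then show "x = y"
      using g f fA h(2) unfolding basis_family_def by (metis imageI inj_onD subsetD)
  qed
  show "pm.independent (g ` A)"
    unfolding e using f h W
    by (intro pmp.linear_independent_injective_image) (auto simp: basis_family_def)
  show "pm.span (g ` A) = h ` W"
    unfolding e using pmp.linear_span_image[OF h(1)] W by simp
  show "g ` A \<subseteq> W'" unfolding e using fA h(3) by blast
qed

lemma basis_family_step_same:
  fixes W W' :: "('a \<Rightarrow>\<^sub>0 'k::field) set"
  assumes f: "basis_family f A W" and A: "finite A" and W': "pm.subspace W'"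
    and h: "lin h" "inj_on h W" "h ` W \<subseteq> W'" and g: "\<And>x. x \<in> A \<Longrightarrow> g x = h (f x)"
    and max: "\<And>R. pm.independent R \<Longrightarrow> R \<subseteq> W' \<Longrightarrow> card R \<le> card A"
  shows "basis_family g A W'"
proof -
  note b = basis_family_image[OF f A W' h g]
  have "pm.span (g ` A) = W'"
    using b A W' max by (intro span_eq_if_max_independent) (simp_all add: card_image)
  then show ?thesis using b by (simp add: basis_family_def)
qed

lemma basis_family_step_insert:
  fixes W W' :: "('a \<Rightarrow>\<^sub>0 'k::field) set"
  assumes f: "basis_family f A W" and A: "finite A" and W': "pm.subspace W'"
    and h: "lin h" "inj_on h W" "h ` W \<subseteq> W'" and g: "\<And>x. x \<in> A \<Longrightarrow> g x = h (f x)"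
    and a: "a \<notin> A" "g a \<in> W'" "g a \<notin> h ` W"
    and max: "\<And>R. pm.independent R \<Longrightarrow> R \<subseteq> W' \<Longrightarrow> card R \<le> Suc (card A)"
  shows "basis_family g (insert a A) W'"
proof -
  note b = basis_family_image[OF f A W' h g]
  have gA: "g a \<notin> g ` A" using a(3) b(3) pm.span_base by metis
  have inj: "inj_on g (insert a A)" using b(1) gA by (simp add: inj_on_insert a(1))
  have ind: "pm.independent (g ` insert a A)"
    using b(2,3) a(3) by (simp add: pm.independent_insertI)
  have "card (g ` insert a A) = Suc (card A)"
    using card_image[OF inj] a A by simp
  then have "pm.span (g ` insert a A) = W'"
    using b(4) a A W' max ind by (intro span_eq_if_max_independent) (simp_all del: image_insert, auto)
  then show ?thesis using inj ind by (simp add: basis_family_def)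
qed

section \<open>Ladder operators on coefficient sequences\<close>

text \<open>
  The quantum integer \<open>qnum\<close> over an integral domain. The field \<open>k\<close> is not enough, since an
  identity below is proved over the polynomial ring \<open>k[r]\<close> first.
\<close>

definition qn :: "nat \<Rightarrow> 'a::idom \<Rightarrow> 'a" where
  "qn k t = (\<Sum>i<k. t ^ i)"

lemma qn_0 [simp]: "qn 0 t = 0"
  by (simp add: qn_def)

lemma qn_Suc: "qn (Suc k) t = qn k t + t ^ k"
  by (simp add: qn_def)

lemma qn_Suc_left: "qn (Suc k) t = 1 + t * qn k t"
  unfolding qn_def by (simp add: sum.lessThan_Suc_shift sum_distrib_left del: sum.lessThan_Suc)

lemma qn_1 [simp]: "qn (Suc 0) t = 1"
  by (simp add: qn_Suc)

lemma qnum_eq_qn: "qnum k t = qn k t"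
  by (simp add: qnum_def qn_def)

lemma one_diff_power_qn: "1 - t ^ k = (1 - t) * qn k (t :: 'a::idom)"
  by (simp add: qn_def one_diff_power_eq)

text \<open>
  The action of \<open>- d\<^sub>1 / q\<^sub>2\<^sub>1\<close> on coordinates, see \<open>d1_Phi\<close>.
\<close>

definition lower :: "'a::idom \<Rightarrow> (nat \<Rightarrow> 'a) \<Rightarrow> nat \<Rightarrow> 'a" where
  "lower q c i = q ^ i * (c (Suc i) - c i)"

text \<open>
  The action of \<open>ad x\<^sub>1\<close> on coordinates up to the factor \<open>- 1 / q\<^sub>2\<^sub>1\<close>, see \<open>ad_Phi\<close>; here \<open>p\<close> stands
  for \<open>1 / q\<close>. Truncated subtraction does no harm: wherever an exponent or an index is truncated, the
  quantum integer in the same term is zero.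
\<close>

definition raise :: "'a::idom \<Rightarrow> 'a \<Rightarrow> 'a \<Rightarrow> nat \<Rightarrow> (nat \<Rightarrow> 'a) \<Rightarrow> nat \<Rightarrow> 'a" where
  "raise q p r m c i = p ^ (i - 1) * qn i q * (1 - q ^ (i - 1) * r) * c (i - 1)
     - r * q ^ i * qn (m + 1 - i) q * (1 - q ^ (m - i) * r) * c i"

lemma raise_cong:
  assumes "\<And>j. j \<le> m \<Longrightarrow> c j = c' j" "i \<le> Suc m"
  shows "raise q p r m c i = raise q p r m c' i"
proof (cases "i = Suc m")
  case True
  then show ?thesis using assms by (simp add: raise_def)
next
  case False
  then have "i \<le> m" "i - 1 \<le> m" using assms by auto
  then show ?thesis using assms(1) by (simp add: raise_def)
qed

lemma raise_scale: "raise q p r m (\<lambda>i. a * c i) i = a * raise q p r m c i"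
  by (simp add: raise_def algebra_simps)

lemma lower_raise_0: "lower q (raise q p r 0 c) 0 = (1 - r ^ 2) * c 0"
  by (simp add: lower_def raise_def algebra_simps power2_eq_square)

text \<open>
  The coordinate form of \<open>d\<^sub>1 \<circ> ad x\<^sub>1 = q ad x\<^sub>1 \<circ> d\<^sub>1 + (1 - q\<^bsup>2m\<^esup> r\<^sup>2)\<close>. The coefficients of \<open>c (i - 1)\<close>
  and \<open>c (i + 1)\<close> agree on both sides; that of \<open>c i\<close> is settled by the two recursions
  \<open>(k + 1)\<^sub>q = (k)\<^sub>q + q\<^sup>k = 1 + q (k)\<^sub>q\<close>.
\<close>

lemma lower_raise:
  fixes q p r :: "'a::idom"
  assumes p: "p * q = 1" and i: "i \<le> Suc m"
  shows "lower q (raise q p r (Suc m) c) i =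
    q * raise q p r m (lower q c) i + (1 - q ^ (2 * Suc m) * r ^ 2) * c i"
proof (cases i)
  case 0
  define a where "a = q ^ m"
  define g where "g = qn (Suc m) q"
  have "qn (Suc (Suc m)) q = g + q * a" "qn (Suc (Suc m)) q = 1 + q * g"
    using qn_Suc[of "Suc m" q] qn_Suc_left[of "Suc m" q] by (simp_all add: g_def a_def)
  then show ?thesis
    unfolding 0 lower_def raise_def
    by (simp add: power_add mult_2 power2_eq_square flip: a_def g_def) algebra
next
  case (Suc k)
  have pk: "p ^ k * q ^ k = 1"
    using p by (simp flip: power_mult_distrib)
  define a where "a = q ^ k"
  define b where "b = p ^ k"
  define n where "n = qn (Suc k) q"
  have ab: "b * a = 1" using pk by (simp add: a_def b_def)
  have n2: "qn (Suc (Suc k)) q = n + q * a" "qn (Suc (Suc k)) q = 1 + q * n"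
    using qn_Suc[of "Suc k" q] qn_Suc_left[of "Suc k" q] by (simp_all add: n_def a_def)
  show ?thesis
  proof (cases "m - k")
    case 0
    then have m: "m = k" using i Suc by simp
    show ?thesis
      unfolding lower_def raise_def Suc m using p ab n2
      by (simp add: power_add mult_2 power2_eq_square flip: a_def b_def n_def) algebra
  next
    case (Suc f)
    then have m: "m = Suc (k + f)" by simp
    define F where "F = q ^ f"
    define g where "g = qn (Suc f) q"
    have g: "qn (Suc (Suc f)) q = g + q * F"  "qn (Suc (Suc f)) q = 1 + q * g"
      using qn_Suc[of "Suc f" q] qn_Suc_left[of "Suc f" q] by (simp_all add: g_def F_def)
    have e: "Suc k + f - k = Suc f" by simp
    show ?thesis
      unfolding lower_def raise_def \<open>i = Suc k\<close> m using p ab n2 g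
      by (simp add: power_add mult_2 power2_eq_square e Suc_diff_le flip: a_def b_def n_def F_def g_def) algebra
  qed
qed

text \<open>
  Coordinates of \<open>(ad x\<^sub>1)\<^sup>k(P\<^sub>n)\<close> up to a scalar, see \<open>ad_pow_P\<close>.
\<close>

primrec ladder :: "'a::idom \<Rightarrow> 'a \<Rightarrow> 'a \<Rightarrow> nat \<Rightarrow> nat \<Rightarrow> nat \<Rightarrow> 'a" where
  "ladder q p r n 0 = (\<lambda>_. 1)"
| "ladder q p r n (Suc k) = raise q p r (n + k) (ladder q p r n k)"

lemma lower_ladder:
  fixes q p r :: "'a::idom"
  assumes p: "p * q = 1"
  shows "i \<le> n + k \<Longrightarrow> lower q (ladder q p r n (Suc k)) i =
    qn (Suc k) q * (1 - q ^ (2 * n + k) * r ^ 2) * ladder q p r n k i"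
proof (induction k arbitrary: i)
  case 0
  have z: "lower q (\<lambda>_. 1) = (\<lambda>i. 0 * (1::'a))"
    by (simp add: lower_def fun_eq_iff)
  show ?case
  proof (cases n)
    case 0
    then show ?thesis using "0.prems" by (simp add: lower_raise_0)
  next
    case (Suc m)
    have "lower q (raise q p r (Suc m) (\<lambda>_. 1)) i = q * raise q p r m (lower q (\<lambda>_. 1)) i + (1 - q ^ (2 * Suc m) * r ^ 2) * 1"
      using lower_raise[OF p, of i m r "\<lambda>_. 1"] "0.prems" Suc by simp
    then show ?thesis
      by (simp add: Suc z raise_scale del: mult_Suc_right) (simp add: raise_def)
  qed
next
  case (Suc k)
  have "lower q (ladder q p r n (Suc (Suc k))) i = lower q (raise q p r (Suc (n + k)) (ladder q p r n (Suc k))) i"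
    by simp
  also have "\<dots> = q * raise q p r (n + k) (lower q (ladder q p r n (Suc k))) i
      + (1 - q ^ (2 * Suc (n + k)) * r ^ 2) * ladder q p r n (Suc k) i"
    using lower_raise[OF p] Suc.prems by simp
  also have "raise q p r (n + k) (lower q (ladder q p r n (Suc k))) i =
     raise q p r (n + k) (\<lambda>i. qn (Suc k) q * (1 - q ^ (2 * n + k) * r ^ 2) * ladder q p r n k i) i"
    using Suc by (intro raise_cong) auto
  also have "\<dots> = qn (Suc k) q * (1 - q ^ (2 * n + k) * r ^ 2) * ladder q p r n (Suc k) i"
    by (simp add: raise_scale)
  also have "q * \<dots> + (1 - q ^ (2 * Suc (n + k)) * r ^ 2) * ladder q p r n (Suc k) i =
      (q * qn (Suc k) q * (1 - q ^ (2 * n + k) * r ^ 2) + (1 - q ^ (2 * Suc (n + k)) * r ^ 2)) * ladder q p r n (Suc k) i"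
    by (simp add: algebra_simps)
  also have "q * qn (Suc k) q * (1 - q ^ (2 * n + k) * r ^ 2) + (1 - q ^ (2 * Suc (n + k)) * r ^ 2) =
     qn (Suc (Suc k)) q * (1 - q ^ (2 * n + Suc k) * r ^ 2)"
  proof -
    define A where "A = q ^ (2 * n + k)"
    define B where "B = q ^ Suc k"
    define N where "N = qn (Suc k) q"
    define N' where "N' = qn (Suc (Suc k)) q"
    have e: "q ^ (2 * Suc (n + k)) = A * (q * B)" "q ^ (2 * n + Suc k) = A * q"
      by (simp_all add: A_def B_def power_add mult_2)
    have "N' = 1 + q * N" "N' = N + B"
      unfolding N_def N'_def B_def by (rule qn_Suc_left, rule qn_Suc)
    then show ?thesis
      unfolding e A_def[symmetric] N_def[symmetric] N'_def[symmetric] by algebra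
  qed
  finally show ?case .
qed

definition ladder_weight :: "'a::idom \<Rightarrow> 'a \<Rightarrow> nat \<Rightarrow> nat \<Rightarrow> 'a" where
  "ladder_weight q r n k = (\<Prod>j<k. qn (Suc (n + j)) q * (1 - q ^ (n + j) * r))"

lemma ladder_top: "ladder q p r n k (n + k) = p ^ (\<Sum>j<k. n + j) * ladder_weight q r n k"
  by (induction k) (simp_all add: ladder_weight_def raise_def power_add algebra_simps)

lemma ladder_bot: "ladder q p r n k 0 = (- r) ^ k * ladder_weight q r n k"
  by (induction k) (simp_all add: ladder_weight_def raise_def algebra_simps)

text \<open>
  Dividing the \<open>q\<close>-difference by \<open>q\<^sup>i\<close> makes the sum telescope. Hence this weighted sum detects whether
  a sequence is a \<open>q\<close>-difference of one with equal boundary values.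
\<close>

lemma sum_lower:
  fixes q p :: "'a::idom"
  assumes p: "p * q = 1"
  shows "(\<Sum>i<m. p ^ i * lower q c i) = c m - c 0"
proof -
  have "p ^ i * q ^ i = 1" for i
    using p by (simp flip: power_mult_distrib)
  then have "p ^ i * lower q c i = c (Suc i) - c i" for i
    unfolding lower_def by (simp flip: mult.assoc)
  then show ?thesis by (simp add: sum_lessThan_telescope)
qed

lemma double_sum_arith: "2 * (\<Sum>j<Suc k. n + j) = Suc k * (2 * n + k)" for n k :: nat
  by (induction k) auto

lemma ladder_power_even:
  fixes q r :: "'a::idom"
  assumes E: "E = (\<Sum>j<Suc k. n + j)" and k: "Suc k = 2 * h"
  shows "(- r) ^ Suc k * q ^ E = (q ^ (2 * n + k) * r ^ 2) ^ h"
proof -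
  have E': "E = h * (2 * n + k)"
    using double_sum_arith[of n k] unfolding E[symmetric] unfolding k by simp
  show ?thesis
    unfolding k E' by (simp add: power_mult power_mult_distrib mult.commute flip: power_mult)
qed

lemma ladder_power_odd:
  fixes q r :: "'a::idom"
  assumes E: "E = (\<Sum>j<Suc k. n + j)" and e: "2 * n + k = 2 * e"
  shows "(- r) ^ Suc k * q ^ E = (- (q ^ e) * r) ^ Suc k"
proof -
  have E': "E = e * Suc k"
    using double_sum_arith[of n k] unfolding E[symmetric] unfolding e by (simp add: algebra_simps)
  have "(- r) ^ Suc k * q ^ E = (- r * q ^ e) ^ Suc k"
    unfolding E' power_mult power_mult_distrib by simp
  then show ?thesis by (simp add: mult.commute)
qed

definition ladder_sum :: "'a::idom \<Rightarrow> 'a \<Rightarrow> 'a \<Rightarrow> nat \<Rightarrow> nat \<Rightarrow> 'a" where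
  "ladder_sum q p r n k = (\<Sum>i\<le>n + k. p ^ i * ladder q p r n k i)"

text \<open>
  Since \<open>lower\<close> maps the ladder at step \<open>k + 1\<close> to a multiple of the ladder at step \<open>k\<close>, the weighted
  sum is, up to that multiple, the difference of the two boundary values, which are products.
\<close>

lemma ladder_sum_relation:
  fixes q p r :: "'a::idom"
  assumes p: "p * q = 1" and E: "E = (\<Sum>j<Suc k. n + j)"
  shows "qn (Suc k) q * (1 - q ^ (2 * n + k) * r ^ 2) * ladder_sum q p r n k =
    ladder_weight q r n (Suc k) * p ^ E * (1 - (- r) ^ Suc k * q ^ E)"
proof -
  have "qn (Suc k) q * (1 - q ^ (2 * n + k) * r ^ 2) * ladder_sum q p r n k =
     (\<Sum>i<n + Suc k. p ^ i * lower q (ladder q p r n (Suc k)) i)"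
    unfolding ladder_sum_def sum_distrib_left
    by (rule sum.cong) (auto simp: lower_ladder[OF p] lessThan_Suc_atMost mult_ac simp del: ladder.simps)
  also have "\<dots> = ladder q p r n (Suc k) (n + Suc k) - ladder q p r n (Suc k) 0"
    by (rule sum_lower[OF p])
  also have "\<dots> = ladder_weight q r n (Suc k) * (p ^ E - (- r) ^ Suc k)"
    unfolding ladder_top ladder_bot E by (simp add: algebra_simps)
  also have "p ^ E - (- r) ^ Suc k = p ^ E * (1 - (- r) ^ Suc k * q ^ E)"
    using p by (simp add: algebra_simps flip: power_mult_distrib)
  finally show ?thesis by (simp add: mult.assoc)
qed

text \<open>
  The factor \<open>1 - q\<^bsup>2n+k\<^esup> r\<^sup>2\<close> in \<open>ladder_sum_relation\<close> is cancelled. The case where it vanishes is the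
  interesting one; it is recovered in \<open>ladder_sum_even\<close>.
\<close>

lemma ladder_sum_even_generic:
  fixes q p r :: "'a::idom"
  assumes p: "p * q = 1" and E: "E = (\<Sum>j<Suc k. n + j)"
    and k: "Suc k = 2 * h" and ne: "q ^ (2 * n + k) * r ^ 2 \<noteq> 1"
  shows "qn (Suc k) q * ladder_sum q p r n k = ladder_weight q r n (Suc k) * p ^ E * qn h (q ^ (2 * n + k) * r ^ 2)"
proof -
  let ?T = "q ^ (2 * n + k) * r ^ 2"
  have "1 - (- r) ^ Suc k * q ^ E = (1 - ?T) * qn h ?T"
    unfolding ladder_power_even[OF E k] by (rule one_diff_power_qn)
  with ladder_sum_relation[OF p E, of r] have
    "(1 - ?T) * (qn (Suc k) q * ladder_sum q p r n k) = (1 - ?T) * (ladder_weight q r n (Suc k) * p ^ E * qn h ?T)"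
    by (simp add: mult_ac)
  then show ?thesis using ne by simp
qed

text \<open>
  For an odd number of steps the exponent \<open>2n + k\<close> is even, and with \<open>t = - q\<^sup>e r\<close> the factor
  \<open>1 - t\<^sup>2\<close> is only cancelled partly, by \<open>1 - t\<close>.
\<close>

lemma ladder_sum_odd_generic:
  fixes q p r :: "'a::idom"
  assumes p: "p * q = 1" and E: "E = (\<Sum>j<Suc k. n + j)"
    and e: "2 * n + k = 2 * e" and ne: "- (q ^ e) * r \<noteq> 1"
  shows "qn (Suc k) q * (1 - q ^ e * r) * ladder_sum q p r n k =
    ladder_weight q r n (Suc k) * p ^ E * qn (Suc k) (- (q ^ e) * r)"
proof -
  let ?t = "- (q ^ e) * r"
  have T: "q ^ (2 * n + k) * r ^ 2 = ?t ^ 2"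
    unfolding e by (simp add: power_mult_distrib mult.commute flip: power_mult)
  have "1 - (- r) ^ Suc k * q ^ E = (1 - ?t) * qn (Suc k) ?t"
    unfolding ladder_power_odd[OF E e] by (rule one_diff_power_qn)
  with ladder_sum_relation[OF p E, of r] have
    rel: "qn (Suc k) q * (1 - ?t ^ 2) * ladder_sum q p r n k =
      ladder_weight q r n (Suc k) * p ^ E * ((1 - ?t) * qn (Suc k) ?t)"
    unfolding T by simp
  have gen: "(1 - t) * (N * (1 + t) * S) = (1 - t) * (W * Y)" if "N * (1 - t ^ 2) * S = W * ((1 - t) * Y)"
    for N t S W Y :: 'a
    using that by algebra
  have "1 - q ^ e * r = 1 + ?t" by simp
  then have
    "(1 - ?t) * (qn (Suc k) q * (1 - q ^ e * r) * ladder_sum q p r n k) = (1 - ?t) * (ladder_weight q r n (Suc k) * p ^ E * qn (Suc k) ?t)"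
    using gen[OF rel] by simp
  moreover have "1 - ?t \<noteq> 0"
    using ne by (metis right_minus_eq)
  ultimately show ?thesis by (metis mult_left_cancel)
qed

lemma poly_qn: "poly (qn k t) x = qn k (poly t x)"
  by (simp add: qn_def poly_sum poly_power)

lemma poly_ladder:
  "poly (ladder q p r n k i) x = ladder (poly q x) (poly p x) (poly r x) n k i"
  by (induction k arbitrary: i) (simp_all add: raise_def poly_qn poly_power)

lemma poly_ladder_sum:
  "poly (ladder_sum q p r n k) x = ladder_sum (poly q x) (poly p x) (poly r x) n k"
  by (simp add: ladder_sum_def poly_sum poly_power poly_ladder)

lemma poly_ladder_weight:
  "poly (ladder_weight q r n k) x = ladder_weight (poly q x) (poly r x) n k"
  by (simp add: ladder_weight_def poly_prod poly_power poly_qn)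

text \<open>
  An identity polynomial in \<open>r\<close>. Over the polynomial ring, with \<open>r\<close> replaced by the variable, the
  factor to be cancelled has constant term \<open>1\<close>, so \<open>ladder_sum_even_generic\<close> applies, and evaluation
  gives the identity for every \<open>r\<close>.
\<close>

lemma ladder_sum_even:
  fixes q p r :: "'a::idom"
  assumes p: "p * q = 1" and E: "E = (\<Sum>j<Suc k. n + j)" and k: "Suc k = 2 * h"
  shows "qn (Suc k) q * ladder_sum q p r n k = ladder_weight q r n (Suc k) * p ^ E * qn h (q ^ (2 * n + k) * r ^ 2)"
proof -
  let ?q = "[:q:]" and ?p = "[:p:]" and ?x = "[:0, 1:] :: 'a poly"
  have "?p * ?q = 1" using p by (simp add: one_pCons mult.commute)
  moreover have "?q ^ (2 * n + k) * ?x ^ 2 \<noteq> 1"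
  proof
    assume "?q ^ (2 * n + k) * ?x ^ 2 = 1"
    then have "poly (?q ^ (2 * n + k) * ?x ^ 2) 0 = poly 1 0" by simp
    then show False by (simp add: poly_power)
  qed
  ultimately have "poly (qn (Suc k) ?q * ladder_sum ?q ?p ?x n k) r =
     poly (ladder_weight ?q ?x n (Suc k) * ?p ^ E * qn h (?q ^ (2 * n + k) * ?x ^ 2)) r"
    using ladder_sum_even_generic[OF _ E k] by metis
  then show ?thesis
    by (simp add: poly_qn poly_ladder_sum poly_ladder_weight poly_power)
qed

lemma ladder_sum_odd:
  fixes q p r :: "'a::idom"
  assumes p: "p * q = 1" and E: "E = (\<Sum>j<Suc k. n + j)" and e: "2 * n + k = 2 * e"
  shows "qn (Suc k) q * (1 - q ^ e * r) * ladder_sum q p r n k =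
    ladder_weight q r n (Suc k) * p ^ E * qn (Suc k) (- (q ^ e) * r)"
proof -
  let ?q = "[:q:]" and ?p = "[:p:]" and ?x = "[:0, 1:] :: 'a poly"
  have "?p * ?q = 1" using p by (simp add: one_pCons mult.commute)
  moreover have "- (?q ^ e) * ?x \<noteq> 1"
  proof
    assume "- (?q ^ e) * ?x = 1"
    then have "poly (- (?q ^ e) * ?x) 0 = poly 1 0" by simp
    then show False by (simp add: poly_power)
  qed
  ultimately have "poly (qn (Suc k) ?q * (1 - ?q ^ e * ?x) * ladder_sum ?q ?p ?x n k) r =
     poly (ladder_weight ?q ?x n (Suc k) * ?p ^ E * qn (Suc k) (- (?q ^ e) * ?x)) r"
    using ladder_sum_odd_generic[OF _ E e] by metis
  then show ?thesis
    by (simp add: poly_qn poly_ladder_sum poly_ladder_weight poly_power mult.commute[of r])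
qed

section \<open>Coordinates on \<open>U\<^sub>m\<close>\<close>

lemma counit_homog: "homog a y \<Longrightarrow> a \<noteq> (0, 0) \<Longrightarrow> counit y = 0"
  by (force simp: homog_def counit_def in_keys_iff zero_word_def)

text \<open>
  The skew-derivations need not separate the products \<open>u\<^sub>i u\<^sub>m\<^sub>-\<^sub>i\<close>, since \<open>d\<^sub>1\<close> and \<open>d\<^sub>2\<close> may have common
  zeros. Looking at final letters does: applied twice, this map isolates one coordinate.
\<close>

definition strip :: "'k::field tensor_alg \<Rightarrow> 'k tensor_alg" where
  "strip = lin_ext (\<lambda>w. if letters w \<noteq> [] \<and> last (letters w) = X2 then mon (butlast (letters w)) else 0)"

lemma lin_strip [simp]: "lin strip"
  by (simp add: strip_def)

lemma strip_x2: "strip (y * x2) = y"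
  by (rule lin_eq_monI[where y = y], rule lin_comp[OF lin_strip lin_mult_right], rule linI)
    (simp_all add: mon_times strip_def)

lemma strip_x1: "strip (y * x1) = 0"
  by (rule lin_eq_monI[where y = y], rule lin_comp[OF lin_strip lin_mult_right], rule linI)
    (simp_all add: mon_times strip_def)

lemma strip_u: "strip (y * u Q k) = y * x1 ^ k"
proof (induction k arbitrary: y)
  case 0
  then show ?case by (simp add: strip_x2)
next
  case (Suc k)
  have "y * u Q (Suc k) = (y * x1) * u Q k - scale (qq Q ^ k * Q X1 X2) ((y * u Q k) * x1)"
    by (simp add: right_diff_distrib scale_mult_right mult.assoc)
  then have "strip (y * u Q (Suc k)) = (y * x1) * x1 ^ k"
    by (simp only: pmp.linear_diff[OF lin_strip] pmp.linear_scale[OF lin_strip] strip_x1 Suc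
        pm.scale_zero_right diff_zero)
  then show ?case
    by (simp only: power_Suc mult.assoc)
qed

lemma all_gen: "(\<forall>i. R i) \<longleftrightarrow> R X1 \<and> R X2"
  by (metis gen.exhaust)

lemma x1_power: "(x1 :: 'k::field tensor_alg) ^ k = mon (replicate k X1)"
  by (induction k) (simp_all add: mon_Nil mon_times)

context diagonal_braiding
begin

abbreviation "q \<equiv> qq Q"
abbreviation "r \<equiv> rr Q"
abbreviation "s \<equiv> ss Q"
abbreviation "q21 \<equiv> Q X2 X1"
abbreviation "d1 \<equiv> deriv Q X1"
abbreviation "d2 \<equiv> deriv Q X2"
abbreviation "ad \<equiv> ad_x1 Q"

lemma q_nz [simp]: "q \<noteq> 0" "q21 \<noteq> 0" "Q X1 X2 \<noteq> 0" "s \<noteq> 0"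
  using Q by auto

definition norm_fac :: "nat \<Rightarrow> 'k" where
  "norm_fac k = qfact k q * bcoef q r k"

text \<open>
  The condition on \<open>m\<close> in the theorem. It passes to all smaller numbers, so it is available in every
  step of an induction.
\<close>

abbreviation nondeg :: "nat \<Rightarrow> bool" where
  "nondeg k \<equiv> norm_fac k \<noteq> 0"

abbreviation wt :: "nat \<Rightarrow> 'k" where
  "wt k \<equiv> qn (Suc k) q * (1 - q ^ k * r)"

lemma norm_fac_0 [simp]: "norm_fac 0 = 1"
  by (simp add: norm_fac_def qfact_def bcoef_def)

lemma norm_fac_Suc: "norm_fac (Suc k) = norm_fac k * wt k"
  by (simp add: norm_fac_def qfact_def bcoef_def qnum_eq_qn)

lemma nondeg_le: "nondeg m \<Longrightarrow> k \<le> m \<Longrightarrow> nondeg k"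
proof (induction m)
  case (Suc m)
  then show ?case by (cases "k = Suc m") (auto simp: norm_fac_Suc)
qed simp

lemma nondeg_wt: "nondeg m \<Longrightarrow> k < m \<Longrightarrow> wt k \<noteq> 0"
  using nondeg_le[of m "Suc k"] by (simp add: norm_fac_Suc)

lemma nondeg_qn: "nondeg m \<Longrightarrow> 0 < k \<Longrightarrow> k \<le> m \<Longrightarrow> qn k q \<noteq> 0"
  using nondeg_wt[of m "k - 1"] by simp

lemma nondeg_r: "nondeg m \<Longrightarrow> k < m \<Longrightarrow> q ^ k * r \<noteq> 1"
  using nondeg_wt[of m k] by auto

lemma homog_x1: "homog (1, 0) (x1 :: 'k tensor_alg)"
  using homog_mon[of "[X1]"] by (simp add: deg_def)

lemma homog_x2: "homog (0, 1) (x2 :: 'k tensor_alg)"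
  using homog_mon[of "[X2]"] by (simp add: deg_def)

lemma homog_u: "homog (int k, 1) (u Q k)"
proof (induction k)
  case 0
  show ?case using homog_x2 by simp
next
  case (Suc k)
  have "homog (int (Suc k), 1) (x1 * u Q k)" "homog (int (Suc k), 1) (u Q k * x1)"
    using homog_mult[OF homog_x1 Suc] homog_mult[OF Suc homog_x1] by (simp_all add: add.commute)
  then show ?case by (auto intro: homog_diff homog_scale)
qed

lemma Leibniz: "homog a x \<Longrightarrow> deriv Q i (x * y) = deriv Q i x * y + scale (chi Q a (alpha i)) (x * deriv Q i y)"
  using deriv_Leibniz[OF Q] by (simp add: homog_def)

text \<open>
  Since \<open>u\<^sub>k\<^sub>+\<^sub>1 = x\<^sub>1 u\<^sub>k - q\<^sup>k q\<^sub>1\<^sub>2 u\<^sub>k x\<^sub>1\<close>, the Leibniz rule gives a multiple of \<open>u\<^sub>k\<close> plus the bracket that defines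
  \<open>u\<^sub>k\<close> from \<open>u\<^sub>k\<^sub>-\<^sub>1\<close>.
\<close>

lemma d1_u: "d1 (u Q (Suc k)) = scale (wt k) (u Q k)"
proof (induction k)
  case 0
  have "d1 (u Q (Suc 0)) = x2 - scale (Q X1 X2 * q21) x2"
    by (simp add: pmp.linear_diff[OF lin_deriv] pmp.linear_scale[OF lin_deriv] Leibniz[OF homog_x1]
        Leibniz[OF homog_x2] deriv_gen)
  then show ?case by (simp add: pm.scale_left_diff_distrib)
next
  case (Suc k)
  let ?u = "u Q (Suc k)"
  have pw: "q powi (1 + int k) = q * q ^ k"
    by (metis of_nat_Suc power_int_of_nat power_Suc)
  have 1: "d1 (x1 * ?u) = ?u + scale (q * wt k) (x1 * u Q k)"
    by (simp only: Leibniz[OF homog_x1] Suc) (simp add: deriv_gen scale_mult_right mult.assoc)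
  have 2: "d1 (?u * x1) = scale (wt k) (u Q k * x1) + scale (q ^ Suc k * q21) ?u"
    by (simp only: Leibniz[OF homog_u] Suc) (simp add: deriv_gen scale_mult_left pw)
  have "d1 (u Q (Suc (Suc k))) = d1 (x1 * ?u) - scale (q ^ Suc k * Q X1 X2) (d1 (?u * x1))"
    by (simp only: u.simps pmp.linear_diff[OF lin_deriv] pmp.linear_scale[OF lin_deriv])
  also have "\<dots> = ?u + scale (q * wt k) (x1 * u Q k - scale (q ^ k * Q X1 X2) (u Q k * x1))
      - scale (q ^ Suc k * Q X1 X2 * (q ^ Suc k * q21)) ?u"
    unfolding 1 2
    by (simp add: pm.scale_right_distrib pm.scale_right_diff_distrib mult_ac del: u.simps)
  also have "x1 * u Q k - scale (q ^ k * Q X1 X2) (u Q k * x1) = ?u" by simp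
  also have "?u + scale (q * wt k) ?u - scale (q ^ Suc k * Q X1 X2 * (q ^ Suc k * q21)) ?u =
      scale (1 + q * wt k - q ^ Suc k * q ^ Suc k * r) ?u"
    by (simp add: pm.scale_left_distrib pm.scale_left_diff_distrib mult_ac del: u.simps)
  also have "1 + q * wt k - q ^ Suc k * q ^ Suc k * r = wt (Suc k)"
  proof -
    have *: "1 + q * (N * (1 - a * x)) - q * a * (q * a) * x = M * (1 - q * a * x)"
      if "M = 1 + q * N" "M = N + q * a" for M N a x :: 'k
      using that by algebra
    show ?thesis
      using *[OF qn_Suc_left[of "Suc k" q], of "q ^ k"] qn_Suc[of "Suc k" q] by simp
  qed
  finally show ?case .
qed

lemma d2_u: "d2 (u Q k) = (if k = 0 then 1 else 0)"
proof (induction k)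
  case 0
  then show ?case by (simp add: deriv_gen)
next
  case (Suc k)
  show ?case using Suc
    by (cases "k = 0") (auto simp: pmp.linear_diff[OF lin_deriv] pmp.linear_scale[OF lin_deriv]
        Leibniz[OF homog_x1] Leibniz[OF homog_u] Leibniz[OF homog_x2] deriv_gen)
qed

lemma uhat_eq: "nondeg k \<Longrightarrow> uhat Q k = scale (1 / norm_fac k) (u Q k)"
  by (simp add: uhat_def norm_fac_def)

lemma u_eq: "nondeg k \<Longrightarrow> u Q k = scale (norm_fac k) (uhat Q k)"
  by (simp add: uhat_eq)

lemma homog_uhat: "nondeg k \<Longrightarrow> homog (int k, 1) (uhat Q k)"
  by (simp add: uhat_eq homog_scale homog_u)

lemma d1_uhat_0: "d1 (uhat Q 0) = 0"
  by (simp add: uhat_eq deriv_gen)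

lemma d1_uhat: "nondeg (Suc k) \<Longrightarrow> d1 (uhat Q (Suc k)) = uhat Q k"
  using nondeg_le[of "Suc k" k]
  by (simp add: uhat_eq pmp.linear_scale[OF lin_deriv] d1_u norm_fac_Suc del: u.simps)

lemma d2_uhat: "nondeg k \<Longrightarrow> d2 (uhat Q k) = (if k = 0 then 1 else 0)"
  by (simp add: uhat_eq pmp.linear_scale[OF lin_deriv] d2_u)

lemma bracket_uhat:
  "nondeg (Suc k) \<Longrightarrow> x1 * uhat Q k - scale (q ^ k * Q X1 X2) (uhat Q k * x1) = scale (wt k) (uhat Q (Suc k))"
  using nondeg_le[of "Suc k" k]
  by (simp add: uhat_eq norm_fac_Suc scale_mult_left scale_mult_right pm.scale_right_diff_distrib mult_ac)

lemma ad_homog: "homog a y \<Longrightarrow> ad y = x1 * y - scale (chi Q (1, 0) a) (y * x1)"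
proof -
  assume h: "homog a y"
  have "ad y = (\<Sum>w\<in>Poly_Mapping.keys y. scale (Poly_Mapping.lookup y w) (x1 * mon (letters w))
       - scale (chi Q (1, 0) a) (scale (Poly_Mapping.lookup y w) (mon (letters w) * x1)))"
    unfolding ad_x1_def lin_ext_def using h
    by (intro sum.cong refl) (simp add: homog_def pm.scale_right_diff_distrib mult.commute)
  also have "\<dots> = x1 * (\<Sum>w\<in>Poly_Mapping.keys y. scale (Poly_Mapping.lookup y w) (mon (letters w))) -
     scale (chi Q (1, 0) a) ((\<Sum>w\<in>Poly_Mapping.keys y. scale (Poly_Mapping.lookup y w) (mon (letters w))) * x1)"
    by (simp add: sum_subtractf sum_distrib_left sum_distrib_right pm.scale_sum_right scale_mult_right scale_mult_left)
  finally show ?thesis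
    by (simp flip: sum_scale_mon)
qed

text \<open>
  The coefficients of \<open>P\<^sub>m\<close>, used as weights of the coordinates. With this choice \<open>P\<^sub>m\<close> has constant
  coordinates and \<open>d\<^sub>1\<close> acts by differences.
\<close>

definition gcoef :: "nat \<Rightarrow> 'k" where
  "gcoef i = (- q21) ^ i * q ^ (i * (i - 1) div 2)"

lemma gcoef_0 [simp]: "gcoef 0 = 1"
  by (simp add: gcoef_def)

lemma gcoef_nz [simp]: "gcoef i \<noteq> 0"
  by (simp add: gcoef_def)

lemma triangle_Suc: "Suc i * i div 2 = i * (i - 1) div 2 + i"
proof -
  have "Suc i * i = i * (i - 1) + 2 * i" by (cases i) auto
  then show ?thesis by (simp only: div_mult_self2[OF zero_neq_numeral[symmetric]])
qed

lemma gcoef_Suc: "gcoef (Suc i) = - q21 * q ^ i * gcoef i"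
  using triangle_Suc[of i] by (simp add: gcoef_def power_add)

text \<open>
  Coordinate sequences are total functions, but only the values at \<open>0, \<dots>, m\<close> matter.
\<close>

definition Phi :: "nat \<Rightarrow> (nat \<Rightarrow> 'k) \<Rightarrow> 'k tensor_alg" where
  "Phi m c = (\<Sum>i\<le>m. scale (gcoef i * c i) (uhat Q i * uhat Q (m - i)))"

lemma Phi_cong: "(\<And>i. i \<le> m \<Longrightarrow> c i = c' i) \<Longrightarrow> Phi m c = Phi m c'"
  by (simp add: Phi_def)

lemma Phi_add: "Phi m (\<lambda>i. c i + c' i) = Phi m c + Phi m c'"
  by (simp add: Phi_def distrib_left pm.scale_left_distrib sum.distrib)

lemma Phi_scale: "Phi m (\<lambda>i. a * c i) = scale a (Phi m c)"
  by (simp add: Phi_def pm.scale_sum_right mult.left_commute)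

lemma Phi_diff: "Phi m (\<lambda>i. c i - c' i) = Phi m c - Phi m c'"
  by (simp add: Phi_def right_diff_distrib pm.scale_left_diff_distrib sum_subtractf)

lemma Phi_0: "Phi m (\<lambda>i. 0) = 0"
  by (simp add: Phi_def)

lemma P_eq_Phi: "P Q m = Phi m (\<lambda>_. 1)"
  by (simp add: P_def Phi_def gcoef_def atMost_atLeast0)

lemma homog_Phi:
  assumes "nondeg m" shows "homog (int m, 2) (Phi m c)"
proof -
  have "homog (int m, 2) (\<Sum>i\<in>A. scale (gcoef i * c i) (uhat Q i * uhat Q (m - i)))" if "finite A" "A \<subseteq> {..m}" for A
    using that
  proof induction
    case (insert i A)
    then have "homog ((int i, 1) + (int (m - i), 1)) (uhat Q i * uhat Q (m - i))"
      using nondeg_le[OF assms] by (intro homog_mult homog_uhat) auto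
    then have "homog (int m, 2) (uhat Q i * uhat Q (m - i))"
      using insert by simp
    then show ?case using insert by (simp add: homog_add homog_scale)
  qed simp
  then show ?thesis unfolding Phi_def by simp
qed

lemma d1_Phi_0: "d1 (Phi 0 c) = 0"
proof -
  have "homog (0, 1) (uhat Q 0)" using homog_uhat[of 0] by simp
  then show ?thesis
    by (simp add: Phi_def pmp.linear_scale[OF lin_deriv] Leibniz d1_uhat_0)
qed

lemma d1_Phi:
  assumes "nondeg (Suc m)"
  shows "d1 (Phi (Suc m) c) = scale (- q21) (Phi m (lower q c))"
proof -
  let ?f = "\<lambda>i. scale (gcoef i * c i) (d1 (uhat Q i) * uhat Q (Suc m - i))"
  let ?g = "\<lambda>i. scale (gcoef i * c i * (q ^ i * q21)) (uhat Q i * d1 (uhat Q (Suc m - i)))"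
  have "d1 (Phi (Suc m) c) = (\<Sum>i\<le>Suc m. ?f i + ?g i)"
    unfolding Phi_def pmp.linear_sum[OF lin_deriv]
    by (intro sum.cong refl)
      (auto simp: pmp.linear_scale[OF lin_deriv] Leibniz[OF homog_uhat[OF nondeg_le[OF assms]]]
        pm.scale_right_distrib)
  also have "\<dots> = (\<Sum>i\<le>Suc m. ?f i) + (\<Sum>i\<le>Suc m. ?g i)"
    by (rule sum.distrib)
  also have "(\<Sum>i\<le>Suc m. ?f i) = (\<Sum>i\<le>m. ?f (Suc i))"
    unfolding sum.atMost_Suc_shift by (simp add: d1_uhat_0)
  also have "(\<Sum>i\<le>Suc m. ?g i) = (\<Sum>i\<le>m. ?g i)"
    by (simp add: d1_uhat_0)
  also have "(\<Sum>i\<le>m. ?f (Suc i)) + (\<Sum>i\<le>m. ?g i) = scale (- q21) (Phi m (lower q c))"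
    unfolding Phi_def pm.scale_sum_right sum.distrib[symmetric]
  proof (intro sum.cong refl)
    fix i assume "i \<in> {..m}"
    then have "d1 (uhat Q (Suc i)) = uhat Q i" "d1 (uhat Q (Suc m - i)) = uhat Q (m - i)"
      using nondeg_le[OF assms] by (auto intro!: d1_uhat simp: Suc_diff_le)
    then show "?f (Suc i) + ?g i = scale (- q21) (scale (gcoef i * lower q c i) (uhat Q i * uhat Q (m - i)))"
      by (simp add: gcoef_Suc lower_def algebra_simps pm.scale_left_distrib pm.scale_left_diff_distrib)
  qed
  finally show ?thesis .
qed

text \<open>
  In these terms \<open>d\<^sub>2\<close> of an element with coordinates \<open>c\<close> is \<open>(c\<^sub>0 + \<mu>\<^sub>m c\<^sub>m) uhat\<^sub>m\<close>, and \<open>\<mu>\<^sub>m = -1\<close> is the first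
  condition for \<open>m \<in> \<J>\<close>.
\<close>

definition mu :: "nat \<Rightarrow> 'k" where
  "mu m = q ^ (m * (m - 1) div 2) * (- r) ^ m * s"

lemma mu_Suc: "mu (Suc m) = - r * q ^ m * mu m"
  using triangle_Suc[of m] by (simp add: mu_def power_add)

lemma d2_Phi:
  assumes "nondeg m"
  shows "d2 (Phi m c) = scale (c 0 + mu m * c m) (uhat Q m)"
proof -
  have "(- q21) ^ m * Q X1 X2 ^ m = (- r) ^ m"
    by (simp add: mult.commute flip: power_mult_distrib)
  then have mu: "gcoef m * (s * Q X1 X2 ^ m) = mu m"
    unfolding gcoef_def mu_def by (simp add: mult_ac)
  let ?f = "\<lambda>i. scale (gcoef i * c i) (d2 (uhat Q i) * uhat Q (m - i))"
  let ?g = "\<lambda>i. scale (gcoef i * c i * (Q X1 X2 ^ i * s)) (uhat Q i * d2 (uhat Q (m - i)))"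
  have "d2 (Phi m c) = (\<Sum>i\<le>m. ?f i + ?g i)"
    unfolding Phi_def pmp.linear_sum[OF lin_deriv]
    by (intro sum.cong refl)
      (auto simp: pmp.linear_scale[OF lin_deriv] Leibniz[OF homog_uhat[OF nondeg_le[OF assms]]]
        pm.scale_right_distrib)
  also have "\<dots> = (\<Sum>i\<le>m. ?f i) + (\<Sum>i\<le>m. ?g i)"
    by (rule sum.distrib)
  also have "(\<Sum>i\<le>m. ?f i) = (\<Sum>i\<in>{0}. ?f i)"
    using nondeg_le[OF assms] by (intro sum.mono_neutral_right) (auto simp: d2_uhat)
  also have "(\<Sum>i\<le>m. ?g i) = (\<Sum>i\<in>{m}. ?g i)"
    using nondeg_le[OF assms] by (intro sum.mono_neutral_right) (auto simp: d2_uhat)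
  also have "(\<Sum>i\<in>{0}. ?f i) + (\<Sum>i\<in>{m}. ?g i) = scale (c 0 + mu m * c m) (uhat Q m)"
    by (simp add: d2_uhat pm.scale_left_distrib mult.commute mu)
  finally show ?thesis .
qed

lemma ad_uhat_mult:
  assumes "nondeg (Suc i)" "nondeg (Suc j)"
  shows "ad (uhat Q i * uhat Q j) = scale (wt i) (uhat Q (Suc i) * uhat Q j)
     + scale (q ^ i * Q X1 X2 * wt j) (uhat Q i * uhat Q (Suc j))"
proof -
  have g: "nondeg i" "nondeg j" using nondeg_le[OF assms(1), of i] nondeg_le[OF assms(2), of j] by simp_all
  let ?a = "q ^ i * Q X1 X2" and ?b = "q ^ j * Q X1 X2"
  have "homog (int i + int j, 2) (uhat Q i * uhat Q j)"
    using homog_mult[OF homog_uhat[OF g(1)] homog_uhat[OF g(2)]] by simp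
  moreover have "chi Q (1, 0) (int i + int j, 2) = ?a * ?b"
    by (simp add: power_int_add power2_eq_square)
  ultimately have "ad (uhat Q i * uhat Q j) = x1 * (uhat Q i * uhat Q j) - scale (?a * ?b) (uhat Q i * uhat Q j * x1)"
    using ad_homog by metis
  also have "\<dots> = (x1 * uhat Q i - scale ?a (uhat Q i * x1)) * uhat Q j
      + scale ?a (uhat Q i * (x1 * uhat Q j - scale ?b (uhat Q j * x1)))"
    by (simp add: left_diff_distrib right_diff_distrib pm.scale_right_diff_distrib scale_mult_left
        scale_mult_right mult.assoc)
  also have "\<dots> = scale (wt i) (uhat Q (Suc i) * uhat Q j)
     + scale (?a * wt j) (uhat Q i * uhat Q (Suc j))"
    by (simp only: bracket_uhat[OF assms(1)] bracket_uhat[OF assms(2)] scale_mult_left scale_mult_right pm.scale_scale)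
  finally show ?thesis .
qed

text \<open>
  Each product \<open>uhat\<^sub>i uhat\<^sub>m\<^sub>-\<^sub>i\<close> contributes to two neighbouring products, by the twisted Leibniz rule for
  \<open>ad x\<^sub>1\<close>. Collecting the contributions to one product gives the two terms of \<open>raise\<close>.
\<close>

lemma ad_Phi:
  assumes "nondeg (Suc m)"
  shows "ad (Phi m c) = scale (- (1 / q21)) (Phi (Suc m) (raise q (1 / q) r m c))"
proof -
  let ?v = "\<lambda>i. uhat Q i * uhat Q (Suc m - i)"
  let ?f = "\<lambda>i. scale (- (1 / q21) * gcoef i * ((1 / q) ^ (i - 1) * qn i q * (1 - q ^ (i - 1) * r) * c (i - 1))) (?v i)"
  let ?g = "\<lambda>i. scale (1 / q21 * gcoef i * (r * q ^ i * qn (m + 1 - i) q * (1 - q ^ (m - i) * r) * c i)) (?v i)"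
  have gen: "scale (- a) (scale (g * (A - B)) v) = scale (- a * g * A) v + scale (a * g * B) v"
    for a g A B :: 'k and v :: "'k tensor_alg"
    unfolding pm.scale_scale pm.scale_left_distrib[symmetric]
    by (rule arg_cong[of _ _ "\<lambda>b. scale b v"]) (simp add: algebra_simps)
  have "scale (- (1 / q21)) (Phi (Suc m) (raise q (1 / q) r m c)) = (\<Sum>i\<le>Suc m. ?f i + ?g i)"
    unfolding Phi_def pm.scale_sum_right raise_def by (intro sum.cong refl gen)
  also have "\<dots> = (\<Sum>i\<le>Suc m. ?f i) + (\<Sum>i\<le>Suc m. ?g i)"
    by (rule sum.distrib)
  also have "(\<Sum>i\<le>Suc m. ?f i) = (\<Sum>i\<le>m. ?f (Suc i))"
    unfolding sum.atMost_Suc_shift by simp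
  also have "(\<Sum>i\<le>Suc m. ?g i) = (\<Sum>i\<le>m. ?g i)"
    by simp
  also have "(\<Sum>i\<le>m. ?f (Suc i)) + (\<Sum>i\<le>m. ?g i) = (\<Sum>i\<le>m. scale (gcoef i * c i) (ad (uhat Q i * uhat Q (m - i))))"
    unfolding sum.distrib[symmetric]
  proof (intro sum.cong refl)
    fix i assume "i \<in> {..m}"
    then have i: "i \<le> m" by simp
    have e: "(1 / q) ^ i * q ^ i = 1" by (simp add: power_divide)
    have 1: "- (1 / q21) * gcoef (Suc i) * ((1 / q) ^ i * wt i * c i) = gcoef i * c i * wt i"
      using e by (simp add: gcoef_Suc power_divide)
    have 2: "1 / q21 * gcoef i * (r * q ^ i * wt (m - i) * c i) = gcoef i * c i * (q ^ i * Q X1 X2 * wt (m - i))"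
      by (simp add: field_simps)
    have "?f (Suc i) = scale (gcoef i * c i * wt i) (uhat Q (Suc i) * uhat Q (m - i))"
      using 1 by (simp add: mult.assoc)
    moreover have "?g i = scale (gcoef i * c i * (q ^ i * Q X1 X2 * wt (m - i))) (uhat Q i * uhat Q (Suc (m - i)))"
      using 2 i by (simp add: Suc_diff_le mult.assoc)
    moreover have "ad (uhat Q i * uhat Q (m - i)) = scale (wt i) (uhat Q (Suc i) * uhat Q (m - i))
     + scale (q ^ i * Q X1 X2 * wt (m - i)) (uhat Q i * uhat Q (Suc (m - i)))"
      using i by (intro ad_uhat_mult nondeg_le[OF assms]) auto
    ultimately show "?f (Suc i) + ?g i = scale (gcoef i * c i) (ad (uhat Q i * uhat Q (m - i)))"
      by (simp only: pm.scale_right_distrib pm.scale_scale)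
  qed
  also have "\<dots> = ad (Phi m c)"
    by (simp add: Phi_def pmp.linear_sum[OF lin_ad_x1] pmp.linear_scale[OF lin_ad_x1])
  finally show ?thesis ..
qed

lemma span_products:
  assumes "nondeg m" "I \<subseteq> {..m}"
  shows "pm.span ((\<lambda>i. u Q i * u Q (m - i)) ` I) = {Phi m c | c. \<forall>i\<le>m. i \<notin> I \<longrightarrow> c i = 0}" (is "?S = ?R")
proof
  have prod: "u Q i * u Q (m - i) = scale (norm_fac i * norm_fac (m - i)) (uhat Q i * uhat Q (m - i))" if "i \<le> m" for i
    using that nondeg_le[OF assms(1)] by (simp add: u_eq scale_mult_left scale_mult_right)
  have nz: "norm_fac i * norm_fac (m - i) \<noteq> 0" if "i \<le> m" for i
    using that nondeg_le[OF assms(1)] by simp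
  show "?S \<subseteq> ?R"
  proof (rule pm.span_minimal)
    show "(\<lambda>i. u Q i * u Q (m - i)) ` I \<subseteq> ?R"
    proof clarify
      fix i assume i: "i \<in> I"
      then have im: "i \<le> m" using assms(2) by auto
      let ?c = "\<lambda>j. if j = i then norm_fac i * norm_fac (m - i) / gcoef i else 0"
      have "Phi m ?c = (\<Sum>j\<in>{i}. scale (gcoef j * ?c j) (uhat Q j * uhat Q (m - j)))"
        unfolding Phi_def using im by (intro sum.mono_neutral_right) auto
      also have "\<dots> = u Q i * u Q (m - i)"
        using im by (simp add: prod)
      finally show "\<exists>c. u Q i * u Q (m - i) = Phi m c \<and> (\<forall>i\<le>m. i \<notin> I \<longrightarrow> c i = 0)"
        using i by (intro exI[of _ ?c]) auto
    qed
    show "pm.subspace ?R"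
    proof (rule pm.subspaceI)
      show "0 \<in> ?R" using Phi_0 by (intro CollectI exI[of _ "\<lambda>_. 0"]) simp
      fix x y assume "x \<in> ?R" "y \<in> ?R"
      then obtain c c' where "x = Phi m c" "y = Phi m c'" "\<forall>i\<le>m. i \<notin> I \<longrightarrow> c i = 0" "\<forall>i\<le>m. i \<notin> I \<longrightarrow> c' i = 0"
        by blast
      then show "x + y \<in> ?R"
        by (intro CollectI exI[of _ "\<lambda>i. c i + c' i"]) (simp add: Phi_add)
    next
      fix a :: 'k and x assume "x \<in> ?R"
      then obtain c where "x = Phi m c" "\<forall>i\<le>m. i \<notin> I \<longrightarrow> c i = 0"
        by blast
      then show "scale a x \<in> ?R"
        by (intro CollectI exI[of _ "\<lambda>i. a * c i"]) (simp add: Phi_scale)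
    qed
  qed
  show "?R \<subseteq> ?S"
  proof clarify
    fix c :: "nat \<Rightarrow> 'k" assume c: "\<forall>i\<le>m. i \<notin> I \<longrightarrow> c i = 0"
    have "scale (gcoef i * c i) (uhat Q i * uhat Q (m - i)) \<in> ?S" if "i \<le> m" for i
    proof (cases "i \<in> I")
      case True
      have "uhat Q i * uhat Q (m - i) = scale (1 / (norm_fac i * norm_fac (m - i))) (u Q i * u Q (m - i))"
        using that nz[OF that] by (simp add: prod)
      then show ?thesis using True
        by (auto intro!: pm.span_scale intro: pm.span_base)
    next
      case False
      then show ?thesis using c that by (simp add: pm.span_zero)
    qed
    then show "Phi m c \<in> ?S"
      unfolding Phi_def by (intro pm.span_sum) auto
  qed
qed

lemma U_eq: "nondeg m \<Longrightarrow> U Q m = range (Phi m)"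
  unfolding U_def using span_products[of m "{0..m}"] by auto

lemma U'_eq: "nondeg m \<Longrightarrow> U' Q m = {Phi m c | c. c m = 0}"
proof -
  assume "nondeg m"
  moreover have "(\<forall>i\<le>m. i \<notin> {0..<m} \<longrightarrow> c i = 0) \<longleftrightarrow> c m = 0" for c :: "nat \<Rightarrow> 'k"
    by (auto simp: le_less)
  moreover have "{0..<m} \<subseteq> {..m}" by auto
  ultimately show ?thesis
    unfolding U'_def using span_products[of m "{0..<m}"] by simp
qed

text \<open>
  The last coordinate as a linear form on the whole tensor algebra: up to normalisation, the
  coefficient of the word \<open>x\<^sub>1\<^sup>m x\<^sub>2 x\<^sub>2\<close>, which occurs in \<open>u\<^sub>i u\<^sub>m\<^sub>-\<^sub>i\<close> only for \<open>i = m\<close>.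
\<close>

definition top_coef :: "nat \<Rightarrow> 'k tensor_alg \<Rightarrow> 'k" where
  "top_coef m y = Poly_Mapping.lookup (strip (strip y)) (Word (replicate m X1)) * norm_fac m / gcoef m"

lemma top_coef_add: "top_coef m (x + y) = top_coef m x + top_coef m y"
  by (simp add: top_coef_def pmp.linear_add[OF lin_strip] lookup_add distrib_right add_divide_distrib)

lemma top_coef_scale: "top_coef m (scale a y) = a * top_coef m y"
  by (simp add: top_coef_def pmp.linear_scale[OF lin_strip])

lemma top_coef_diff: "top_coef m (x - y) = top_coef m x - top_coef m y"
  using top_coef_add[of m "x - y" y] by simp

lemma top_coef_Phi:
  assumes "nondeg m"
  shows "top_coef m (Phi m c) = c m"
proof -
  have *: "strip (strip (uhat Q i * uhat Q (m - i))) = (if i = m then scale (1 / norm_fac m) (x1 ^ m) else 0)"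
    if "i \<le> m" for i
  proof -
    have g: "nondeg i" "nondeg (m - i)" using that nondeg_le[OF assms] by auto
    have "strip (strip (u Q i * u Q (m - i))) = (if i = m then x1 ^ m else 0)"
    proof (cases "i = m")
      case True
      then show ?thesis
        using strip_u[of "u Q i" Q 0] strip_u[of 1 Q m] by simp
    next
      case False
      then have "m - i = Suc (m - i - 1)" using that by simp
      then have "u Q i * x1 ^ (m - i) = (u Q i * x1 ^ (m - i - 1)) * x1"
        by (metis power_Suc2 mult.assoc)
      then show ?thesis using False by (simp add: strip_u strip_x1)
    qed
    then show ?thesis
      using g by (auto simp: uhat_eq scale_mult_left scale_mult_right pmp.linear_scale[OF lin_strip])
  qed
  have "strip (strip (Phi m c)) = (\<Sum>i\<le>m. scale (gcoef i * c i) (strip (strip (uhat Q i * uhat Q (m - i)))))"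
    by (simp add: Phi_def pmp.linear_sum[OF lin_strip] pmp.linear_scale[OF lin_strip])
  also have "\<dots> = (\<Sum>i\<in>{m}. scale (gcoef i * c i) (strip (strip (uhat Q i * uhat Q (m - i)))))"
    by (intro sum.mono_neutral_right) (auto simp: *)
  also have "\<dots> = scale (gcoef m * c m / norm_fac m) (x1 ^ m)"
    using *[of m] by simp
  finally show ?thesis
    using assms by (simp add: top_coef_def x1_power) (simp add: mon_def)
qed

text \<open>
  The last coordinate of the zero element vanishes by \<open>top_coef_Phi\<close>. By induction all differences
  of the other coordinates vanish, as they are the coordinates of a multiple of \<open>d\<^sub>1\<close> of the element.
\<close>

lemma Phi_eq_0: "nondeg m \<Longrightarrow> Phi m c = 0 \<Longrightarrow> i \<le> m \<Longrightarrow> c i = 0"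
proof (induction m arbitrary: c i)
  case 0
  then show ?case using top_coef_Phi[of 0 c] by (simp add: top_coef_def pmp.linear_0[OF lin_strip])
next
  case (Suc m)
  have t: "c (Suc m) = 0"
    using Suc.prems top_coef_Phi[of "Suc m" c] by (simp add: top_coef_def pmp.linear_0[OF lin_strip])
  have "scale (- q21) (Phi m (lower q c)) = 0"
    using d1_Phi[OF Suc.prems(1), of c] Suc.prems(2) by (simp add: pmp.linear_0[OF lin_deriv])
  then have "Phi m (lower q c) = 0"
    by (simp only: pm.scale_eq_0_iff) simp
  then have "lower q c j = 0" if "j \<le> m" for j
    using that Suc.IH nondeg_le[OF Suc.prems(1)] by auto
  then have step: "c (Suc j) = c j" if "j \<le> m" for j
    using that by (auto simp: lower_def)
  from Suc.prems(3) show ?case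
    by (induction rule: inc_induct) (use t step in auto)
qed

lemma Phi_inj: "nondeg m \<Longrightarrow> Phi m c = Phi m c' \<Longrightarrow> i \<le> m \<Longrightarrow> c i = c' i"
  using Phi_eq_0[of m "\<lambda>i. c i - c' i" i] by (simp add: Phi_diff)

text \<open>
  Applying \<open>d\<^sub>1\<close> repeatedly reduces to \<open>x\<^sub>2\<close>, and \<open>d\<^sub>2(x\<^sub>2) = 1\<close>.
\<close>

lemma uhat_notin_ker: "nondeg m \<Longrightarrow> uhat Q m \<notin> ker_pi Q"
proof (induction m)
  case 0
  have "counit (1 :: 'k tensor_alg) = 1"
    using counit_mon[of "[]"] by (simp add: mon_Nil)
  then have "1 \<notin> ker_pi Q"
    unfolding ker_pi_eq_deriv_radical deriv_radical_def by (auto intro!: exI[of _ "[]"])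
  moreover have "d2 (uhat Q 0) = 1" by (simp add: d2_uhat)
  ultimately show ?case
    unfolding ker_pi_eq_deriv_radical using deriv_radical_deriv by metis
next
  case (Suc m)
  then show ?case
    using nondeg_le[of "Suc m" m] d1_uhat[of m] deriv_radical_deriv[of "uhat Q (Suc m)" X1]
    unfolding ker_pi_eq_deriv_radical by auto
qed

lemma Phi_in_ker_iff:
  assumes "nondeg m"
  shows "Phi m c \<in> ker_pi Q \<longleftrightarrow> c 0 + mu m * c m = 0 \<and> d1 (Phi m c) \<in> ker_pi Q"
proof -
  have "counit (Phi m c) = 0"
    by (rule counit_homog[OF homog_Phi[OF assms]]) simp
  then have 1: "Phi m c \<in> ker_pi Q \<longleftrightarrow> d1 (Phi m c) \<in> ker_pi Q \<and> d2 (Phi m c) \<in> ker_pi Q"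
    using ker_pi_iff[of "Phi m c"] all_gen[of "\<lambda>i. deriv Q i (Phi m c) \<in> ker_pi Q"] by simp
  have 2: "scale a (uhat Q m) \<in> ker_pi Q \<longleftrightarrow> a = 0" for a
  proof
    assume "scale a (uhat Q m) \<in> ker_pi Q"
    then have "scale (1 / a) (scale a (uhat Q m)) \<in> ker_pi Q"
      by (rule pm.subspace_scale[OF subspace_ker_pi])
    then show "a = 0" using uhat_notin_ker[OF assms] by (cases "a = 0") auto
  qed (simp add: pm.subspace_0[OF subspace_ker_pi])
  show ?thesis unfolding 1 d2_Phi[OF assms] 2 by blast
qed

section \<open>The spaces of relations and the two operators\<close>

abbreviation rels :: "nat \<Rightarrow> 'k tensor_alg set" where
  "rels m \<equiv> ker_pi Q \<inter> U Q m"

lemma subspace_U: "pm.subspace (U Q m)"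
  by (simp add: U_def)

lemma subspace_rels: "pm.subspace (rels m)"
  by (intro pm.subspace_inter subspace_ker_pi subspace_U)

lemma ker_d1: "y \<in> ker_pi Q \<Longrightarrow> d1 y \<in> ker_pi Q"
  unfolding ker_pi_eq_deriv_radical by (rule deriv_radical_deriv)

lemma nondeg_pred: "nondeg (Suc m) \<Longrightarrow> nondeg m"
  using nondeg_le[of "Suc m" m] by simp

lemma Phi_in_U: "nondeg m \<Longrightarrow> Phi m c \<in> U Q m"
  by (simp add: U_eq)

lemma d1_U_0: "y \<in> U Q 0 \<Longrightarrow> d1 y = 0"
  by (auto simp: U_eq d1_Phi_0)

lemma d1_U: "nondeg (Suc m) \<Longrightarrow> y \<in> U Q (Suc m) \<Longrightarrow> d1 y \<in> U Q m"
  using nondeg_pred[of m]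
  by (auto simp: U_eq d1_Phi simp flip: Phi_scale)

lemma d1_rels: "nondeg (Suc m) \<Longrightarrow> y \<in> rels (Suc m) \<Longrightarrow> d1 y \<in> rels m"
  by (simp add: ker_d1 d1_U)

lemma ad_U: "nondeg (Suc m) \<Longrightarrow> y \<in> U Q m \<Longrightarrow> ad y \<in> U Q (Suc m)"
  using nondeg_pred[of m]
  by (auto simp: U_eq ad_Phi simp flip: Phi_scale)

lemma d1_scale: "d1 (scale a y) = scale a (d1 y)"
  by (rule pmp.linear_scale[OF lin_deriv])

lemma ad_scale: "ad (scale a y) = scale a (ad y)"
  by (rule pmp.linear_scale[OF lin_ad_x1])

lemma pq: "1 / q * q = 1"
  by simp

lemma d1_ad:
  assumes g: "nondeg (Suc m)" and y: "y \<in> U Q m"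
  shows "d1 (ad y) = scale q (ad (d1 y)) + scale (1 - q ^ (2 * m) * r ^ 2) y"
proof -
  obtain c where c: "y = Phi m c"
    using y g nondeg_pred by (auto simp: U_eq)
  have L: "d1 (ad y) = Phi m (lower q (raise q (1 / q) r m c))"
    unfolding c ad_Phi[OF g] d1_scale d1_Phi[OF g] by simp
  show ?thesis
  proof (cases m)
    case 0
    have "Phi 0 (lower q (raise q (1 / q) r 0 c)) = Phi 0 (\<lambda>i. (1 - r ^ 2) * c i)"
      by (rule Phi_cong) (simp add: lower_raise_0)
    then show ?thesis
      unfolding L unfolding c 0 by (simp add: Phi_scale d1_Phi_0 pmp.linear_0[OF lin_ad_x1])
  next
    case (Suc n)
    have gn: "nondeg (Suc n)" using g Suc nondeg_pred by simp
    have "d1 (ad y) = Phi (Suc n) (\<lambda>i. q * raise q (1 / q) r n (lower q c) i + (1 - q ^ (2 * Suc n) * r ^ 2) * c i)"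
      unfolding L Suc by (rule Phi_cong) (rule lower_raise[OF pq])
    also have "\<dots> = scale q (Phi (Suc n) (raise q (1 / q) r n (lower q c))) + scale (1 - q ^ (2 * m) * r ^ 2) y"
      unfolding Phi_add Phi_scale c Suc ..
    also have "Phi (Suc n) (raise q (1 / q) r n (lower q c)) = ad (d1 y)"
      unfolding c Suc d1_Phi[OF gn] ad_scale ad_Phi[OF gn] by simp
    finally show ?thesis .
  qed
qed

lemma d1_pow_U: "nondeg m \<Longrightarrow> y \<in> U Q m \<Longrightarrow> t \<le> m \<Longrightarrow> (d1 ^^ t) y \<in> U Q (m - t)"
proof (induction t)
  case (Suc t)
  then have "(d1 ^^ t) y \<in> U Q (Suc (m - Suc t))" by (simp add: Suc_diff_Suc)
  moreover have "nondeg (Suc (m - Suc t))" using nondeg_le[OF Suc.prems(1)] Suc.prems by simp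
  ultimately show ?case using d1_U by simp
qed simp

lemma ker_d1_pow: "y \<in> ker_pi Q \<Longrightarrow> (d1 ^^ t) y \<in> ker_pi Q"
  by (induction t) (simp_all add: ker_d1)

lemma lin_d1_pow: "lin (d1 ^^ t)"
  by (simp add: lin_funpow)

lemma d1_pow_zero_mono: "t \<le> t' \<Longrightarrow> (d1 ^^ t) y = 0 \<Longrightarrow> (d1 ^^ t') y = 0"
  by (induction rule: dec_induct) (simp_all add: pmp.linear_0)

lemma d1_pow_top: "nondeg m \<Longrightarrow> y \<in> U Q m \<Longrightarrow> (d1 ^^ Suc m) y = 0"
  using d1_pow_U[of m y m] by (simp add: d1_U_0)

text \<open>
  The iterated commutation rule. On an element killed by \<open>d\<^sub>1\<^bsup>t+1\<^esup>\<close> the first summand drops out, so that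
  \<open>d\<^sub>1 \<circ> ad x\<^sub>1\<close> acts on the leading term \<open>d\<^sub>1\<^sup>t(y)\<close> as a scalar.
\<close>

lemma d1_pow_ad:
  assumes g: "nondeg (Suc m)" and y: "y \<in> U Q m"
  shows "t \<le> m \<Longrightarrow> (d1 ^^ Suc t) (ad y) = scale (q ^ Suc t) (ad ((d1 ^^ Suc t) y))
     + scale (qn (Suc t) q * (1 - q ^ (2 * m - t) * r ^ 2)) ((d1 ^^ t) y)"
proof (induction t)
  case 0
  then show ?case using d1_ad[OF g y] by simp
next
  case (Suc t)
  let ?z = "(d1 ^^ Suc t) y"
  let ?a = "2 * (m - Suc t)"
  have z: "?z \<in> U Q (m - Suc t)"
    using d1_pow_U[OF nondeg_pred[OF g] y] Suc.prems by blast
  have "nondeg (Suc (m - Suc t))" using nondeg_le[OF g] Suc.prems by simp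
  from d1_ad[OF this z] have 1: "d1 (ad ?z) = scale q (ad (d1 ?z)) + scale (1 - q ^ ?a * r ^ 2) ?z" .
  have co: "q ^ Suc t * (1 - q ^ ?a * r ^ 2) + qn (Suc t) q * (1 - q ^ (2 * m - t) * r ^ 2)
     = qn (Suc (Suc t)) q * (1 - q ^ (2 * m - Suc t) * r ^ 2)"
  proof -
    have e: "2 * m - t = ?a + Suc t + 1" "2 * m - Suc t = ?a + Suc t"
      using Suc.prems by simp_all
    have *: "B * (1 - A * x) + N * (1 - A * B * q * x) = M * (1 - A * B * x)"
      if "M = N + B" "M = 1 + q * N" for A B M N x :: 'k
      using that by algebra
    show ?thesis
      unfolding e power_add[of q _ "Suc t"] power_add[of q _ 1] power_one_right
      by (rule *[OF qn_Suc qn_Suc_left])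
  qed
  have "(d1 ^^ Suc (Suc t)) (ad y) = scale (q ^ Suc t) (d1 (ad ?z)) + scale (qn (Suc t) q * (1 - q ^ (2 * m - t) * r ^ 2)) ?z"
    using Suc by (simp add: pmp.linear_add pmp.linear_scale)
  also have "\<dots> = scale (q ^ Suc (Suc t)) (ad (d1 ?z)) +
      scale (q ^ Suc t * (1 - q ^ ?a * r ^ 2) + qn (Suc t) q * (1 - q ^ (2 * m - t) * r ^ 2)) ?z"
    unfolding 1 by (simp only: pm.scale_right_distrib pm.scale_left_distrib pm.scale_scale power_Suc2[of q "Suc t"] add.assoc)
  finally show ?case unfolding co by simp
qed

lemma top_coef_P: "nondeg m \<Longrightarrow> top_coef m (P Q m) = 1"
  by (simp add: P_eq_Phi top_coef_Phi)

lemma P_ne_0: "nondeg m \<Longrightarrow> P Q m \<noteq> 0"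
  using Phi_eq_0[of m "\<lambda>_. 1" 0] by (auto simp: P_eq_Phi)

lemma P_in_U: "nondeg m \<Longrightarrow> P Q m \<in> U Q m"
  by (simp add: P_eq_Phi Phi_in_U)

lemma lower_const: "lower q (\<lambda>_. a) = (\<lambda>_. 0)"
  by (simp add: lower_def fun_eq_iff)

lemma d1_P: "nondeg m \<Longrightarrow> d1 (P Q m) = 0"
  by (cases m) (simp_all add: P_eq_Phi d1_Phi_0 d1_Phi lower_const Phi_0)

text \<open>
  A sequence without differences is constant, hence a multiple of the coordinates of \<open>P\<^sub>m\<close>.
\<close>

lemma d1_zero:
  assumes g: "nondeg m" and y: "y \<in> U Q m" and 0: "d1 y = 0"
  shows "y = scale (top_coef m y) (P Q m)"
proof -
  obtain c where c: "y = Phi m c" using y g by (auto simp: U_eq)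
  have "c i = c m" if "i \<le> m" for i
  proof (cases m)
    case (Suc n)
    have gn: "nondeg n" using g Suc nondeg_pred by simp
    have "scale (- q21) (Phi n (lower q c)) = 0"
      using d1_Phi[OF g[unfolded Suc], of c] 0[unfolded c Suc] by metis
    then have "Phi n (lower q c) = 0"
      by (simp only: pm.scale_eq_0_iff) simp
    then have "lower q c j = 0" if "j \<le> n" for j
      using Phi_eq_0[OF gn] that by blast
    then have step: "c (Suc j) = c j" if "j < m" for j
      using that Suc by (auto simp: lower_def)
    from that show ?thesis
      by (induction rule: inc_induct) (use step in auto)
  qed (use that in simp)
  then have "y = Phi m (\<lambda>i. c m * 1)"
    unfolding c mult_1_right by (rule Phi_cong)
  then show ?thesis
    unfolding Phi_scale P_eq_Phi[symmetric] using top_coef_Phi[OF g, of c] c by metis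
qed

lemma Phi_in_rels_iff: "nondeg m \<Longrightarrow> Phi m c \<in> rels m \<longleftrightarrow> c 0 + mu m * c m = 0 \<and> d1 (Phi m c) \<in> ker_pi Q"
  by (simp add: Phi_in_ker_iff Phi_in_U)

lemma ker_0: "0 \<in> ker_pi Q"
  by (rule pm.subspace_0[OF subspace_ker_pi])

lemma P_in_rels_iff:
  assumes "nondeg m" shows "P Q m \<in> rels m \<longleftrightarrow> mu m = - 1"
  using d1_P[OF assms] unfolding P_eq_Phi Phi_in_rels_iff[OF assms]
  by (simp add: ker_0 add_eq_0_iff)

lemma scale_P_in_ker: "nondeg m \<Longrightarrow> a \<noteq> 0 \<Longrightarrow> scale a (P Q m) \<in> ker_pi Q \<Longrightarrow> mu m = - 1"
  using pm.subspace_scale[OF subspace_ker_pi, of "scale a (P Q m)" "1 / a"] P_in_rels_iff[of m] P_in_U[of m]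
  by simp

text \<open>
  In coordinates \<open>ad x\<^sub>1\<close> is triangular, and the entries \<open>(i + 1)\<^sub>q (1 - q\<^sup>i r)\<close>, up to powers of \<open>q\<close>, that
  lead from \<open>c i\<close> to position \<open>i + 1\<close> are nonzero; so the coordinates vanish one after the other, starting
  from the last.
\<close>

lemma ad_eq_0:
  assumes g: "nondeg (Suc m)" and y: "y \<in> U Q m" and 0: "ad y = 0"
  shows "y = 0"
proof -
  obtain c where c: "y = Phi m c" using y g nondeg_pred by (auto simp: U_eq)
  let ?R = "raise q (1 / q) r m c"
  have "scale (- (1 / q21)) (Phi (Suc m) ?R) = 0"
    using 0 unfolding c ad_Phi[OF g] .
  then have "Phi (Suc m) ?R = 0"
    by (simp only: pm.scale_eq_0_iff) simp
  then have R: "?R i = 0" if "i \<le> Suc m" for i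
    using Phi_eq_0[OF g] that by blast
  have step: "c i = 0" if "i \<le> m" "c (Suc i) = 0 \<or> i = m" for i
    using R[of "Suc i"] that nondeg_wt[OF g, of i] by (auto simp: raise_def)
  have "c i = 0" if "i \<le> m" for i
    using that by (induction rule: inc_induct) (use step in auto)
  then have "Phi m c = Phi m (\<lambda>_. 0)" by (intro Phi_cong) simp
  then show ?thesis unfolding c by (simp add: Phi_0)
qed

text \<open>
  The boundary condition is preserved, since both boundary values are multiplied by known factors
  whose ratio is that of \<open>\<mu>\<^sub>m\<close> and \<open>\<mu>\<^sub>m\<^sub>+\<^sub>1\<close>.
\<close>

lemma ad_boundary:
  assumes g: "nondeg (Suc m)" and y: "Phi m c \<in> rels m" and d: "d1 (ad (Phi m c)) \<in> ker_pi Q"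
  shows "ad (Phi m c) \<in> rels (Suc m)"
proof -
  let ?R = "raise q (1 / q) r m c"
  have "c 0 + mu m * c m = 0" using y Phi_in_rels_iff[OF nondeg_pred[OF g]] by blast
  then have c0: "c 0 = - mu m * c m" by (simp add: add_eq_0_iff2)
  have "?R 0 + mu (Suc m) * ?R (Suc m) = - r * wt m * c 0 + - r * (q ^ m * (1 / q) ^ m) * wt m * (mu m * c m)"
    by (simp add: raise_def mu_Suc mult_ac)
  also have "q ^ m * (1 / q) ^ m = 1" by (simp add: power_divide)
  finally have "?R 0 + mu (Suc m) * ?R (Suc m) = 0" by (simp add: c0)
  then have "(- (1 / q21)) * (?R 0 + mu (Suc m) * ?R (Suc m)) = 0" by simp
  then have "(- (1 / q21)) * ?R 0 + mu (Suc m) * ((- (1 / q21)) * ?R (Suc m)) = 0"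
    by (simp only: distrib_left mult.left_commute)
  moreover have "ad (Phi m c) = Phi (Suc m) (\<lambda>i. (- (1 / q21)) * ?R i)"
    unfolding ad_Phi[OF g] Phi_scale ..
  ultimately show ?thesis using Phi_in_rels_iff[OF g] d by metis
qed

text \<open>
  The condition on \<open>d\<^sub>1\<close> follows by induction from the commutation rule \<open>d1_ad\<close>.
\<close>

lemma ad_rels:
  "nondeg (Suc m) \<Longrightarrow> y \<in> rels m \<Longrightarrow> ad y \<in> rels (Suc m)"
proof (induction m arbitrary: y)
  case 0
  then obtain c where c: "y = Phi 0 c" using nondeg_pred by (auto simp: U_eq)
  have "d1 (ad y) \<in> ker_pi Q"
    using d1_ad[of 0 y] 0 pm.subspace_scale[OF subspace_ker_pi, of y "1 - r ^ 2"]
    by (simp add: d1_U_0 pmp.linear_0)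
  then show ?case using 0 ad_boundary c by blast
next
  case (Suc m)
  then obtain c where c: "y = Phi (Suc m) c" using nondeg_pred by (auto simp: U_eq)
  have g: "nondeg (Suc m)" using Suc.prems nondeg_pred by blast
  have "ad (d1 y) \<in> ker_pi Q" using Suc.IH[OF g d1_rels[OF g Suc.prems(2)]] by blast
  then have "d1 (ad y) \<in> ker_pi Q"
    using d1_ad[OF Suc.prems(1), of y] Suc.prems(2)
    by (auto intro!: pm.subspace_add pm.subspace_scale subspace_ker_pi)
  then show ?case using Suc.prems ad_boundary c by blast
qed

lemma ad_pow_P:
  "nondeg (n + k) \<Longrightarrow> (ad ^^ k) (P Q n) = scale ((- (1 / q21)) ^ k) (Phi (n + k) (ladder q (1 / q) r n k))"
proof (induction k)
  case 0
  then show ?case by (simp add: P_eq_Phi)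
next
  case (Suc k)
  then have "nondeg (Suc (n + k))" by simp
  then show ?case
    using Suc.IH nondeg_pred by (simp add: pmp.linear_scale ad_Phi mult.commute)
qed

lemma ad_pow_U: "nondeg (n + k) \<Longrightarrow> y \<in> U Q n \<Longrightarrow> (ad ^^ k) y \<in> U Q (n + k)"
proof (induction k)
  case (Suc k)
  then have "nondeg (Suc (n + k))" by simp
  then show ?case using Suc nondeg_pred ad_U by simp
qed simp

lemma ad_pow_rels: "nondeg (n + k) \<Longrightarrow> y \<in> rels n \<Longrightarrow> (ad ^^ k) y \<in> rels (n + k)"
proof (induction k)
  case (Suc k)
  then have g: "nondeg (Suc (n + k))" by simp
  then show ?case using Suc nondeg_pred[OF g] ad_rels[OF g] by simp
qed simp

lemma ad_pow_eq_0: "nondeg (n + k) \<Longrightarrow> y \<in> U Q n \<Longrightarrow> (ad ^^ k) y = 0 \<Longrightarrow> y = 0"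
proof (induction k)
  case (Suc k)
  then have g: "nondeg (Suc (n + k))" by simp
  show ?case using Suc.IH ad_eq_0[OF g ad_pow_U[OF nondeg_pred[OF g]]] Suc.prems nondeg_pred[OF g] by simp
qed simp

lemma d1_ad_pow_P:
  assumes g: "nondeg (n + Suc k)"
  shows "d1 ((ad ^^ Suc k) (P Q n)) = scale (qn (Suc k) q * (1 - q ^ (2 * n + k) * r ^ 2)) ((ad ^^ k) (P Q n))"
proof -
  have g': "nondeg (Suc (n + k))" using g by simp
  let ?l = "ladder q (1 / q) r n" and ?a = "- (1 / q21)"
  have "d1 ((ad ^^ Suc k) (P Q n)) = scale (?a ^ Suc k) (scale (- q21) (Phi (n + k) (lower q (?l (Suc k)))))"
    unfolding ad_pow_P[OF g] d1_scale add_Suc_right d1_Phi[OF g'] by (rule refl)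
  also have "\<dots> = scale (?a ^ k) (Phi (n + k) (lower q (?l (Suc k))))"
    by simp
  also have "Phi (n + k) (lower q (?l (Suc k))) = Phi (n + k) (\<lambda>i. qn (Suc k) q * (1 - q ^ (2 * n + k) * r ^ 2) * ?l k i)"
    by (rule Phi_cong) (rule lower_ladder[OF pq])
  finally show ?thesis
    unfolding Phi_scale ad_pow_P[OF nondeg_pred[OF g']] by (simp add: mult.commute)
qed

lemma d1_pow_ad_pow_P:
  "nondeg (n + k) \<Longrightarrow> (d1 ^^ k) ((ad ^^ k) (P Q n)) = scale (\<Prod>i<k. qn (Suc i) q * (1 - q ^ (2 * n + i) * r ^ 2)) (P Q n)"
proof (induction k)
  case (Suc k)
  have g: "nondeg (n + k)" using nondeg_le[OF Suc.prems] by simp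
  have "(d1 ^^ Suc k) ((ad ^^ Suc k) (P Q n)) = (d1 ^^ k) (d1 ((ad ^^ Suc k) (P Q n)))"
    by (simp only: funpow_Suc_right o_apply)
  also have "\<dots> = scale (qn (Suc k) q * (1 - q ^ (2 * n + k) * r ^ 2)) ((d1 ^^ k) ((ad ^^ k) (P Q n)))"
    unfolding d1_ad_pow_P[OF Suc.prems] by (rule pmp.linear_scale[OF lin_d1_pow])
  finally show ?case
    unfolding Suc.IH[OF g] by (simp add: mult.commute)
qed simp

text \<open>
  For \<open>\<mu>\<^sub>m\<^sub>+\<^sub>1 = -1\<close> the boundary condition for a preimage under \<open>d\<^sub>1\<close> says that its first and last
  coordinates agree. A preimage is found by summation, and by \<open>sum_lower\<close> the weighted sum of the given
  coordinates is the difference between its last and first coordinates.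
\<close>

lemma in_d1_image_iff:
  assumes g: "nondeg (Suc m)" and mu: "mu (Suc m) = - 1" and K: "Phi m b \<in> rels m"
  shows "Phi m b \<in> d1 ` rels (Suc m) \<longleftrightarrow> (\<Sum>i\<le>m. (1 / q) ^ i * b i) = 0"
proof
  assume "Phi m b \<in> d1 ` rels (Suc m)"
  then obtain y where y: "y \<in> rels (Suc m)" "Phi m b = d1 y" by blast
  then obtain c where c: "y = Phi (Suc m) c" using g by (auto simp: U_eq)
  have "Phi m b = Phi m (\<lambda>i. (- q21) * lower q c i)"
    unfolding Phi_scale using y(2) unfolding c d1_Phi[OF g] .
  then have b: "b i = (- q21) * lower q c i" if "i \<le> m" for i
    using Phi_inj[OF nondeg_pred[OF g]] that by blast
  have "(\<Sum>i\<le>m. (1 / q) ^ i * b i) = (\<Sum>i\<le>m. (- q21) * ((1 / q) ^ i * lower q c i))"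
    by (intro sum.cong refl) (simp add: b)
  also have "\<dots> = (- q21) * (\<Sum>i<Suc m. (1 / q) ^ i * lower q c i)"
    by (simp add: sum_distrib_left lessThan_Suc_atMost)
  also have "\<dots> = (- q21) * (c (Suc m) - c 0)"
    by (simp only: sum_lower[OF pq])
  also have "\<dots> = 0"
    using y(1) mu unfolding c Phi_in_rels_iff[OF g] by simp
  finally show "(\<Sum>i\<le>m. (1 / q) ^ i * b i) = 0" .
next
  assume b: "(\<Sum>i\<le>m. (1 / q) ^ i * b i) = 0"
  \<comment> \<open>A sequence with \<open>q\<close>-difference \<open>b\<close> that starts at zero.\<close>
  define c where "c i = (\<Sum>j<i. (1 / q) ^ j * b j)" for i
  have "lower q c = b"
    by (simp add: lower_def c_def fun_eq_iff power_divide)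
  then have d: "d1 (Phi (Suc m) c) = scale (- q21) (Phi m b)"
    using d1_Phi[OF g] by simp
  have "d1 (Phi (Suc m) c) \<in> ker_pi Q"
    unfolding d using K by (intro pm.subspace_scale[OF subspace_ker_pi]) simp
  moreover have "c 0 = 0" "c (Suc m) = 0"
    using b by (simp_all add: c_def lessThan_Suc_atMost)
  ultimately have "Phi (Suc m) c \<in> rels (Suc m)"
    unfolding Phi_in_rels_iff[OF g] by simp
  then have "scale (- (1 / q21)) (Phi (Suc m) c) \<in> rels (Suc m)"
    by (rule pm.subspace_scale[OF subspace_rels])
  moreover have "d1 (scale (- (1 / q21)) (Phi (Suc m) c)) = Phi m b"
    unfolding d1_scale d by simp
  ultimately show "Phi m b \<in> d1 ` rels (Suc m)" by (metis image_eqI)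
qed

text \<open>
  The recursive condition that \<open>n\<close> imposes on \<open>j\<close> in the definition of \<open>\<J>\<close>.
\<close>

definition compat :: "nat \<Rightarrow> nat \<Rightarrow> bool" where
  "compat n j \<longleftrightarrow> (if even (j - n) then qnum ((j - n) div 2) (q ^ (n + j - 1) * r ^ 2) = 0
         else qnum (j - n) (- (q ^ ((n + j - 1) div 2)) * r) = 0)"

lemma ladder_weight_nz: "nondeg (n + k) \<Longrightarrow> ladder_weight q r n k \<noteq> 0"
  using nondeg_wt[of "n + k"] by (auto simp: ladder_weight_def)

text \<open>
  In the formulas for the weighted sum every factor except one is nonzero by nondegeneracy. The
  remaining factor is the quantum integer in \<open>compat\<close>.
\<close>

lemma ladder_sum_eq_0_iff:
  assumes g: "nondeg (n + Suc k)"
  shows "ladder_sum q (1 / q) r n k = 0 \<longleftrightarrow> compat n (n + Suc k)"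
proof -
  define E where "E = (\<Sum>j<Suc k. n + j)"
  have nz: "ladder_weight q r n (Suc k) * (1 / q) ^ E \<noteq> 0" "qn (Suc k) q \<noteq> 0"
    using ladder_weight_nz[OF g] nondeg_qn[OF g, of "Suc k"] by simp_all
  have e: "n + Suc k - n = Suc k" "n + (n + Suc k) - 1 = 2 * n + k" by simp_all
  show ?thesis
  proof (cases "even (Suc k)")
    case True
    then obtain h where h: "Suc k = 2 * h" by blast
    have "ladder_sum q (1 / q) r n k = 0 \<longleftrightarrow> qn h (q ^ (2 * n + k) * r ^ 2) = 0"
      using ladder_sum_even[OF pq E_def h, of r] nz by (metis mult_eq_0_iff)
    then show ?thesis
      unfolding compat_def e using True h by (simp add: qnum_eq_qn)
  next
    case False
    then have "even (2 * n + k)" by simp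
    then obtain e' where e': "2 * n + k = 2 * e'" by (elim evenE)
    \<comment> \<open>The extra factor \<open>1 - q\<^bsup>e'\<^esup> r\<close> of the odd case divides \<open>b\<^bsub>n+k+1\<^esub>\<close>.\<close>
    have "e' < n + Suc k" using e' by simp
    then have "1 - q ^ e' * r \<noteq> 0" using nondeg_r[OF g] by simp
    then have "ladder_sum q (1 / q) r n k = 0 \<longleftrightarrow> qn (Suc k) (- (q ^ e') * r) = 0"
      using ladder_sum_odd[OF pq E_def e', of r] nz by (metis mult_eq_0_iff)
    then show ?thesis
      unfolding compat_def e using False e' by (simp add: qnum_eq_qn)
  qed
qed

lemma ad_pow_P_in_d1_image_iff:
  assumes g: "nondeg (n + Suc k)" and mu: "mu n = - 1" "mu (n + Suc k) = - 1"
  shows "(ad ^^ k) (P Q n) \<in> d1 ` rels (n + Suc k) \<longleftrightarrow> compat n (n + Suc k)"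
proof -
  have g': "nondeg (Suc (n + k))" using g by simp
  have gn: "nondeg n" using nondeg_le[OF g] by simp
  let ?a = "(- (1 / q21)) ^ k" and ?l = "ladder q (1 / q) r n k"
  have z: "(ad ^^ k) (P Q n) = Phi (n + k) (\<lambda>i. ?a * ?l i)"
    using ad_pow_P[OF nondeg_pred[OF g']] by (simp add: Phi_scale)
  have K: "Phi (n + k) (\<lambda>i. ?a * ?l i) \<in> rels (n + k)"
    using ad_pow_rels[OF nondeg_pred[OF g']] P_in_rels_iff[OF gn] mu z by metis
  have "(\<Sum>i\<le>n + k. (1 / q) ^ i * (?a * ?l i)) = ?a * ladder_sum q (1 / q) r n k"
    unfolding ladder_sum_def sum_distrib_left by (intro sum.cong refl) simp
  then have "(\<Sum>i\<le>n + k. (1 / q) ^ i * (?a * ?l i)) = 0 \<longleftrightarrow> compat n (n + Suc k)"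
    using ladder_sum_eq_0_iff[OF g] by simp
  then show ?thesis
    unfolding z using in_d1_image_iff[OF g' _ K] mu by simp
qed

section \<open>Arithmetic of the index set\<close>

abbreviation JJ :: "nat set" where "JJ \<equiv> J q r s"

text \<open>
  The value \<open>1\<close> of this expression marks the pairs for which \<open>(ad x\<^sub>1)\<^bsup>m-n\<^esup>(P\<^sub>n)\<close> is killed by \<open>d\<^sub>1\<close>.
\<close>

abbreviation T :: "nat \<Rightarrow> nat \<Rightarrow> 'k" where
  "T n m \<equiv> q ^ (n + m - 1) * r ^ 2"

lemma in_JJ_iff: "j \<in> JJ \<longleftrightarrow> mu j = - 1 \<and> (\<forall>n\<in>JJ. n < j \<longrightarrow> compat n j)"
  unfolding J_def mem_Collect_eq
  by (subst in_J.simps, unfold mu_def compat_def lessThan_iff Ball_def mem_Collect_eq) blast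

lemma JJ_mu: "j \<in> JJ \<Longrightarrow> mu j = - 1"
  using in_JJ_iff[of j] by simp

lemma JJ_compat: "j \<in> JJ \<Longrightarrow> n \<in> JJ \<Longrightarrow> n < j \<Longrightarrow> compat n j"
  using in_JJ_iff[of j] by simp

lemma mu_add: "mu (n + k) = (- r) ^ k * q ^ (\<Sum>j<k. n + j) * mu n"
  by (induction k) (simp_all add: mu_Suc power_add)

lemma mu_ratio:
  assumes "mu n = - 1" "mu (n + k) = - 1"
  shows "(- r) ^ k * q ^ (\<Sum>j<k. n + j) = 1"
  using mu_add[of n k] assms by simp

lemma T_odd: "2 * n + k = 2 * e \<Longrightarrow> q ^ (2 * n + k) * r ^ 2 = (- (q ^ e) * r) ^ 2"
  by (simp add: power_mult_distrib mult.commute flip: power_mult)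

text \<open>
  The quotient of \<open>\<mu>\<^sub>m = -1\<close> by \<open>\<mu>\<^sub>n = -1\<close> says that the argument \<open>t\<close> of the quantum integer \<open>(k)\<^sub>t\<close> in
  \<open>compat n m\<close> satisfies \<open>t\<^sup>k = 1\<close>. Since \<open>1 - t\<^sup>k = (1 - t) (k)\<^sub>t\<close>, either \<open>(k)\<^sub>t\<close> vanishes or \<open>t = 1\<close>.
\<close>

lemma T_eq_1_if_not_compat:
  assumes mu: "mu n = - 1" "mu m = - 1" and "n < m" and nc: "\<not> compat n m"
  shows "T n m = 1"
proof -
  obtain k where m: "m = n + Suc k" using \<open>n < m\<close> less_imp_Suc_add by auto
  have e: "n + Suc k - n = Suc k" "n + (n + Suc k) - 1 = 2 * n + k" by simp_all
  note one = mu_ratio[OF mu(1) mu(2)[unfolded m]]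
  show ?thesis
  proof (cases "even (Suc k)")
    case True
    then obtain h where h: "Suc k = 2 * h" by blast
    have "(q ^ (2 * n + k) * r ^ 2) ^ h = 1"
      using one ladder_power_even[OF refl h] by metis
    then have "(1 - q ^ (2 * n + k) * r ^ 2) * qn h (q ^ (2 * n + k) * r ^ 2) = 0"
      using one_diff_power_qn by (metis right_minus_eq)
    moreover have "qn h (q ^ (2 * n + k) * r ^ 2) \<noteq> 0"
      using nc True h unfolding compat_def m e by (simp add: qnum_eq_qn)
    ultimately show ?thesis unfolding m e by simp
  next
    case False
    then have "even (2 * n + k)" by simp
    then obtain e' where e': "2 * n + k = 2 * e'" by (elim evenE)
    let ?t = "- (q ^ e') * r"
    have "?t ^ Suc k = 1"
      using one ladder_power_odd[OF refl e'] by metis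
    then have "(1 - ?t) * qn (Suc k) ?t = 0"
      using one_diff_power_qn by (metis right_minus_eq)
    moreover have "qn (Suc k) ?t \<noteq> 0"
      using nc False e' unfolding compat_def m e by (simp add: qnum_eq_qn)
    ultimately have "?t = 1" by (metis mult_eq_0_iff right_minus_eq)
    then show ?thesis unfolding m e T_odd[OF e'] by simp
  qed
qed

lemma qn_one: "qn k (1::'k) = of_nat k"
  by (simp add: qn_def)

text \<open>
  For \<open>t = 1\<close> the quantum integer \<open>(k)\<^sub>t\<close> is \<open>k\<close>. In the odd case \<open>t\<^sup>2 = 1\<close> is given, and \<open>t = 1\<close>
  follows because an odd power of \<open>t\<close> is \<open>1\<close> as well.
\<close>

lemma compat_T_1:
  assumes mu: "mu n = - 1" "mu m = - 1" and "n < m" and c: "compat n m" and T: "T n m = 1"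
  shows "even (m - n) \<Longrightarrow> (of_nat ((m - n) div 2) :: 'k) = 0"
    and "odd (m - n) \<Longrightarrow> q ^ ((n + m - 1) div 2) * r = - 1 \<and> (of_nat (m - n) :: 'k) = 0"
proof -
  obtain k where m: "m = n + Suc k" using \<open>n < m\<close> less_imp_Suc_add by auto
  have e: "n + Suc k - n = Suc k" "n + (n + Suc k) - 1 = 2 * n + k" by simp_all
  note one = mu_ratio[OF mu(1) mu(2)[unfolded m]]
  show "(of_nat ((m - n) div 2) :: 'k) = 0" if "even (m - n)"
    using c T that by (simp add: compat_def qnum_eq_qn qn_one)
  assume odd: "odd (m - n)"
  then have "even (2 * n + k)" unfolding m by simp
  then obtain e' where e': "2 * n + k = 2 * e'" by (elim evenE)
  let ?t = "- (q ^ e') * r"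
  have tk: "?t ^ Suc k = 1"
    using one ladder_power_odd[OF refl e'] by metis
  have t2: "?t ^ 2 = 1" using T unfolding m e T_odd[OF e'] .
  have "even k" using odd by (simp add: m)
  then obtain f where "k = 2 * f" by blast
  then have "?t ^ k = 1" by (simp only: power_mult t2 power_one)
  then have t: "?t = 1" using tk by (simp only: power_Suc mult_1_right)
  have d: "(n + m - 1) div 2 = e'" using e' by (simp add: m)
  have "qn (m - n) ?t = 0"
    using c odd unfolding compat_def d by (simp add: qnum_eq_qn)
  then have "(of_nat (m - n) :: 'k) = 0"
    unfolding t qn_one .
  moreover have "q ^ e' * r = - 1"
    using t by (metis minus_minus minus_mult_left)
  ultimately show "q ^ ((n + m - 1) div 2) * r = - 1 \<and> (of_nat (m - n) :: 'k) = 0"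
    unfolding d by blast
qed

lemma nondeg_pow_ne_1: "nondeg m \<Longrightarrow> q \<noteq> 1 \<Longrightarrow> 0 < d \<Longrightarrow> d \<le> m \<Longrightarrow> q ^ d \<noteq> 1"
  using one_diff_power_qn[of q d] nondeg_qn[of m d] by auto

text \<open>
  If \<open>q = 1\<close>, then \<open>r\<^sup>2 = 1\<close>, and \<open>r = -1\<close> by nondegeneracy, so \<open>s = -1\<close> and \<open>0 \<in> \<J>\<close>. The
  compatibility of \<open>0\<close> and \<open>m\<close> then says that \<open>m\<close> or \<open>m / 2\<close> vanishes in \<open>k\<close>, in contrast to
  \<open>(m)\<^sub>q\<^sup>! \<noteq> 0\<close>.
\<close>

lemma q_ne_1:
  assumes m: "m \<in> JJ" and g: "nondeg m" and mu: "mu n = - 1" and "n < m" and T: "T n m = 1"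
  shows "q \<noteq> 1"
proof
  assume q: "q = 1"
  have r2: "r ^ 2 = 1" using T q by simp
  have "r \<noteq> 1" using nondeg_r[OF g, of 0] \<open>n < m\<close> by simp
  then have r: "r = - 1" using r2 by (simp add: power2_eq_1_iff)
  have "s = - 1" using mu by (simp add: mu_def q r)
  then have mu0: "mu 0 = - 1" by (simp add: mu_def)
  then have "0 \<in> JJ" by (subst in_JJ_iff) simp
  then have c: "compat 0 m" using JJ_compat m \<open>n < m\<close> by simp
  have T0: "T 0 m = 1" using q r by simp
  have "0 < m" "mu m = - 1" using \<open>n < m\<close> m JJ_mu by simp_all
  note z = compat_T_1[OF mu0 \<open>mu m = - 1\<close> \<open>0 < m\<close> c T0]
  have nz: "(of_nat k :: 'k) \<noteq> 0" if "0 < k" "k \<le> m" for k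
    using nondeg_qn[OF g that] by (simp add: q qn_one)
  show False
  proof (cases "even m")
    case True
    then have "0 < m div 2" using \<open>0 < m\<close> by (auto elim: evenE)
    then show False using z(1) True nz[of "m div 2"] by simp
  next
    case False
    then show False using z(2) nz[of m] \<open>0 < m\<close> by simp
  qed
qed

lemma T_diff:
  assumes "n' < n" "T n' l = 1" "T n l = 1" "0 < l"
  shows "q ^ (n - n') = 1"
proof -
  have "n + l - 1 = (n - n') + (n' + l - 1)" using assms by simp
  then have "q ^ (n - n') * T n' l = T n l"
    by (simp only: power_add mult.assoc)
  then show ?thesis unfolding assms(2,3) by simp
qed

lemma T_unique:
  assumes "nondeg m" "q \<noteq> 1" "n < m" "n' < m" "T n m = 1" "T n' m = 1"
  shows "n = n'"
proof (rule ccontr)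
  assume "n \<noteq> n'"
  then consider "n < n'" | "n' < n" by linarith
  then show False
  proof cases
    case 1
    then show False using T_diff[OF 1, of m] nondeg_pow_ne_1[of m "n' - n"] assms by auto
  next
    case 2
    then show False using T_diff[OF 2, of m] nondeg_pow_ne_1[of m "n - n'"] assms by auto
  qed
qed

text \<open>
  Dividing the two equations gives \<open>q\<^bsup>m-n'\<^esup> = 1\<close>, which is impossible for \<open>q \<noteq> 1\<close> as \<open>(m - n')\<^sub>q \<noteq> 0\<close>.
\<close>

lemma T_chain:
  assumes "nondeg m" "q \<noteq> 1" "n' < n" "n < m" "T n m = 1" "T n' n = 1"
  shows False
proof -
  have "T m n = 1" using assms by (simp add: add.commute)
  then have "q ^ (m - n') = 1" using T_diff[of n' m n] assms by auto
  then show False using nondeg_pow_ne_1[of m "m - n'"] assms by auto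
qed

text \<open>
  If \<open>n\<close> were excluded from \<open>\<J>\<close> by some \<open>n'\<close>, then \<open>T n' n = 1\<close>, and \<open>T_chain\<close> gives a
  contradiction.
\<close>

lemma in_JJ:
  assumes m: "m \<in> JJ" and g: "nondeg m" and mu: "mu n = - 1" and "n < m" and T: "T n m = 1"
  shows "n \<in> JJ"
proof (rule ccontr)
  assume "n \<notin> JJ"
  then obtain n' where n': "n' \<in> JJ" "n' < n" "\<not> compat n' n"
    using mu in_JJ_iff[of n] by blast
  then have "T n' n = 1" using T_eq_1_if_not_compat mu JJ_mu by blast
  then show False using T_chain[OF g q_ne_1[OF assms]] n' \<open>n < m\<close> T by blast
qed

text \<open>
  For elements of \<open>\<J>\<close> the divisibility conditions in the definition of \<open>\<J>\<^sub>2\<close> are automatic, by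
  \<open>compat_T_1\<close>. In particular \<open>\<J>\<close> is the disjoint union of \<open>\<J>\<^sub>1\<close> and \<open>\<J>\<^sub>2\<close>.
\<close>

lemma J2_iff:
  "m \<in> J2 q r s \<longleftrightarrow> m \<in> JJ \<and> (\<exists>n\<in>JJ. n < m \<and> T n m = 1)"
proof
  assume "m \<in> J2 q r s"
  then obtain n where m: "m \<in> JJ" and n: "n \<in> JJ" "n < m" and
    c: "if even (m - n) then T n m = 1 \<and> 2 * CHAR('k) dvd m - n
      else q ^ ((n + m - 1) div 2) * r = - 1 \<and> CHAR('k) dvd m - n"
    unfolding J2_def by blast
  have "T n m = 1"
  proof (cases "even (m - n)")
    case False
    then have "even (n + m - 1)" using n by auto
    then have "T n m = (q ^ ((n + m - 1) div 2) * r) ^ 2"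
      by (simp add: power_mult_distrib flip: power_mult)
    then show ?thesis using c False by simp
  qed (use c in simp)
  then show "m \<in> JJ \<and> (\<exists>n\<in>JJ. n < m \<and> T n m = 1)" using m n by blast
next
  assume "m \<in> JJ \<and> (\<exists>n\<in>JJ. n < m \<and> T n m = 1)"
  then obtain n where m: "m \<in> JJ" and n: "n \<in> JJ" "n < m" "T n m = 1" by blast
  note z = compat_T_1[of n m]
  have mu: "mu n = - 1" "mu m = - 1" "compat n m" using m n JJ_mu JJ_compat by simp_all
  have "if even (m - n) then T n m = 1 \<and> 2 * CHAR('k) dvd m - n
      else q ^ ((n + m - 1) div 2) * r = - 1 \<and> CHAR('k) dvd m - n"
  proof (cases "even (m - n)")
    case True
    then have "CHAR('k) dvd (m - n) div 2"
      using z(1) mu n by (simp add: of_nat_eq_0_iff_char_dvd)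
    from mult_dvd_mono[OF dvd_refl[of 2] this] have "2 * CHAR('k) dvd m - n"
      unfolding dvd_mult_div_cancel[OF True] .
    then show ?thesis using True n by simp
  next
    case False
    then show ?thesis using z(2) mu n by (simp add: of_nat_eq_0_iff_char_dvd del: of_nat_diff)
  qed
  then show "m \<in> J2 q r s" unfolding J2_def using m n by blast
qed

lemma J1_iff: "m \<in> J1 q r s \<longleftrightarrow> m \<in> JJ \<and> (\<forall>n\<in>JJ. n < m \<longrightarrow> T n m \<noteq> 1)"
  unfolding J1_def using JJ_mu by (auto simp: mu_def)

section \<open>Images of the two operators\<close>

text \<open>
  The last nonzero power of \<open>d\<^sub>1\<close> on \<open>y\<close> lies in the kernel of \<open>d\<^sub>1\<close>, hence is a multiple of some
  \<open>P\<^sub>n\<close>.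
\<close>

lemma depth:
  assumes g: "nondeg m" and y: "y \<in> U Q m" "y \<noteq> 0"
  obtains t c where "t \<le> m" "(d1 ^^ Suc t) y = 0" "c \<noteq> 0" "(d1 ^^ t) y = scale c (P Q (m - t))"
proof -
  define t where "t = (LEAST t. (d1 ^^ Suc t) y = 0)"
  have t0: "(d1 ^^ Suc t) y = 0"
    unfolding t_def using d1_pow_top[OF g y(1)] by (rule LeastI)
  have tm: "t \<le> m"
    unfolding t_def using d1_pow_top[OF g y(1)] by (rule Least_le)
  have nz: "(d1 ^^ t) y \<noteq> 0"
  proof (cases t)
    case (Suc t')
    then have "(d1 ^^ Suc t') y \<noteq> 0"
      unfolding t_def using not_less_Least[of t' "\<lambda>t. (d1 ^^ Suc t) y = 0"] by simp
    then show ?thesis using Suc by simp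
  qed (use y in simp)
  have "nondeg (m - t)" using nondeg_le[OF g] by simp
  then have e: "(d1 ^^ t) y = scale (top_coef (m - t) ((d1 ^^ t) y)) (P Q (m - t))"
    using d1_zero d1_pow_U[OF g y(1) tm] t0 by simp
  then have "top_coef (m - t) ((d1 ^^ t) y) \<noteq> 0" using nz by auto
  then show ?thesis using that tm t0 e by blast
qed

text \<open>
  The scalar by which \<open>d\<^sub>1\<^sup>k\<close> takes \<open>(ad x\<^sub>1)\<^sup>k(P\<^sub>n)\<close> back to \<open>P\<^sub>n\<close>. Two vanishing factors
  \<open>1 - q\<^bsup>2n+i\<^esup> r\<^sup>2\<close> with \<open>i \<le> k\<close> would give a root of unity of an order that nondegeneracy excludes, and
  the factor for \<open>i = k\<close> is zero already.
\<close>

lemma prod_T_nz: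
  assumes g: "nondeg (n + Suc k)" and q1: "q \<noteq> 1" and T: "T n (n + Suc k) = 1"
  shows "(\<Prod>i<k. qn (Suc i) q * (1 - q ^ (2 * n + i) * r ^ 2)) \<noteq> 0"
proof -
  have "q ^ (2 * n + i) * r ^ 2 \<noteq> 1" if "i < k" for i
  proof
    assume 1: "q ^ (2 * n + i) * r ^ 2 = 1"
    have "n + (n + Suc k) - 1 = (k - i) + (2 * n + i)" using that by simp
    then have "q ^ (k - i) * (q ^ (2 * n + i) * r ^ 2) = 1"
      using T by (simp only: power_add mult.assoc)
    then have "q ^ (k - i) = 1" unfolding 1 by simp
    then show False using nondeg_pow_ne_1[OF g q1, of "k - i"] that by simp
  qed
  moreover have "qn (Suc i) q \<noteq> 0" if "i < k" for i
    using nondeg_qn[OF g, of "Suc i"] that by simp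
  ultimately show ?thesis by simp
qed

text \<open>
  Induction on the power \<open>t\<close> of \<open>d\<^sub>1\<close> that kills \<open>y\<close>. If \<open>d\<^sub>1\<^bsup>t-1\<^esup>(y)\<close> is nonzero, it is a multiple of
  \<open>P\<^sub>n\<close> with \<open>n = m - t + 1\<close>, and \<open>d\<^sub>1 \<circ> ad x\<^sub>1\<close>, whose values on relations lie in the image, acts on
  this leading term as a scalar \<open>\<theta>\<close>. If \<open>\<theta> \<noteq> 0\<close>, subtract the multiple \<open>d\<^sub>1(ad x\<^sub>1(y)) / \<theta>\<close>. If
  \<open>\<theta> = 0\<close>, then \<open>n \<in> \<J>\<close>, and a multiple of \<open>(ad x\<^sub>1)\<^bsup>t-1\<^esup>(P\<^sub>n)\<close>, which lies in the image by
  compatibility of \<open>n\<close> and \<open>m + 1\<close>, has the same leading term.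
\<close>

lemma d1_surj:
  assumes M: "Suc m \<in> JJ" and g: "nondeg (Suc m)"
  shows "y \<in> rels m \<Longrightarrow> y \<in> d1 ` rels (Suc m)"
proof -
  let ?D = "d1 ` rels (Suc m)"
  have D: "pm.subspace ?D"
    by (rule pmp.linear_subspace_image[OF lin_deriv subspace_rels])
  have gm: "nondeg m" using nondeg_pred[OF g] .
  have main: "(d1 ^^ t) y = 0 \<Longrightarrow> y \<in> rels m \<Longrightarrow> y \<in> ?D" for t y
  proof (induction t arbitrary: y)
    case 0
    then show ?case using pm.subspace_0[OF D] by simp
  next
    case (Suc t)
    note y = Suc.prems(2)
    show ?case
    proof (cases "(d1 ^^ t) y = 0")
      case True
      then show ?thesis using Suc.IH y by blast
    next
      case False
      have tm: "t \<le> m"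
      proof (rule ccontr)
        assume "\<not> t \<le> m"
        then show False
          using False d1_pow_zero_mono[of "Suc m" t y] d1_pow_top[OF gm] y by simp
      qed
      define n where "n = m - t"
      have gn: "nondeg n" using nondeg_le[OF gm] by (simp add: n_def)
      define c where "c = top_coef n ((d1 ^^ t) y)"
      have dt: "(d1 ^^ t) y = scale c (P Q n)"
        unfolding c_def n_def using d1_zero[OF gn[unfolded n_def]] d1_pow_U[OF gm _ tm] Suc.prems by simp
      then have c: "c \<noteq> 0" using False by auto
      have mun: "mu n = - 1"
        using scale_P_in_ker[OF gn c] ker_d1_pow[of y t] y dt by simp
      define \<theta> where "\<theta> = qn (Suc t) q * (1 - q ^ (2 * m - t) * r ^ 2)"
      have Tn: "T n (Suc m) = q ^ (2 * m - t) * r ^ 2"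
        using tm by (simp add: n_def mult_2)
      have ay: "d1 (ad y) \<in> ?D" using ad_rels[OF g y] by blast
      show ?thesis
      proof (cases "\<theta> = 0")
        case False
        let ?v = "d1 (ad y) - scale \<theta> y"
        have vK: "?v \<in> rels m"
          using d1_rels[OF g ad_rels[OF g y]] y
          by (intro pm.subspace_diff[OF subspace_rels] pm.subspace_scale[OF subspace_rels])
        have "(d1 ^^ t) ?v = (d1 ^^ Suc t) (ad y) - scale \<theta> ((d1 ^^ t) y)"
          by (simp add: pmp.linear_diff[OF lin_d1_pow] pmp.linear_scale[OF lin_d1_pow] funpow_swap1)
        also have "\<dots> = 0"
          using d1_pow_ad[OF g _ tm, of y] y Suc.prems(1) unfolding \<theta>_def
          by (simp add: pmp.linear_0)
        finally have "?v \<in> ?D" using Suc.IH vK by blast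
        then have "scale (1 / \<theta>) (d1 (ad y) - ?v) \<in> ?D"
          by (rule pm.subspace_scale[OF D pm.subspace_diff[OF D ay]])
        then show ?thesis using False by (simp only: diff_diff_eq2 add_diff_cancel_left' pm.scale_scale) simp
      next
        case True
        have "qn (Suc t) q \<noteq> 0" using nondeg_qn[OF g, of "Suc t"] tm by simp
        then have T1: "T n (Suc m) = 1" unfolding Tn using True by (simp add: \<theta>_def)
        have nM: "n < Suc m" by (simp add: n_def)
        have q1: "q \<noteq> 1" by (rule q_ne_1[OF M g mun nM T1])
        have nJ: "n \<in> JJ" by (rule in_JJ[OF M g mun nM T1])
        have M': "n + Suc t = Suc m" using tm by (simp add: n_def)
        have g': "nondeg (n + Suc t)" "nondeg (n + t)" using g gm M' by auto
        let ?z = "(ad ^^ t) (P Q n)"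
        have "?z \<in> d1 ` rels (n + Suc t)"
          using ad_pow_P_in_d1_image_iff[OF g'(1) mun] JJ_mu[OF M] JJ_compat[OF M nJ nM] M' by simp
        then have zD: "?z \<in> ?D" using M' by simp
        have zK: "?z \<in> rels m"
          using ad_pow_rels[OF g'(2), of "P Q n"] P_in_rels_iff[OF gn] mun M' by simp
        define e where "e = (\<Prod>i<t. qn (Suc i) q * (1 - q ^ (2 * n + i) * r ^ 2))"
        have e: "e \<noteq> 0" unfolding e_def using prod_T_nz[OF g'(1) q1] T1 M' by simp
        have dz: "(d1 ^^ t) ?z = scale e (P Q n)"
          unfolding e_def by (rule d1_pow_ad_pow_P[OF g'(2)])
        let ?v = "y - scale (c / e) ?z"
        have "(d1 ^^ t) ?v = 0"
          using e by (simp add: pmp.linear_diff[OF lin_d1_pow] pmp.linear_scale[OF lin_d1_pow] dt dz)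
        moreover have "?v \<in> rels m"
          using y zK by (intro pm.subspace_diff[OF subspace_rels] pm.subspace_scale[OF subspace_rels])
        ultimately have "?v \<in> ?D" using Suc.IH by blast
        then have "?v + scale (c / e) ?z \<in> ?D"
          using zD D by (intro pm.subspace_add pm.subspace_scale)
        then show ?thesis by simp
      qed
    qed
  qed
  show "y \<in> rels m \<Longrightarrow> y \<in> ?D"
    using main[of "Suc m" y] d1_pow_top[OF gm, of y] by blast
qed

text \<open>
  Suppose \<open>P\<^sub>m\<^sub>+\<^sub>1 = ad x\<^sub>1(w)\<close>, and let \<open>d\<^sub>1\<^sup>t(w)\<close>, a multiple of \<open>P\<^sub>n\<close>, be the last nonzero power. Then
  \<open>d\<^sub>1\<^bsup>t+1\<^esup>(ad x\<^sub>1(w))\<close> is a multiple of it and vanishes. The scalar is zero only if \<open>T n (m + 1) = 1\<close>, and then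
  \<open>n \<in> \<J>\<close> contradicts \<open>m + 1 \<in> \<J>\<^sub>1\<close>.
\<close>

lemma P_not_in_ad_image:
  assumes M: "Suc m \<in> J1 q r s" and g: "nondeg (Suc m)"
  shows "P Q (Suc m) \<notin> ad ` rels m"
proof
  assume "P Q (Suc m) \<in> ad ` rels m"
  then obtain w where w: "w \<in> rels m" "ad w = P Q (Suc m)" by auto
  have gm: "nondeg m" using nondeg_pred[OF g] .
  have "w \<noteq> 0" using w P_ne_0[OF g] by (auto simp: pmp.linear_0)
  then obtain t c where t: "t \<le> m" "(d1 ^^ Suc t) w = 0" "c \<noteq> 0" "(d1 ^^ t) w = scale c (P Q (m - t))"
    using depth[OF gm, of w] w by blast
  have gn: "nondeg (m - t)" using nondeg_le[OF gm] by simp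
  have mu: "mu (m - t) = - 1"
    using scale_P_in_ker[OF gn t(3)] ker_d1_pow[of w t] w t(4) by simp
  have "(d1 ^^ Suc t) (ad w) = 0"
    unfolding w(2) funpow_Suc_right o_apply d1_P[OF g] by (rule pmp.linear_0[OF lin_d1_pow])
  then have "scale (qn (Suc t) q * (1 - q ^ (2 * m - t) * r ^ 2) * c) (P Q (m - t)) = 0"
    using d1_pow_ad[OF g _ t(1), of w] w t(2,4) by (simp add: pmp.linear_0)
  then have "q ^ (2 * m - t) * r ^ 2 = 1"
    using P_ne_0[OF gn] t(1,3) nondeg_qn[OF g, of "Suc t"] by simp
  then have T: "T (m - t) (Suc m) = 1" using t(1) by (simp add: mult_2)
  have "m - t \<in> JJ"
    using in_JJ[OF _ g mu _ T] M J1_iff by auto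
  then show False using M T unfolding J1_iff by auto
qed

lemma j_of_spec:
  assumes M: "Suc m \<in> J2 q r s" and g: "nondeg (Suc m)"
  shows "j_of Q (Suc m) \<in> JJ" "j_of Q (Suc m) \<le> m" "T (j_of Q (Suc m)) (Suc m) = 1" "q \<noteq> 1"
proof -
  obtain n where n: "n \<in> JJ" "n < Suc m" "T n (Suc m) = 1" and MJ: "Suc m \<in> JJ"
    using M J2_iff by blast
  show q1: "q \<noteq> 1" using q_ne_1[OF MJ g JJ_mu[OF n(1)] n(2,3)] .
  have "\<exists>!j. j \<in> JJ \<and> j < Suc m \<and> q ^ (Suc m + j - 1) * r ^ 2 = 1"
  proof (rule ex1I[of _ n])
    show "n \<in> JJ \<and> n < Suc m \<and> q ^ (Suc m + n - 1) * r ^ 2 = 1"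
      using n by (simp add: add.commute)
    fix j assume "j \<in> JJ \<and> j < Suc m \<and> q ^ (Suc m + j - 1) * r ^ 2 = 1"
    then show "j = n"
      using T_unique[OF g q1, of j n] n by (simp add: add.commute)
  qed
  then have "j_of Q (Suc m) \<in> JJ \<and> j_of Q (Suc m) < Suc m \<and> q ^ (Suc m + j_of Q (Suc m) - 1) * r ^ 2 = 1"
    unfolding j_of_def by (rule theI')
  then show "j_of Q (Suc m) \<in> JJ" "j_of Q (Suc m) \<le> m" "T (j_of Q (Suc m)) (Suc m) = 1"
    by (simp_all add: add.commute)
qed

text \<open>
  A preimage under \<open>d\<^sub>1\<close> exists by \<open>d1_surj\<close>. It is unique up to multiples of \<open>P\<^sub>m\<^sub>+\<^sub>1\<close>, whose last
  coordinate is \<open>1\<close>, so membership in \<open>U'\<^sub>m\<^sub>+\<^sub>1\<close> (last coordinate zero) singles out one preimage.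
\<close>

lemma L_spec:
  assumes M: "Suc m \<in> J2 q r s" and g: "nondeg (Suc m)"
  defines "n \<equiv> j_of Q (Suc m)"
  shows "L Q (Suc m) \<in> rels (Suc m)" "d1 (L Q (Suc m)) = scale (- q21) ((ad ^^ (m - n)) (P Q n))"
proof -
  have MJ: "Suc m \<in> JJ" using M J2_iff by blast
  have gm: "nondeg m" using nondeg_pred[OF g] .
  have n: "n \<in> JJ" "n \<le> m" using j_of_spec[OF M g] by (simp_all add: n_def)
  have gn: "nondeg n" using nondeg_le[OF gm] n by simp
  let ?z = "(ad ^^ (m - n)) (P Q n)"
  have "?z \<in> rels m"
    using ad_pow_rels[of n "m - n" "P Q n"] P_in_rels_iff[OF gn] JJ_mu[OF n(1)] n(2) gm by simp
  then have "scale (- q21) ?z \<in> rels m" by (rule pm.subspace_scale[OF subspace_rels])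
  then obtain y0 where y0: "y0 \<in> rels (Suc m)" "d1 y0 = scale (- q21) ?z"
    using d1_surj[OF MJ g] by (metis imageE)
  \<comment> \<open>Normalises the last coordinate to zero, without changing \<open>d\<^sub>1\<close>.\<close>
  define y where "y = y0 - scale (top_coef (Suc m) y0) (P Q (Suc m))"
  have y: "y \<in> rels (Suc m)"
    unfolding y_def using y0(1) P_in_rels_iff[OF g] JJ_mu[OF MJ]
    by (intro pm.subspace_diff[OF subspace_rels] pm.subspace_scale[OF subspace_rels]) simp_all
  have dy: "d1 y = scale (- q21) ?z"
    by (simp add: y_def pmp.linear_diff d1_scale d1_P[OF g] y0(2))
  have ty: "top_coef (Suc m) y = 0"
    by (simp add: y_def top_coef_diff top_coef_scale top_coef_P[OF g])
  have "y \<in> U' Q (Suc m)"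
    using y ty top_coef_Phi[OF g] by (auto simp: U'_eq[OF g] U_eq[OF g])
  define R where "R x \<longleftrightarrow> x \<in> U' Q (Suc m) \<inter> ker_pi Q \<and> scale (- inverse q21) (d1 x) = ?z" for x
  have "R y"
    using \<open>y \<in> U' Q (Suc m)\<close> y by (simp add: R_def dy)
  moreover have "x = y" if "R x" for x
  proof -
    have x: "x \<in> U Q (Suc m)" "top_coef (Suc m) x = 0"
      using that top_coef_Phi[OF g] by (auto simp: R_def U'_eq[OF g] U_eq[OF g])
    have "scale (- q21) (scale (- inverse q21) (d1 x)) = scale (- q21) ?z"
      using that by (simp only: R_def)
    then have "d1 x = scale (- q21) ?z" by simp
    then have "d1 (x - y) = 0" by (simp add: pmp.linear_diff dy)
    moreover have "x - y \<in> U Q (Suc m)" using x y by (intro pm.subspace_diff[OF subspace_U]) simp_all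
    moreover have "top_coef (Suc m) (x - y) = 0" by (simp add: top_coef_diff x ty)
    ultimately show ?thesis using d1_zero[OF g, of "x - y"] by simp
  qed
  ultimately have "(THE x. R x) = y" by (intro the_equality)
  then have "L Q (Suc m) = y"
    unfolding L_def R_def n_def by simp
  then show "L Q (Suc m) \<in> rels (Suc m)" "d1 (L Q (Suc m)) = scale (- q21) ?z"
    using y dy by simp_all
qed

text \<open>
  Suppose \<open>L\<^sub>m\<^sub>+\<^sub>1 = ad x\<^sub>1(w)\<close> with last nonzero power \<open>d\<^sub>1\<^sup>t(w)\<close>, and let \<open>z = (ad x\<^sub>1)\<^sup>k(P\<^sub>n)\<close> with
  \<open>k = m - n\<close>, so that \<open>d\<^sub>1(ad x\<^sub>1(w))\<close> is a nonzero multiple of \<open>z\<close>. Then \<open>d\<^sub>1\<^bsup>t+1\<^esup>(z) = 0\<close>, whereas the last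
  nonzero power on \<open>z\<close> is \<open>d\<^sub>1\<^sup>k\<close>. So \<open>k \<le> t\<close>. For \<open>t = k\<close> the scalar by which \<open>d\<^sub>1 \<circ> ad x\<^sub>1\<close> acts on
  the leading term of \<open>w\<close> vanishes, which would give \<open>d\<^sub>1\<^sup>k(z) = 0\<close>. For \<open>t > k\<close> it vanishes
  as well, which determines \<open>m - t\<close> to be \<open>n\<close>, in contrast to \<open>t > k\<close>.
\<close>

lemma L_not_in_ad_image:
  assumes M: "Suc m \<in> J2 q r s" and g: "nondeg (Suc m)"
  shows "L Q (Suc m) \<notin> ad ` rels m"
proof
  assume "L Q (Suc m) \<in> ad ` rels m"
  then obtain w where w: "w \<in> rels m" "ad w = L Q (Suc m)" by auto
  define n where "n = j_of Q (Suc m)"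
  define k where "k = m - n"
  have n: "n \<in> JJ" "n \<le> m" "T n (Suc m) = 1" and q1: "q \<noteq> 1"
    using j_of_spec[OF M g] by (simp_all add: n_def)
  have nk: "n + k = m" using n by (simp add: k_def)
  have gm: "nondeg m" using nondeg_pred[OF g] .
  have gn: "nondeg n" using nondeg_le[OF gm] n by simp
  let ?z = "(ad ^^ k) (P Q n)"
  have dL: "d1 (ad w) = scale (- q21) ?z"
    using L_spec(2)[OF M g] by (simp add: w n_def k_def)
  have zne: "?z \<noteq> 0"
    using ad_pow_eq_0[of n k "P Q n"] nk gm P_in_U[OF gn] P_ne_0[OF gn] by auto
  have "w \<noteq> 0"
  proof
    assume "w = 0"
    then have "scale (- q21) ?z = 0" using dL by (simp add: pmp.linear_0)
    then show False using zne by simp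
  qed
  then obtain t c where t: "t \<le> m" "(d1 ^^ Suc t) w = 0" "c \<noteq> 0" "(d1 ^^ t) w = scale c (P Q (m - t))"
    using depth[OF gm, of w] w by blast
  have gt: "nondeg (m - t)" using nondeg_le[OF gm] by simp
  define \<theta> where "\<theta> = qn (Suc t) q * (1 - q ^ (2 * m - t) * r ^ 2)"
  have dz: "(d1 ^^ t) (scale (- q21) ?z) = scale (\<theta> * c) (P Q (m - t))"
    using d1_pow_ad[OF g _ t(1), of w] w t(2,4) unfolding \<theta>_def dL[symmetric]
    by (simp add: pmp.linear_0 funpow_swap1)
  then have dz1: "(d1 ^^ Suc t) (scale (- q21) ?z) = 0"
    by (simp add: d1_scale d1_P[OF gt])
  have gk: "nondeg (n + Suc k)" "nondeg (n + k)" using g gm nk by simp_all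
  have "T n (n + Suc k) = 1" using n(3) nk by simp
  note e = prod_T_nz[OF gk(1) q1 this]
  have dk: "(d1 ^^ k) (scale (- q21) ?z) \<noteq> 0"
    unfolding pmp.linear_scale[OF lin_d1_pow] d1_pow_ad_pow_P[OF gk(2)]
    using e P_ne_0[OF gn] by simp
  have dk1: "(d1 ^^ Suc k) (scale (- q21) ?z) = 0"
    unfolding pmp.linear_scale[OF lin_d1_pow] funpow.simps o_apply d1_pow_ad_pow_P[OF gk(2)]
      d1_scale d1_P[OF gn] by simp
  have "k \<le> t"
    using dk d1_pow_zero_mono[OF _ dz1, of k] by (metis not_less_eq_eq)
  then consider "t = k" | "k < t" by linarith
  then show False
  proof cases
    case 1
    have "2 * m - t = n + Suc m - 1" using 1 nk by simp
    then have "\<theta> = 0" using n(3) by (simp add: \<theta>_def)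
    then show False using dk dz 1 by simp
  next
    case 2
    then have "scale (\<theta> * c) (P Q (m - t)) = 0"
      using dz d1_pow_zero_mono[OF _ dk1, of t] by (metis Suc_leI)
    then have "q ^ (2 * m - t) * r ^ 2 = 1"
      using P_ne_0[OF gt] t(1,3) nondeg_qn[OF g, of "Suc t"] by (simp add: \<theta>_def)
    then have "T (m - t) (Suc m) = 1" using t(1) by (simp add: mult_2)
    then have "m - t = n" using T_unique[OF g q1 _ _ _ n(3)] n(2) by simp
    then show False using 2 nk t(1) by simp
  qed
qed

section \<open>Dimension bounds\<close>

text \<open>
  The map \<open>y \<mapsto> d\<^sub>1(y) + top_coef(y) z\<close> is injective on the relations in degree \<open>m + 1\<close> by hypothesis, and its
  values lie in the span of \<open>B\<close> and \<open>z\<close>. Different choices of \<open>z\<close> give the bounds below.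
\<close>

lemma card_independent_rels:
  assumes g: "nondeg (Suc m)" and B: "finite B" "rels m \<subseteq> pm.span B"
    and z: "\<And>y. y \<in> rels (Suc m) \<Longrightarrow> d1 y + scale (top_coef (Suc m) y) z = 0 \<Longrightarrow> y = 0"
    and R: "pm.independent R" "R \<subseteq> rels (Suc m)"
  shows "card R \<le> card (insert z B)" and "z \<in> rels m \<Longrightarrow> card R \<le> card B"
proof -
  define E where "E y = d1 y + scale (top_coef (Suc m) y) z" for y
  have E: "lin E"
    by (rule linI) (simp_all add: E_def pmp.linear_add d1_scale top_coef_add top_coef_scale
        pm.scale_left_distrib pm.scale_right_distrib)
  have sR: "pm.span R \<subseteq> rels (Suc m)"
    using R subspace_rels by (intro pm.span_minimal)
  have inj: "inj_on E (pm.span R)"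
  proof (rule inj_onI)
    fix x y assume xy: "x \<in> pm.span R" "y \<in> pm.span R" "E x = E y"
    then have "E (x - y) = 0" by (simp add: pmp.linear_diff[OF E])
    moreover have "x - y \<in> rels (Suc m)" using xy sR pm.span_diff by blast
    ultimately show "x = y" using z[of "x - y"] by (simp add: E_def)
  qed
  have ind: "pm.independent (E ` R)"
    using pmp.linear_independent_injective_image[OF E R(1) inj] .
  have "inj_on E R" using inj pm.span_superset by (rule inj_on_subset)
  then have c: "card (E ` R) = card R" by (rule card_image)
  have d: "d1 y \<in> pm.span B" if "y \<in> R" for y
    using that R(2) d1_rels[OF g] B(2) by blast
  have "E ` R \<subseteq> pm.span (insert z B)"
  proof
    fix x assume "x \<in> E ` R"
    then obtain y where y: "y \<in> R" "x = E y" by blast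
    have "d1 y \<in> pm.span (insert z B)" using d[OF y(1)] pm.span_mono[of B "insert z B"] by blast
    then show "x \<in> pm.span (insert z B)"
      unfolding y E_def by (intro pm.span_add pm.span_scale) (auto intro: pm.span_base)
  qed
  then show "card R \<le> card (insert z B)"
    using pm.independent_span_bound[OF _ ind] B(1) c by auto
  assume "z \<in> rels m"
  then have "E ` R \<subseteq> pm.span B"
    using B(2) d unfolding E_def by (auto intro!: pm.span_add pm.span_scale)
  then show "card R \<le> card B"
    using pm.independent_span_bound[OF B(1) ind] c by auto
qed

lemma d1_top_zero:
  "nondeg m \<Longrightarrow> y \<in> U Q m \<Longrightarrow> d1 y = 0 \<Longrightarrow> top_coef m y = 0 \<Longrightarrow> y = 0"
  using d1_zero[of m y] by simp

text \<open>
  Any \<open>z\<close> outside \<open>U\<^sub>m\<close> makes the map of \<open>card_independent_rels\<close> injective; the unit of the tensor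
  algebra is one.
\<close>

lemma card_rels_le_Suc:
  assumes g: "nondeg (Suc m)" and B: "finite B" "pm.span B = rels m"
    and R: "pm.independent R" "R \<subseteq> rels (Suc m)"
  shows "card R \<le> Suc (card B)"
proof -
  have gm: "nondeg m" using nondeg_pred[OF g] .
  have one: "(1 :: 'k tensor_alg) \<notin> U Q m"
  proof
    assume "(1 :: 'k tensor_alg) \<in> U Q m"
    then obtain c where "Phi m c = 1" using gm by (auto simp: U_eq)
    then have "counit (1 :: 'k tensor_alg) = 0"
      using counit_homog[OF homog_Phi[OF gm, of c]] by simp
    moreover have "counit (1 :: 'k tensor_alg) = 1"
      using counit_mon[of "[]"] by (simp add: mon_Nil)
    ultimately show False by simp
  qed
  have "card R \<le> card (insert 1 B)"
  proof (rule card_independent_rels(1)[OF g B(1) _ _ R])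
    show "rels m \<subseteq> pm.span B" using B by simp
    fix y assume y: "y \<in> rels (Suc m)" and 0: "d1 y + scale (top_coef (Suc m) y) 1 = 0"
    let ?t = "top_coef (Suc m) y"
    have t: "?t = 0"
    proof (rule ccontr)
      assume "?t \<noteq> 0"
      then have "1 = scale (- 1 / ?t) (d1 y)"
        using 0 by (simp add: eq_neg_iff_add_eq_0[symmetric])
      also have "\<dots> \<in> U Q m"
        using y d1_U[OF g] by (intro pm.subspace_scale[OF subspace_U]) simp
      finally show False using one by simp
    qed
    then show "y = 0" using 0 y d1_top_zero[OF g, of y] by simp
  qed
  also have "\<dots> \<le> Suc (card B)" by (rule card_insert_le_m1) (auto simp: card_insert_if B)
  finally show ?thesis .
qed

text \<open>
  If \<open>\<mu>\<^sub>m\<^sub>+\<^sub>1 \<noteq> -1\<close>, then \<open>d\<^sub>1\<close> itself is injective and \<open>z = 0\<close> will do. Otherwise \<open>m + 1\<close> is excluded from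
  \<open>\<J>\<close> by some \<open>n \<in> \<J>\<close>, and \<open>z = (ad x\<^sub>1)\<^bsup>m-n\<^esup>(P\<^sub>n)\<close> is a relation in degree \<open>m\<close> outside the image
  of \<open>d\<^sub>1\<close>.
\<close>

lemma card_rels_le:
  assumes M: "Suc m \<notin> JJ" and g: "nondeg (Suc m)" and B: "finite B" "pm.span B = rels m"
    and R: "pm.independent R" "R \<subseteq> rels (Suc m)"
  shows "card R \<le> card B"
proof -
  have gm: "nondeg m" using nondeg_pred[OF g] .
  have KB: "rels m \<subseteq> pm.span B" using B by simp
  show ?thesis
  proof (cases "mu (Suc m) = - 1")
    case False
    show ?thesis
    proof (rule card_independent_rels(2)[OF g B(1) KB _ R])
      show "0 \<in> rels m" by (rule pm.subspace_0[OF subspace_rels])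
      fix y assume y: "y \<in> rels (Suc m)" and "d1 y + scale (top_coef (Suc m) y) 0 = 0"
      then have e: "y = scale (top_coef (Suc m) y) (P Q (Suc m))" using d1_zero[OF g, of y] by simp
      have "top_coef (Suc m) y = 0"
        using scale_P_in_ker[OF g, of "top_coef (Suc m) y"] False y e by fastforce
      then show "y = 0" using e by simp
    qed
  next
    case True
    then obtain n where n: "n \<in> JJ" "n < Suc m" "\<not> compat n (Suc m)"
      using M in_JJ_iff[of "Suc m"] by blast
    have mun: "mu n = - 1" using JJ_mu n by blast
    define k where "k = m - n"
    have M': "n + Suc k = Suc m" "n + k = m" using n by (simp_all add: k_def)
    have gn: "nondeg n" using nondeg_le[OF gm] n by simp
    let ?z = "(ad ^^ k) (P Q n)"
    have zD: "?z \<notin> d1 ` rels (Suc m)"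
      using ad_pow_P_in_d1_image_iff[of n k] g mun True n(3) M' by simp
    have zK: "?z \<in> rels m"
      using ad_pow_rels[of n k "P Q n"] P_in_rels_iff[OF gn] mun M' gm by simp
    show ?thesis
    proof (rule card_independent_rels(2)[OF g B(1) KB _ R zK])
      fix y assume y: "y \<in> rels (Suc m)" and 0: "d1 y + scale (top_coef (Suc m) y) ?z = 0"
      let ?t = "top_coef (Suc m) y"
      have t: "?t = 0"
      proof (rule ccontr)
        assume t: "?t \<noteq> 0"
        then have "?z = scale (- 1 / ?t) (d1 y)"
          using 0 by (simp add: eq_neg_iff_add_eq_0[symmetric])
        also have "\<dots> = d1 (scale (- 1 / ?t) y)" by (rule d1_scale[symmetric])
        also have "\<dots> \<in> d1 ` rels (Suc m)"
          using pm.subspace_scale[OF subspace_rels y] by blast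
        finally show False using zD by simp
      qed
      then show "y = 0" using 0 y d1_top_zero[OF g, of y] by simp
    qed
  qed
qed

section \<open>The basis\<close>

abbreviation fam :: "nat \<Rightarrow> nat + nat \<Rightarrow> 'k tensor_alg" where
  "fam m \<equiv> case_sum (\<lambda>j. (ad ^^ (m - j)) (P Q j)) (\<lambda>n. (ad ^^ (m - n)) (L Q n))"

abbreviation idx :: "nat \<Rightarrow> (nat + nat) set" where
  "idx m \<equiv> {j \<in> J1 q r s. j \<le> m} <+> {n \<in> J2 q r s. n \<le> m}"

lemma finite_idx: "finite (idx m)"
  by (intro finite_Plus) (rule finite_subset[of _ "{..m}"]; auto)+

lemma fam_Suc: "x \<in> idx m \<Longrightarrow> fam (Suc m) x = ad (fam m x)"
  by (auto simp: Suc_diff_le)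

lemma J1_J2_disjoint: "j \<in> J1 q r s \<Longrightarrow> j \<notin> J2 q r s"
  unfolding J1_iff J2_iff by blast

lemma J1_or_J2: "j \<in> JJ \<Longrightarrow> j \<in> J1 q r s \<or> j \<in> J2 q r s"
  unfolding J1_iff J2_iff by blast

text \<open>
  From \<open>m\<close> to \<open>m + 1\<close>, all members of the family are replaced by their images under the injective map
  \<open>ad x\<^sub>1\<close>. For \<open>m + 1 \<notin> \<J>\<close> the dimension bound shows that they still span; for \<open>m + 1 \<in> \<J>\<close> one new
  vector is added, and the weaker bound suffices.
\<close>

lemma basis_rels: "nondeg m \<Longrightarrow> basis_family (fam m) (idx m) (rels m)"
proof (induction m)
  case 0
  have J2: "0 \<notin> J2 q r s" by (simp add: J2_iff)
  have line: "y = scale (top_coef 0 y) (P Q 0)" if "y \<in> rels 0" for y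
    using that d1_zero[of 0 y] d1_U_0[of y] by simp
  show ?case
  proof (cases "mu 0 = - 1")
    case True
    then have "0 \<in> J1 q r s" unfolding J1_iff by (subst in_JJ_iff) simp
    then have "idx 0 = {Inl 0}" using J2 by (auto simp: Plus_def)
    moreover have "rels 0 = pm.span {P Q 0}"
    proof
      show "pm.span {P Q 0} \<subseteq> rels 0"
        using P_in_rels_iff[of 0] True by (intro pm.span_minimal subspace_rels) simp
      show "rels 0 \<subseteq> pm.span {P Q 0}"
        using line by (metis insertI1 pm.span_base pm.span_scale subsetI)
    qed
    ultimately show ?thesis
      using P_ne_0[of 0] by (simp add: basis_family_def)
  next
    case False
    then have i: "idx 0 = {}" using J2 JJ_mu[of 0] by (auto simp: Plus_def J1_iff)
    have K: "rels 0 = {0}"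
    proof -
      have "y = 0" if y: "y \<in> rels 0" for y
      proof -
        have "top_coef 0 y = 0"
          using scale_P_in_ker[of 0 "top_coef 0 y"] False y line[OF y] by fastforce
        then show ?thesis using line[OF y] by simp
      qed
      then show ?thesis using pm.subspace_0[OF subspace_rels, of 0] by blast
    qed
    show ?thesis unfolding basis_family_def i K by (simp add: pm.independent_empty)
  qed
next
  case (Suc m)
  note g = Suc.prems
  have gm: "nondeg m" using nondeg_pred[OF g] .
  note b = Suc.IH[OF gm]
  have bs: "finite (fam m ` idx m)" "pm.span (fam m ` idx m) = rels m" "card (fam m ` idx m) = card (idx m)"
    using b finite_idx by (simp_all add: basis_family_def card_image)
  have inj: "inj_on ad (rels m)"
  proof (rule inj_onI)
    fix x y assume xy: "x \<in> rels m" "y \<in> rels m" "ad x = ad y"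
    then have "x - y \<in> U Q m" by (intro pm.subspace_diff[OF subspace_U]) simp_all
    moreover have "ad (x - y) = 0" using xy by (simp add: pmp.linear_diff)
    ultimately show "x = y" using ad_eq_0[OF g, of "x - y"] by simp
  qed
  have im: "ad ` rels m \<subseteq> rels (Suc m)" using ad_rels[OF g] by blast
  note step = b finite_idx subspace_rels lin_ad_x1 inj im fam_Suc
  have ins: "basis_family (fam (Suc m)) (insert a (idx m)) (rels (Suc m))"
    if "a \<notin> idx m" "fam (Suc m) a \<in> rels (Suc m)" "fam (Suc m) a \<notin> ad ` rels m" for a
    using card_rels_le_Suc[OF g bs(1,2)] bs(3) that
    by (intro basis_family_step_insert[OF step]) simp_all
  show ?case
  proof (cases "Suc m \<in> JJ")
    case False
    then have "idx (Suc m) = idx m"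
      using J1_iff J2_iff by (auto simp: le_Suc_eq Plus_def)
    moreover have "basis_family (fam (Suc m)) (idx m) (rels (Suc m))"
      using card_rels_le[OF False g bs(1,2)] bs(3)
      by (intro basis_family_step_same[OF step]) simp_all
    ultimately show ?thesis by simp
  next
    case True
    then consider "Suc m \<in> J1 q r s" "Suc m \<notin> J2 q r s" | "Suc m \<in> J2 q r s" "Suc m \<notin> J1 q r s"
      using J1_or_J2 J1_J2_disjoint by blast
    then show ?thesis
    proof cases
      case 1
      have "idx (Suc m) = insert (Inl (Suc m)) (idx m)"
        using 1 by (auto simp: le_Suc_eq Plus_def)
      moreover have "P Q (Suc m) \<in> rels (Suc m)" using P_in_rels_iff[OF g] JJ_mu[OF True] by blast
      moreover have "Inl (Suc m) \<notin> idx m" by auto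
      ultimately show ?thesis
        using ins[of "Inl (Suc m)"] P_not_in_ad_image[OF 1(1) g] by simp
    next
      case 2
      have "idx (Suc m) = insert (Inr (Suc m)) (idx m)"
        using 2 by (auto simp: le_Suc_eq Plus_def)
      moreover have "Inr (Suc m) \<notin> idx m" by auto
      ultimately show ?thesis
        using ins[of "Inr (Suc m)"] L_spec(1)[OF 2(1) g] L_not_in_ad_image[OF 2(1) g] by simp
    qed
  qed
qed

end

theorem theorem1p1:
  fixes Q :: "gen \<Rightarrow> gen \<Rightarrow> 'k::field" and m :: nat
  assumes "\<And>i j. Q i j \<noteq> 0"
    and "qfact m (qq Q) * bcoef (qq Q) (rr Q) m \<noteq> 0"
  shows "basis_family
    (case_sum (\<lambda>j. (ad_x1 Q ^^ (m - j)) (P Q j)) (\<lambda>n. (ad_x1 Q ^^ (m - n)) (L Q n)))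
    ({j \<in> J1 (qq Q) (rr Q) (ss Q). j \<le> m} <+> {n \<in> J2 (qq Q) (rr Q) (ss Q). n \<le> m})
    (ker_pi Q \<inter> U Q m)"
proof -
  interpret diagonal_braiding Q
    using assms(1) by unfold_locales
  show ?thesis
    using basis_rels[of m] assms(2) by (simp add: norm_fac_def)
qed

end
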